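(* Let $d\ge 1$ and let $V\ge 0$ be a Borel measure on $\mathbb{R}^d$ with $V(\{0\})=0$, $V\neq 0$, $\int_{\mathbb{R}^d}\min(|x|^2,1)\,V(dx)<\infty$, and $V$ symmetric, i.e. $V(-B)=V(B)$ for all Borel $B$. Let $\phi:\mathbb{R}^d\to\mathbb{C}$ be Borel measurable, symmetric ($\phi(-z)=\phi(z)$), with $|\phi(z)|\le 1$ for all $z\in\mathbb{R}^d$. Define $$M(\xi)=\frac{\int_{\mathbb{R}^d}(\cos(\xi\cdot z)-1)\,\phi(z)\,V(dz)}{\int_{\mathbb{R}^d}(\cos(\xi\cdot z)-1)\,V(dz)},\qquad \xi\in\mathbb{R}^d,$$ with $M(\xi)=0$ whenever the denominator vanishes, and define the operator $\mathcal{M}$ on $L^2(\mathbb{R}^d)$ by $\widehat{\mathcal{M}f}(\xi)=M(\xi)\hat f(\xi)$. Then for every $1<p<\infty$, $\mathcal{M}$ has a unique bounded linear extension to $L^p(\mathbb{R}^d)$, and $$\|\mathcal{M}f\|_p\le (p^*-1)\|f\|_p,\qquad f\in L^p(\mathbb{R}^d),$$ where $p^*=\max(p,q)$ with $q=p/(p-1)$.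
   Context: The Fourier transform is $\hat g(\xi)=\int_{\mathbb{R}^d}e^{i\xi\cdot z}g(z)\,dz$ for $g\in L^1(\mathbb{R}^d)$, extended to $L^2(\mathbb{R}^d)$ by Plancherel. $L^p(\mathbb{R}^d)$ denotes complex-valued functions with respect to Lebesgue measure. *)

theory Defs
  imports "HOL-Analysis.Analysis"
begin

definition in_Lp :: "real \<Rightarrow> ('a::euclidean_space \<Rightarrow> complex) \<Rightarrow> bool" where
  "in_Lp p f \<longleftrightarrow> f \<in> borel_measurable lborel \<and>
     (\<integral>\<^sup>+x. ennreal (cmod (f x) powr p) \<partial>lborel) < \<infinity>"

definition Lp_norm :: "real \<Rightarrow> ('a::euclidean_space \<Rightarrow> complex) \<Rightarrow> real" where
  "Lp_norm p f = enn2real (\<integral>\<^sup>+x. ennreal (cmod (f x) powr p) \<partial>lborel) powr (1 / p)"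

definition ae_eq :: "('a::euclidean_space \<Rightarrow> complex) \<Rightarrow> ('a \<Rightarrow> complex) \<Rightarrow> bool" where
  "ae_eq f g \<longleftrightarrow> (AE x in lborel. f x = g x)"

definition fourier :: "('a::euclidean_space \<Rightarrow> complex) \<Rightarrow> 'a \<Rightarrow> complex" where
  "fourier g \<xi> = (\<integral>z. cis (\<xi> \<bullet> z) * g z \<partial>lborel)"

text \<open>Plancherel extension to L^2: h is (a representative of) the L^2 Fourier transform of f,
  i.e. the L^2-limit of the Fourier transforms of the truncations f * 1_{|z| \<le> n}.\<close>
definition L2_fourier :: "('a::euclidean_space \<Rightarrow> complex) \<Rightarrow> ('a \<Rightarrow> complex) \<Rightarrow> bool" where
  "L2_fourier f h \<longleftrightarrow> in_Lp 2 f \<and> in_Lp 2 h \<and>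
     ((\<lambda>n::nat. \<integral>\<^sup>+\<xi>. ennreal ((cmod (fourier (\<lambda>z. indicator (cball 0 (real n)) z * f z) \<xi> - h \<xi>))\<^sup>2) \<partial>lborel)
        \<longlonglongrightarrow> 0)"

definition mult_symbol :: "'a::euclidean_space measure \<Rightarrow> ('a \<Rightarrow> complex) \<Rightarrow> 'a \<Rightarrow> complex" where
  "mult_symbol V \<phi> \<xi> =
     (let den = (\<integral>z. (cos (\<xi> \<bullet> z) - 1) \<partial>V)
      in if den = 0 then 0
         else (\<integral>z. complex_of_real (cos (\<xi> \<bullet> z) - 1) * \<phi> z \<partial>V) / complex_of_real den)"

definition mult_op :: "('a::euclidean_space \<Rightarrow> complex) \<Rightarrow> ('a \<Rightarrow> complex) \<Rightarrow> ('a \<Rightarrow> complex) \<Rightarrow> bool" where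
  "mult_op m f u \<longleftrightarrow> (\<exists>F. L2_fourier f F \<and> L2_fourier u (\<lambda>\<xi>. m \<xi> * F \<xi>))"

definition Lp_bounded_linear :: "real \<Rightarrow> (('a::euclidean_space \<Rightarrow> complex) \<Rightarrow> ('a \<Rightarrow> complex)) \<Rightarrow> real \<Rightarrow> bool" where
  "Lp_bounded_linear p T C \<longleftrightarrow>
     (\<forall>f. in_Lp p f \<longrightarrow> in_Lp p (T f) \<and> Lp_norm p (T f) \<le> C * Lp_norm p f) \<and>
     (\<forall>f g. in_Lp p f \<longrightarrow> in_Lp p g \<longrightarrow> ae_eq (T (\<lambda>x. f x + g x)) (\<lambda>x. T f x + T g x)) \<and>
     (\<forall>f c. in_Lp p f \<longrightarrow> ae_eq (T (\<lambda>x. c * f x)) (\<lambda>x. c * T f x))"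

definition extends_mult :: "real \<Rightarrow> ('a::euclidean_space \<Rightarrow> complex) \<Rightarrow> (('a \<Rightarrow> complex) \<Rightarrow> ('a \<Rightarrow> complex)) \<Rightarrow> bool" where
  "extends_mult p m T \<longleftrightarrow> (\<forall>f. in_Lp p f \<and> in_Lp 2 f \<longrightarrow> mult_op m f (T f))"

end

theory Submission
  imports Defs "HOL-Probability.Probability"
begin

text \<open>
  Burkholder's function \<open>U\<close> yields, as a partial Legendre transform, a convex function
  \<open>\<Phi>(x, y) = sup\<^sub>g (Re (g cnj y) - c U(x, g))\<close> with
  \<open>0 \<le> \<Phi>(x, y) \<le> (p\<^sup>* - 1)(|x|\<^sup>p/p + |y|\<^sup>q/q)\<close> whose deviation from any supporting hyperplane is at least
  \<open>|\<Delta>x||\<Delta>y|\<close>. Let \<open>V\<close> be finite, let \<open>Q\<close> be one step of the lazy random walk jumping according to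
  \<open>\<delta>V\<close>, and put \<open>u\<^sub>k = Q\<^sup>k f\<close>, \<open>v\<^sub>k = Q\<^sup>k g\<close>. Jensen's inequality with gain shows that \<open>\<integral>\<Phi>(u\<^sub>k, v\<^sub>k)\<close>
  decreases in \<open>k\<close> by at least
  \<open>\<delta>\<integral>\<integral>|u\<^sub>k(x+z) - u\<^sub>k\<^sub>+\<^sub>1(x)||v\<^sub>k(x+z) - v\<^sub>k\<^sub>+\<^sub>1(x)| V(dz)dx\<close>, so the sum over \<open>k\<close> of these
  quantities is at most \<open>\<integral>\<Phi>(f, g)\<close>. By Plancherel, inserting \<open>\<phi>(z)\<close> turns the corresponding bilinear form
  into a Fourier multiplier which tends to \<open>M\<close> as \<open>\<delta> \<rightarrow> 0\<close> and the number of steps grows. General \<open>V\<close> are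
  exhausted by finite ones, and duality gives the bound on \<open>L\<^sup>p\<close>.
\<close>

section \<open>Burkholder's function and a Bellman function with gain\<close>

text \<open>The sharp constant is that of Burkholder's inequality for martingale transforms. It is
  usually brought in through a Levy process; here a discrete walk replaces stochastic calculus by
  Jensen's inequality for a convex function. The obstacle is that \<open>U\<close> is concave only
  along segments on which the second variable moves no more than the first. The Legendre transform
  in the second variable turns this restriction into profit: the dual point may be split by a vector
  of length |\<Delta>x| in the direction of \<Delta>y, and this produces the gain. The gain is an
  absolute value, so weighting the jumps by \<phi> costs nothing. Increments are measured from the
  mean after the step, which cancels the linear part of the supporting hyperplane. Their symbol is 1
  - 2 r cos + r^2, with r the symbol of Q. Its leading part is 2 (1 - cos), and the 2 disappears in
  the geometric series because 1 - r^2 is close to 2 (1 - r). As only powers of r^2 are summed, r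
  has to stay away from -1, hence the small \<delta>. Rescaling f and g finally turns the sum of
  powers into a product of norms.\<close>

lemma powr_convex_segment:
  fixes a b r s :: real
  assumes "a \<ge> 0" "b \<ge> 0" "r \<ge> 1" "0 \<le> s" "s \<le> 1"
  shows "((1 - s) * a + s * b) powr r \<le> (1 - s) * a powr r + s * b powr r"
proof -
  have shrink: "(t * c) powr r \<le> t * c powr r" if "0 \<le> t" "t \<le> 1" "c \<ge> 0" for t c :: real
  proof -
    have "t powr r \<le> t"
    proof (cases "t = 0")
      case False
      then show ?thesis using that powr_mono'[of 1 r t] assms(3) by simp
    qed auto
    then show ?thesis using that by (simp add: powr_mult mult_right_mono)
  qed
  consider "a = 0" | "b = 0" | "a > 0" "b > 0" using assms by linarith
  then show ?thesis
  proof cases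
    case 1
    then show ?thesis using shrink[of s b] assms by simp
  next
    case 2
    then show ?thesis using shrink[of "1-s" a] assms by simp
  next
    case 3
    have "convex_on {0<..} (\<lambda>x::real. x powr r)"
      using powr_convex[OF assms(3)] by simp
    from convex_onD[OF this, of s a b] 3 assms show ?thesis by simp
  qed
qed

text \<open>Bernoulli's inequality for a real exponent: Young's inequality for
  \<open>x powr r\<close> and \<open>1\<close> with weights \<open>1/r\<close> and
  \<open>1 - 1/r\<close>.\<close>

lemma powr_ge_tangent_1:
  fixes x r :: real
  assumes "x > 0" "r \<ge> 1"
  shows "1 + r * (x - 1) \<le> x powr r"
proof -
  have "(x powr r) powr (1/r) * 1 powr (1 - 1/r) \<le> 1/r * x powr r + (1 - 1/r) * 1"
    using assms by (intro Youngs_inequality_0) auto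
  then have "x \<le> x powr r / r + (1 - 1/r)" using assms by (simp add: powr_powr)
  then have "r * x \<le> r * (x powr r / r + (1 - 1/r))" using assms by (intro mult_left_mono) auto
  also have "\<dots> = x powr r + r - 1" using assms by (simp add: field_simps)
  finally show ?thesis by (simp add: algebra_simps)
qed

text \<open>A hyperplane separates the epigraph from the open vertical ray below
  \<open>(x, f x)\<close>. As \<open>f\<close> is finite everywhere, it is not vertical and can be
  solved for the slope.\<close>

lemma convex_on_subgradient:
  fixes f :: "'a::euclidean_space \<Rightarrow> real"
  assumes "convex_on UNIV f"
  shows "\<exists>l. \<forall>y. f x + l \<bullet> (y - x) \<le> f y"
proof -
  define S where "S = epigraph UNIV f"
  define T where "T = {x} \<times> {..<f x}"
  have "convex S" unfolding S_def using assms by (rule convex_epigraphI)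
  moreover have "convex T" unfolding T_def by (intro convex_Times) auto
  moreover have "S \<noteq> {}" unfolding S_def epigraph_def by auto
  moreover have "T \<noteq> {}" unfolding T_def by (auto intro: lt_ex)
  moreover have "T \<inter> S = {}" unfolding S_def T_def epigraph_def by auto
  ultimately obtain ac b where ac: "ac \<noteq> 0" "\<forall>z\<in>T. ac \<bullet> z \<le> b" "\<forall>z\<in>S. ac \<bullet> z \<ge> b"
    using separating_hyperplane_sets[of T S] by metis
  obtain a c where [simp]: "ac = (a, c)" by (cases ac)
  have T: "a \<bullet> x + c * t \<le> b" if "t < f x" for t
    using ac(2) that unfolding T_def by auto
  have S: "a \<bullet> y + c * t \<ge> b" if "t \<ge> f y" for y t
    using ac(3) that unfolding S_def epigraph_def by auto
  have "c \<ge> 0"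
    using T[of "f x - 1"] S[of x "f x + 1"] by (simp add: algebra_simps)
  \<comment> \<open>A vertical hyperplane is refuted at the point \<open>x - a\<close>, where it
    would give \<open>a \<bullet> a \<le> 0\<close>.\<close>
  moreover have "c \<noteq> 0"
  proof
    assume "c = 0"
    have "a \<bullet> (x - a) \<ge> a \<bullet> x"
      using T[of "f x - 1"] S[of "x - a" "f (x - a)"] \<open>c = 0\<close> by simp
    then have "a \<bullet> a \<le> 0" by (simp add: inner_diff_right)
    then have "a = 0" by (metis inner_gt_zero_iff not_less)
    with \<open>c = 0\<close> ac(1) show False by (simp add: zero_prod_def)
  qed
  ultimately have c: "c > 0" by simp
  \<comment> \<open>The ray \<open>T\<close> omits its endpoint; an excess \<open>E\<close> at
    height \<open>f x\<close> would persist by half slightly below it.\<close>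
  have lim: "a \<bullet> x + c * f x \<le> b"
  proof (rule ccontr)
    assume *: "\<not> a \<bullet> x + c * f x \<le> b"
    define E where "E = a \<bullet> x + c * f x - b"
    have E: "E > 0" using * by (simp add: E_def)
    then have "a \<bullet> x + c * (f x - E / (2 * c)) \<le> b" using c by (intro T) auto
    moreover have "c * (f x - E / (2 * c)) = c * f x - E / 2" using c by (simp add: right_diff_distrib)
    ultimately show False using E E_def by linarith
  qed
  have "f x + (- (a /\<^sub>R c)) \<bullet> (y - x) \<le> f y" for y
  proof -
    have "c * f x \<le> a \<bullet> (y - x) + c * f y"
      using lim S[of y "f y"] by (simp add: inner_diff_right)
    then show ?thesis using c by (simp add: field_simps)
  qed
  then show ?thesis by blast
qed

lemma continuous_on_powr_nonneg:
  fixes f :: "'a::topological_space \<Rightarrow> real"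
  assumes "continuous_on S f" "\<And>x. x \<in> S \<Longrightarrow> 0 \<le> f x" "0 < e"
  shows "continuous_on S (\<lambda>x. f x powr e)"
  by (rule continuous_on_powr') (use assms in auto)

text \<open>Burkholder's function is a superposition of dilates of the following kernel, whose concavity along
  segments with \<open>|\<Delta>y| \<le> |\<Delta>x|\<close> needs no differentiation at singular points.\<close>

definition zigzag_kernel :: "real \<Rightarrow> complex \<Rightarrow> complex \<Rightarrow> real" where
  "zigzag_kernel t x y = (if cmod x + cmod y \<le> t then 0 else (cmod y - t)\<^sup>2 - (cmod x)\<^sup>2)"

lemma norm_sq_segment:
  fixes a b :: "'a::real_inner"
  shows "(norm ((1 - s) *\<^sub>R a + s *\<^sub>R b))\<^sup>2
       = (1 - s) * (norm a)\<^sup>2 + s * (norm b)\<^sup>2 - s * (1 - s) * (norm (a - b))\<^sup>2"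
  by (simp only: power2_norm_eq_inner) (simp add: inner_add inner_diff algebra_simps inner_commute
      power2_eq_square)

text \<open>If the intermediate point lies where the kernel vanishes, the triangle inequality gives
  \<open>cmod v - cmod u \<le> t\<close> at both endpoints, so their values are nonpositive.
  Otherwise the kernel equals \<open>N\<close> there and lies below \<open>N\<close> everywhere, and
  \<open>N\<close> is concave along the segment: the quadratic part because |\<Delta>y| \<le>
  |\<Delta>x|, the remaining part because -2t|y| is concave.\<close>

lemma zigzag_kernel_concave:
  assumes "cmod (ya - yb) \<le> cmod (xa - xb)" "0 \<le> s" "s \<le> 1" "t \<ge> 0"
  shows "(1 - s) * zigzag_kernel t xa ya + s * zigzag_kernel t xb yb
       \<le> zigzag_kernel t ((1 - s) *\<^sub>R xa + s *\<^sub>R xb) ((1 - s) *\<^sub>R ya + s *\<^sub>R yb)"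
proof -
  define x y where "x = (1 - s) *\<^sub>R xa + s *\<^sub>R xb" and "y = (1 - s) *\<^sub>R ya + s *\<^sub>R yb"
  have nonpos: "zigzag_kernel t u v \<le> 0"
    if "cmod x + cmod y \<le> t" and "cmod (v - y) \<le> cmod (u - x)" for u v
  proof -
    have "cmod v - cmod u \<le> t"
      using that norm_triangle_ineq2[of v y] norm_triangle_ineq2[of "u - x" "- x"]
        norm_triangle_ineq4[of u x] norm_triangle_ineq2[of u x]
      by (smt (verit) norm_minus_commute norm_triangle_ineq2 norm_triangle_ineq4)
    then have "\<bar>cmod v - t\<bar> \<le> cmod u" if "\<not> cmod u + cmod v \<le> t" using that by auto
    then show ?thesis
      by (auto simp: zigzag_kernel_def intro: power2_le_iff_abs_le[THEN iffD2])
  qed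
  show ?thesis
  proof (cases "cmod x + cmod y \<le> t")
    case True
    have "xa - x = s *\<^sub>R (xa - xb)" "ya - y = s *\<^sub>R (ya - yb)"
      "xb - x = (1 - s) *\<^sub>R (xb - xa)" "yb - y = (1 - s) *\<^sub>R (yb - ya)"
      by (auto simp: x_def y_def algebra_simps)
    then have "zigzag_kernel t xa ya \<le> 0" "zigzag_kernel t xb yb \<le> 0"
      using assms by (auto intro!: nonpos True mult_left_mono simp: norm_minus_commute[of xb]
          norm_minus_commute[of yb])
    moreover have "zigzag_kernel t x y = 0" using True by (simp add: zigzag_kernel_def)
    ultimately show ?thesis
      unfolding x_def[symmetric] y_def[symmetric] using assms
      by (smt (verit) mult_nonneg_nonpos)
  next
    case False
    define N where "N u v = (cmod v)\<^sup>2 - 2 * t * cmod v + t\<^sup>2 - (cmod u)\<^sup>2" for u v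
    have N: "N u v = (cmod v - t)\<^sup>2 - (cmod u)\<^sup>2" for u v
      by (simp add: N_def power2_eq_square algebra_simps)
    have le: "zigzag_kernel t u v \<le> N u v" for u v
    proof (cases "cmod u + cmod v \<le> t")
      case True
      then have "cmod u \<le> \<bar>cmod v - t\<bar>" by auto
      then have "(cmod u)\<^sup>2 \<le> (cmod v - t)\<^sup>2" by (metis norm_ge_zero power2_abs power_mono)
      with True show ?thesis by (simp add: zigzag_kernel_def N)
    qed (simp add: zigzag_kernel_def N)
    have tri: "cmod y \<le> (1 - s) * cmod ya + s * cmod yb"
      unfolding y_def using assms norm_triangle_ineq[of "(1-s) *\<^sub>R ya" "s *\<^sub>R yb"] by simp
    have "(cmod (ya - yb))\<^sup>2 \<le> (cmod (xa - xb))\<^sup>2" using assms by (intro power_mono) auto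
    then have "s * (1 - s) * (cmod (ya - yb))\<^sup>2 \<le> s * (1 - s) * (cmod (xa - xb))\<^sup>2"
      using assms by (intro mult_left_mono) auto
    moreover have "2 * t * cmod y \<le> 2 * t * ((1 - s) * cmod ya + s * cmod yb)"
      using tri assms by (intro mult_left_mono) auto
    ultimately have "(1 - s) * N xa ya + s * N xb yb \<le> N x y"
      unfolding N_def x_def[THEN arg_cong, of "\<lambda>w. (cmod w)\<^sup>2"] y_def[THEN arg_cong, of "\<lambda>w. (cmod
          w)\<^sup>2"] norm_sq_segment
      by (simp add: algebra_simps)
    moreover have "(1 - s) * zigzag_kernel t xa ya + s * zigzag_kernel t xb yb \<le> (1 - s) * N xa ya + s
        * N xb yb"
      using assms le by (intro add_mono mult_left_mono) auto
    moreover have "zigzag_kernel t x y = N x y" using False by (simp add: zigzag_kernel_def N)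
    ultimately show ?thesis unfolding x_def y_def by linarith
  qed
qed

text \<open>Burkholder's special function for exponents above 2, without its normalising factor
  \<open>p * (1 - 1/p) powr (p - 1)\<close>, which enters in \<open>burkholder_majorant\<close>. The
  dominating martingale is \<open>x\<close>, its transform is \<open>y\<close>.\<close>

definition burkholder :: "real \<Rightarrow> complex \<Rightarrow> complex \<Rightarrow> real" where
  "burkholder p x y = (cmod y - (p - 1) * cmod x) * (cmod x + cmod y) powr (p - 1)"

text \<open>The weight \<open>t powr (p - 3)\<close> is forced by homogeneity: the kernel scales
  quadratically, the result has degree \<open>p\<close>. It is integrable at 0 exactly for
  \<open>p > 2\<close>. Beyond \<open>cmod x + cmod y\<close> the integrand vanishes, so the upper
  limit \<open>L\<close> is free and can be shared by several points.\<close>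

lemma zigzag_kernel_integral:
  assumes p: "p > 2" and L: "cmod x + cmod y \<le> L"
  shows "((\<lambda>t. t powr (p - 3) * zigzag_kernel t x y) has_integral
           2 / (p * (p - 1) * (p - 2)) * burkholder p x y) {0..L}"
proof -
  define a b R where "a = cmod x" and "b = cmod y" and "R = a + b"
  have ab: "a \<ge> 0" "b \<ge> 0" "R \<ge> 0" by (auto simp: a_def b_def R_def)
  define F where "F t = (b\<^sup>2 - a\<^sup>2) * t powr (p - 2) / (p - 2) - 2 * b * t powr (p - 1) / (p - 1)
      + t powr p / p" for t
  have FR: "F R - F 0 = 2 / (p * (p - 1) * (p - 2)) * burkholder p x y"
  proof (cases "R = 0")
    case True
    then have "a = 0" "b = 0" using ab by (auto simp: R_def)
    then show ?thesis using p by (simp add: F_def R_def burkholder_def a_def b_def)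
  next
    case False
    then have R: "R > 0" using ab by simp
    have e1: "R powr (p - 1) = R powr (p - 2) * R" "R powr p = R powr (p - 2) * R\<^sup>2"
      using R by (simp_all add: powr_diff powr_numeral field_simps power2_eq_square)
    have "F R - F 0 = R powr (p - 2) * ((b\<^sup>2 - a\<^sup>2) / (p - 2) - 2 * b * R / (p - 1) + R\<^sup>2 / p)"
      unfolding F_def e1 using p by (simp add: field_simps)
    also have "(b\<^sup>2 - a\<^sup>2) / (p - 2) - 2 * b * R / (p - 1) + R\<^sup>2 / p
        = 2 / (p * (p - 1) * (p - 2)) * ((b - (p - 1) * a) * R)"
    proof -
      define D where "D = p * (p - 1) * (p - 2)"
      have "(b\<^sup>2 - a\<^sup>2) / (p - 2) = (b\<^sup>2 - a\<^sup>2) * (p * (p - 1)) / D"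
        "2 * b * R / (p - 1) = 2 * b * R * (p * (p - 2)) / D"
        "R\<^sup>2 / p = R\<^sup>2 * ((p - 1) * (p - 2)) / D"
        using p by (simp_all add: D_def)
      then have "(b\<^sup>2 - a\<^sup>2) / (p - 2) - 2 * b * R / (p - 1) + R\<^sup>2 / p
          = ((b\<^sup>2 - a\<^sup>2) * (p * (p - 1)) - 2 * b * R * (p * (p - 2)) + R\<^sup>2 * ((p - 1) * (p - 2))) / D"
        by (simp add: add_divide_distrib diff_divide_distrib)
      also have "(b\<^sup>2 - a\<^sup>2) * (p * (p - 1)) - 2 * b * R * (p * (p - 2)) + R\<^sup>2 * ((p - 1) * (p - 2))
          = 2 * ((b - (p - 1) * a) * R)"
        unfolding R_def by algebra
      finally show ?thesis by (simp add: D_def)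
    qed
    finally have "F R - F 0 = 2 / (p * (p - 1) * (p - 2)) * ((b - (p - 1) * a) * (R powr (p - 2) * R))"
      by (simp only: mult_ac)
    then show ?thesis unfolding e1(1)[symmetric] by (simp only: burkholder_def a_def b_def R_def)
  qed
  have i1: "((\<lambda>t. t powr (p - 3) * zigzag_kernel t x y) has_integral (F R - F 0)) {0..R}"
  proof (rule fundamental_theorem_of_calculus_interior)
    show "0 \<le> R" by fact
    show "continuous_on {0..R} F"
      unfolding F_def using p
      by (intro continuous_on_add continuous_on_diff continuous_on_mult continuous_on_divide
          continuous_on_const continuous_on_powr_nonneg continuous_on_id) auto
    fix t assume t: "t \<in> {0<..<R}"
    have z: "zigzag_kernel t x y = (b - t)\<^sup>2 - a\<^sup>2"
      using t by (auto simp: zigzag_kernel_def a_def b_def R_def)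
    have e: "t powr (p - 2) = t powr (p - 3) * t" "t powr (p - 1) = t powr (p - 3) * t\<^sup>2"
      using t by (simp_all add: powr_diff powr_numeral field_simps power3_eq_cube power2_eq_square)
    have "(F has_real_derivative ((b\<^sup>2 - a\<^sup>2) * t powr (p - 3) - 2 * b * t powr (p - 2) + t powr (p
        - 1))) (at t)"
      unfolding F_def using t p by (auto intro!: derivative_eq_intros)
    also have "(b\<^sup>2 - a\<^sup>2) * t powr (p - 3) - 2 * b * t powr (p - 2) + t powr (p - 1) = t powr (p - 3)
        * zigzag_kernel t x y"
      unfolding z e by (simp add: power2_eq_square algebra_simps)
    finally show "(F has_vector_derivative t powr (p - 3) * zigzag_kernel t x y) (at t)"
      by (simp add: has_real_derivative_iff_has_vector_derivative)
  qed
  have "((\<lambda>t. t powr (p - 3) * zigzag_kernel t x y) has_integral 0) {R..L}"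
    by (rule has_integral_eq[OF _ has_integral_0]) (auto simp: zigzag_kernel_def R_def a_def b_def)
  with i1 have "((\<lambda>t. t powr (p - 3) * zigzag_kernel t x y) has_integral (F R - F 0 + 0)) {0..L}"
    by (intro has_integral_combine[where c=R]) (use ab L in \<open>auto simp: R_def a_def b_def\<close>)
  then show ?thesis by (simp add: FR)
qed

text \<open>The concavity of the kernels is integrated against a nonnegative weight. The upper limit
  \<open>L\<close> exceeds the radii of all three points.\<close>

lemma burkholder_concave:
  assumes "p > 2" "cmod (ya - yb) \<le> cmod (xa - xb)" "0 \<le> s" "s \<le> 1"
  shows "(1 - s) * burkholder p xa ya + s * burkholder p xb yb
       \<le> burkholder p ((1 - s) *\<^sub>R xa + s *\<^sub>R xb) ((1 - s) *\<^sub>R ya + s *\<^sub>R yb)"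
    (is "_ \<le> burkholder p ?x ?y")
proof -
  define c where "c = 2 / (p * (p - 1) * (p - 2))"
  have c: "c > 0" using assms by (simp add: c_def)
  define L where "L = cmod xa + cmod ya + cmod xb + cmod yb + cmod ?x + cmod ?y"
  note I = zigzag_kernel_integral[OF assms(1), folded c_def]
  have "((\<lambda>t. (1 - s) * (t powr (p - 3) * zigzag_kernel t xa ya) + s * (t powr (p - 3)
      * zigzag_kernel t xb yb))
      has_integral (1 - s) * (c * burkholder p xa ya) + s * (c * burkholder p xb yb)) {0..L}"
    by (intro has_integral_add has_integral_mult_right I) (auto simp: L_def)
  moreover have "((\<lambda>t. t powr (p - 3) * zigzag_kernel t ?x ?y) has_integral c * burkholder p ?x ?y) {0..L}"
    by (rule I) (auto simp: L_def)
  ultimately have "(1 - s) * (c * burkholder p xa ya) + s * (c * burkholder p xb yb) \<le> c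
      * burkholder p ?x ?y"
  proof (rule has_integral_le)
    fix t assume "t \<in> {0..L}"
    then have "(1 - s) * zigzag_kernel t xa ya + s * zigzag_kernel t xb yb \<le> zigzag_kernel t ?x ?y"
      using zigzag_kernel_concave assms by auto
    then have "t powr (p - 3) * ((1 - s) * zigzag_kernel t xa ya + s * zigzag_kernel t xb yb)
        \<le> t powr (p - 3) * zigzag_kernel t ?x ?y"
      by (intro mult_left_mono) auto
    then show "(1 - s) * (t powr (p - 3) * zigzag_kernel t xa ya) + s * (t powr (p - 3)
        * zigzag_kernel t xb yb)
        \<le> t powr (p - 3) * zigzag_kernel t ?x ?y" by (simp add: algebra_simps)
  qed
  then have "c * ((1 - s) * burkholder p xa ya + s * burkholder p xb yb) \<le> c * burkholder p ?x ?y"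
    by (simp add: algebra_simps)
  then show ?thesis using c by simp
qed

text \<open>The case |x| + |y| = 1 with s = |x|. Both sides vanish at \<open>s = 1/p\<close>, where
  |y| = (p-1)|x|, and the factor \<open>p * (1 - 1/p) powr (p - 1)\<close> is the one that makes
  them tangent there. So \<open>F\<close> and its derivative vanish at \<open>1/p\<close>, and this
  point has to be its minimum.\<close>

lemma burkholder_majorant_unit:
  fixes p s :: real
  assumes p: "p > 2" and s: "0 \<le> s" "s \<le> 1"
  shows "(1 - s) powr p - (p - 1) powr p * s powr p \<le> p * (1 - 1/p) powr (p - 1) * (1 - p * s)"
proof -
  define k where "k = (1 - 1/p) powr (p - 1)"
  \<comment> \<open>Bernoulli's inequality at \<open>1 - 1/p\<close>; it is what makes the
    derivative nonpositive at 0.\<close>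
  have pk: "p * k \<ge> 1"
  proof -
    have "1 + (p - 1) * ((1 - 1/p) - 1) \<le> k"
      unfolding k_def using p by (intro powr_ge_tangent_1) auto
    then have "p * (1 + (p - 1) * ((1 - 1/p) - 1)) \<le> p * k" using p by (intro mult_left_mono) auto
    then show ?thesis using p by (simp add: field_simps)
  qed
  define F where "F s = p * k * (1 - p * s) - (1 - s) powr p + (p - 1) powr p * s powr p" for s
  define F' where "F' s = - (p\<^sup>2 * k) + p * (1 - s) powr (p - 1) + p * (p - 1) powr p * s powr (p - 1)"
      for s
  have deriv: "(F has_real_derivative F' s) (at s)" if "0 < s" "s < 1" for s
    unfolding F_def F'_def using that p
    by (auto intro!: derivative_eq_intros simp: power2_eq_square)
  have cont: "continuous_on {0..1} F"
    unfolding F_def using p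
    by (intro continuous_on_add continuous_on_diff continuous_on_mult continuous_on_const
        continuous_on_powr_nonneg continuous_on_id) auto
  \<comment> \<open>The exponent \<open>p - 1\<close> is at least 1, so both powers in
    \<open>F'\<close> are convex.\<close>
  have F'conv: "F' ((1 - w) * a + w * b) \<le> (1 - w) * F' a + w * F' b"
    if "0 \<le> a" "a \<le> 1" "0 \<le> b" "b \<le> 1" "0 \<le> w" "w \<le> 1" for a b w
  proof -
    have "1 - ((1 - w) * a + w * b) = (1 - w) * (1 - a) + w * (1 - b)" by (simp add: algebra_simps)
    then have "(1 - ((1 - w) * a + w * b)) powr (p - 1) \<le> (1 - w) * (1 - a) powr (p - 1) + w * (1
        - b) powr (p - 1)"
      using powr_convex_segment[of "1-a" "1-b" "p-1" w] that p by simp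
    then have 1: "p * (1 - ((1 - w) * a + w * b)) powr (p - 1) \<le> p * ((1 - w) * (1 - a) powr (p - 1) + w
        * (1 - b) powr (p - 1))"
      using p by (intro mult_left_mono) auto
    have "((1 - w) * a + w * b) powr (p - 1) \<le> (1 - w) * a powr (p - 1) + w * b powr (p - 1)"
      using powr_convex_segment[of a b "p-1" w] that p by simp
    then have 2: "p * (p - 1) powr p * ((1 - w) * a + w * b) powr (p - 1) \<le> p * (p - 1) powr p * ((1
        - w) * a powr (p - 1) + w * b powr (p - 1))"
      using p by (intro mult_left_mono) auto
    show ?thesis unfolding F'_def using 1 2 by (simp add: algebra_simps)
  qed
  have kp: "k = (p - 1) powr (p - 1) / p powr (p - 1)"
  proof -
    have "1 - 1/p = (p - 1) / p" using p by (simp add: field_simps)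
    then show ?thesis using p by (simp add: k_def powr_divide)
  qed
  have F'0: "F' 0 \<le> 0"
  proof -
    have "F' 0 = p * (1 - p * k)" using p by (simp add: F'_def power2_eq_square algebra_simps)
    then show ?thesis using pk p by (simp add: mult_le_0_iff)
  qed
  have pp: "(p - 1) powr p = (p - 1) powr (p - 1) * (p - 1)" "p powr p = p powr (p - 1) * p"
    using p by (simp_all add: powr_diff)
  have F'p: "F' (1/p) = 0"
  proof -
    have "(1/p) powr (p - 1) = 1 / p powr (p - 1)" using p by (simp add: powr_divide)
    then have "F' (1/p) = - (p\<^sup>2 * k) + p * k + p * ((p - 1) * k)"
      unfolding F'_def k_def[symmetric] pp by (simp add: kp mult_ac)
    also have "\<dots> = 0" by (simp add: power2_eq_square algebra_simps)
    finally show ?thesis .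
  qed
  have Fp: "F (1/p) = 0"
  proof -
    have "1 - 1/p = (p - 1) / p" using p by (simp add: field_simps)
    then have "(1 - 1/p) powr p = (p - 1) powr p * (1/p) powr p"
      using p by (simp add: powr_divide)
    then show ?thesis using p by (simp add: F_def)
  qed
  \<comment> \<open>\<open>F'\<close> is convex with \<open>F' 0 \<le> 0 = F' (1/p)\<close>, which fixes its sign on both sides of \<open>1/p\<close>.\<close>
  have ge: "F s \<ge> F (1/p)"
  proof (cases "s \<le> 1/p")
    case True
    have "F' u \<le> 0" if "0 < u" "u < 1/p" for u
    proof -
      have w: "0 \<le> p * u" "p * u \<le> 1" using that p by (auto simp: field_simps)
      have "F' u \<le> (1 - p * u) * F' 0"
        using F'conv[of 0 "1/p" "p * u"] w that p F'p by simp
      also have "\<dots> \<le> 0" using w F'0 by (simp add: mult_nonneg_nonpos)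
      finally show ?thesis .
    qed
    moreover have "{s..1/p} \<subseteq> {0..1}" "1/p \<le> 1" using s p by auto
    ultimately show ?thesis
      using True s deriv
      by (intro DERIV_nonpos_imp_decreasing_open[where f=F] continuous_on_subset[OF cont])
         (auto simp del: divide_le_eq_1 less_divide_eq_1, (metis (no_types) less_le_trans le_less_trans
             order.strict_implies_order)?)
  next
    case False
    have "F' u \<ge> 0" if u: "1/p < u" "u < 1" for u
    proof -
      have "u > 0" using u p by (smt (verit) divide_pos_pos)
      \<comment> \<open>The weight that places \<open>1/p\<close> between 0 and \<open>u\<close>;
        convexity then transfers the sign from 0 and \<open>1/p\<close> to \<open>u\<close>.\<close>
      define w where "w = 1 / (p * u)"
      have w: "0 < w" "w < 1" using u p \<open>u > 0\<close> by (auto simp: w_def field_simps)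
      have "(1 - w) * 0 + w * u = 1/p" using \<open>u > 0\<close> by (simp add: w_def)
      then have "0 \<le> (1 - w) * F' 0 + w * F' u"
        using F'conv[of 0 u w] w u \<open>u > 0\<close> F'p by simp
      moreover have "(1 - w) * F' 0 \<le> 0" using w F'0 by (simp add: mult_nonneg_nonpos)
      ultimately show ?thesis using w by (smt (verit) mult_pos_neg)
    qed
    moreover have "{1/p..s} \<subseteq> {0..1}" "1/p > 0" using s p by auto
    ultimately show ?thesis
      using False s deriv
      by (intro DERIV_nonneg_imp_increasing_open[where f=F] continuous_on_subset[OF cont])
         (auto simp del: zero_less_divide_1_iff, (metis (no_types) less_le_trans le_less_trans
             order.strict_implies_order)?)
  qed
  then show ?thesis using Fp by (simp add: F_def k_def)
qed

text \<open>Both sides are homogeneous of degree \<open>p\<close> in \<open>(x, y)\<close>, so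
  dividing by \<open>R\<close> reduces to the unit case.\<close>

lemma burkholder_majorant:
  assumes p: "p > 2"
  shows "cmod y powr p - (p - 1) powr p * cmod x powr p
       \<le> p * (1 - 1/p) powr (p - 1) * burkholder p x y"
proof (cases "cmod x + cmod y = 0")
  case True
  then have "x = 0" "y = 0" by (smt (verit) norm_ge_zero norm_le_zero_iff)+
  then show ?thesis by (simp add: burkholder_def)
next
  case False
  define R s where "R = cmod x + cmod y" and "s = cmod x / R"
  have R: "R > 0" using False by (simp add: R_def less_le)
  have s: "0 \<le> s" "s \<le> 1" "1 - s = cmod y / R"
    using R by (auto simp: s_def R_def field_simps)
  have Rp: "R powr p = R powr (p - 1) * R" using R by (simp add: powr_diff)
  have "R powr p * ((1 - s) powr p - (p - 1) powr p * s powr p)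
      \<le> R powr p * (p * (1 - 1/p) powr (p - 1) * (1 - p * s))"
    using burkholder_majorant_unit[OF p s(1,2)] by (intro mult_left_mono) auto
  also have "R powr p * ((1 - s) powr p - (p - 1) powr p * s powr p)
      = cmod y powr p - (p - 1) powr p * cmod x powr p"
    unfolding s(3) unfolding s_def using R by (simp add: powr_divide right_diff_distrib)
  also have "R powr p * (p * (1 - 1/p) powr (p - 1) * (1 - p * s))
      = p * (1 - 1/p) powr (p - 1) * ((R - p * (s * R)) * R powr (p - 1))"
    unfolding Rp by (simp add: algebra_simps)
  also have "R - p * (s * R) = cmod y - (p - 1) * cmod x"
    using R by (simp add: s_def) (simp add: R_def algebra_simps)
  finally show ?thesis by (simp only: burkholder_def R_def)
qed

text \<open>Young's inequality produces a power of |g|, which the majorant trades for a power of |x|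
  and a multiple of \<open>burkholder\<close>. This is the upper bound for the supremum in
  \<open>bellman\<close>.\<close>

lemma Re_mult_le_burkholder:
  assumes p: "p > 2" and q: "q = p / (p - 1)"
  shows "Re (g * cnj y) \<le> (p - 1) * (cmod x powr p / p + cmod y powr q / q)
           + (p - 1) powr (1 - p) * (1 - 1/p) powr (p - 1) * burkholder p x g"
proof -
  \<comment> \<open>The weight that balances the two terms: \<open>l powr (- q)\<close> equals
    \<open>p - 1\<close>, and \<open>l powr p\<close> times the \<open>(p - 1) powr p\<close> of the
    majorant equals \<open>p - 1\<close> as well.\<close>
  define l where "l = (p - 1) powr ((1 - p) / p)"
  have l: "l > 0" using p by (simp add: l_def)
  have pq: "q > 1" "1/p + 1/q = 1" using p by (auto simp: q field_simps)
  have lp: "l powr p = (p - 1) powr (1 - p)" using p by (simp add: l_def powr_powr)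
  have "(1 - p) / p * q = -1" using p by (simp add: q field_simps)
  then have lq: "l powr q = 1 / (p - 1)" using p by (simp add: l_def powr_powr powr_minus_divide)
  have "Re (g * cnj y) \<le> cmod g * cmod y"
    by (metis complex_Re_le_cmod complex_mod_cnj norm_mult)
  also have "\<dots> = (l * cmod g) * (cmod y / l)" using l by simp
  also have "\<dots> \<le> (l * cmod g) powr p / p + (cmod y / l) powr q / q"
    using p pq l by (intro Youngs_inequality) auto
  also have "\<dots> = (p - 1) powr (1 - p) / p * cmod g powr p + (p - 1) * (cmod y powr q / q)"
    using l p by (simp add: powr_mult powr_divide lp lq)
  also have "\<dots> \<le> (p - 1) powr (1 - p) / p * ((p - 1) powr p * cmod x powr p
        + p * (1 - 1/p) powr (p - 1) * burkholder p x g) + (p - 1) * (cmod y powr q / q)"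
    using burkholder_majorant[OF p, of g x] p by (intro add_right_mono mult_left_mono) auto
  also have "(p - 1) powr (1 - p) / p * ((p - 1) powr p * cmod x powr p
        + p * (1 - 1/p) powr (p - 1) * burkholder p x g)
      = ((p - 1) powr (1 - p) * (p - 1) powr p) * (cmod x powr p / p)
        + (p - 1) powr (1 - p) * (1 - 1/p) powr (p - 1) * burkholder p x g"
    using p by (simp add: distrib_left)
  also have "(p - 1) powr (1 - p) * (p - 1) powr p = p - 1"
    using p by (simp flip: powr_add)
  finally show ?thesis by (simp add: distrib_left)
qed

text \<open>The constant is the coefficient that \<open>Re_mult_le_burkholder\<close> leaves in
  front of \<open>burkholder\<close>; with it the supremum is finite.\<close>

definition bellman :: "real \<Rightarrow> complex \<Rightarrow> complex \<Rightarrow> real" where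
  "bellman p x y = (SUP g. Re (g * cnj y)
     - (p - 1) powr (1 - p) * (1 - 1/p) powr (p - 1) * burkholder p x g)"

lemma
  assumes p: "p > 2" and q: "q = p / (p - 1)"
  shows bellman_bdd_above: "bdd_above (range (\<lambda>g. Re (g * cnj y)
          - (p - 1) powr (1 - p) * (1 - 1/p) powr (p - 1) * burkholder p x g))"
    and bellman_nonneg: "0 \<le> bellman p x y"
    and bellman_le: "bellman p x y \<le> (p - 1) * (cmod x powr p / p + cmod y powr q / q)"
proof -
  show bdd: "bdd_above (range (\<lambda>g. Re (g * cnj y)
          - (p - 1) powr (1 - p) * (1 - 1/p) powr (p - 1) * burkholder p x g))"
    using Re_mult_le_burkholder[OF p q, of _ y x]
    by (intro bdd_aboveI[of _ "(p - 1) * (cmod x powr p / p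
        + cmod y powr q / q)"]) (auto simp: algebra_simps)
  \<comment> \<open>The competitor \<open>g = 0\<close>: there \<open>burkholder\<close> is
    nonpositive.\<close>
  have "0 \<le> Re (0 * cnj y) - (p - 1) powr (1 - p) * (1 - 1/p) powr (p - 1) * burkholder p x 0"
    using p by (simp add: burkholder_def mult_nonneg_nonpos mult_nonpos_nonneg)
  also have "\<dots> \<le> bellman p x y" unfolding bellman_def by (intro cSUP_upper bdd) auto
  finally show "0 \<le> bellman p x y" .
  show "bellman p x y \<le> (p - 1) * (cmod x powr p / p + cmod y powr q / q)"
    unfolding bellman_def using Re_mult_le_burkholder[OF p q, of _ y x]
    by (intro cSUP_least) (auto simp: algebra_simps)
qed

text \<open>A competitor \<open>g\<close> at the intermediate point is split into \<open>ga\<close>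
  and \<open>gb\<close> differing by \<open>k\<close>. Since |k| is at most |\<Delta>x|,
  \<open>burkholder\<close> is concave along the split, while the bilinear part gains
  \<open>s * (1 - s)\<close> times the pairing of \<open>k\<close> with \<Delta>y. Pointing
  \<open>k\<close> along \<Delta>y makes this pairing |\<Delta>x||\<Delta>y|.\<close>

lemma bellman_segment:
  assumes p: "p > 2" and s: "0 \<le> s" "s \<le> 1"
  shows "bellman p ((1 - s) *\<^sub>R xa + s *\<^sub>R xb) ((1 - s) *\<^sub>R ya + s *\<^sub>R yb)
           + s * (1 - s) * (cmod (xb - xa) * cmod (yb - ya))
       \<le> (1 - s) * bellman p xa ya + s * bellman p xb yb"
proof -
  define c where "c = (p - 1) powr (1 - p) * (1 - 1/p) powr (p - 1)"
  have c: "c \<ge> 0" by (simp add: c_def)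
  define x y where "x = (1 - s) *\<^sub>R xa + s *\<^sub>R xb" and "y = (1 - s) *\<^sub>R ya + s *\<^sub>R yb"
  define d where "d = s * (1 - s) * (cmod (xb - xa) * cmod (yb - ya))"
  \<comment> \<open>If \<open>ya = yb\<close>, then \<open>sgn 0 = 0\<close> makes \<open>k\<close>
    vanish, in accordance with a gain of zero.\<close>
  define k where "k = cmod (xb - xa) *\<^sub>R sgn (yb - ya)"
  have k: "cmod k \<le> cmod (xb - xa)" by (simp add: k_def norm_sgn)
  have "Re (sgn (yb - ya) * cnj (yb - ya)) = cmod (yb - ya)"
    by (cases "yb = ya")
      (simp_all add: sgn_eq complex_norm_square[symmetric] power2_eq_square
        del: complex_cnj_diff flip: complex_norm_square)
  then have kRe: "Re (k * cnj (yb - ya)) = cmod (xb - xa) * cmod (yb - ya)"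
    by (simp add: k_def)
  have up: "Re (g * cnj w) - c * burkholder p z g \<le> bellman p z w" for g w z
    unfolding bellman_def c_def by (intro cSUP_upper bellman_bdd_above[OF p refl]) auto
  have "Re (g * cnj y) - c * burkholder p x g \<le> (1 - s) * bellman p xa ya + s * bellman p xb yb - d" for g
  proof -
    define ga gb where "ga = g - s *\<^sub>R k" and "gb = g + (1 - s) *\<^sub>R k"
    have g: "(1 - s) *\<^sub>R ga + s *\<^sub>R gb = g" by (simp add: ga_def gb_def algebra_simps)
    have "gb - ga = k" by (simp add: ga_def gb_def algebra_simps)
    then have "cmod (ga - gb) \<le> cmod (xa - xb)" using k by (metis norm_minus_commute)
    from burkholder_concave[OF p this s]
    have U: "(1 - s) * burkholder p xa ga + s * burkholder p xb gb \<le> burkholder p x g"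
      by (simp add: g x_def)
    have "(1 - s) * Re (ga * cnj ya) + s * Re (gb * cnj yb)
        = Re (g * cnj y) + s * (1 - s) * Re (k * cnj (yb - ya))"
      by (simp add: ga_def gb_def y_def algebra_simps)
    then have "Re (g * cnj y) + d = (1 - s) * Re (ga * cnj ya) + s * Re (gb * cnj yb)"
      by (simp only: kRe d_def)
    moreover have "c * ((1 - s) * burkholder p xa ga + s * burkholder p xb gb) \<le> c * burkholder p x g"
      using U c by (rule mult_left_mono)
    moreover have "(1 - s) * (Re (ga * cnj ya) - c * burkholder p xa ga)
        + s * (Re (gb * cnj yb) - c * burkholder p xb gb)
        \<le> (1 - s) * bellman p xa ya + s * bellman p xb yb"
      using s up by (intro add_mono mult_left_mono) auto
    ultimately show ?thesis by (simp add: algebra_simps)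
  qed
  then have "bellman p x y \<le> (1 - s) * bellman p xa ya + s * bellman p xb yb - d"
    unfolding bellman_def[of p x y] c_def by (intro cSUP_least) auto
  then show ?thesis by (simp add: x_def y_def d_def)
qed

text \<open>The superposition of kernels needs an exponent above 2. For \<open>p < 2\<close> the
  conjugate exponent has this property, and exchanging the two variables yields the constant
  \<open>q - 1\<close>. At \<open>p = 2\<close> a quadratic form does it, its gain being the
  arithmetic-geometric mean inequality.\<close>

lemma bellman_exists:
  fixes p q C :: real
  assumes "p > 1" and q: "q = p / (p - 1)" and C: "C = max p q - 1"
  obtains \<Phi> :: "complex \<Rightarrow> complex \<Rightarrow> real"
  where "\<And>x y. 0 \<le> \<Phi> x y"
    and "\<And>x y. \<Phi> x y \<le> C * (cmod x powr p / p + cmod y powr q / q)"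
    and "\<And>s xa xb ya yb. 0 \<le> s \<Longrightarrow> s \<le> 1 \<Longrightarrow>
           \<Phi> ((1 - s) *\<^sub>R xa + s *\<^sub>R xb) ((1 - s) *\<^sub>R ya + s *\<^sub>R yb)
             + s * (1 - s) * (cmod (xb - xa) * cmod (yb - ya))
           \<le> (1 - s) * \<Phi> xa ya + s * \<Phi> xb yb"
proof -
  consider "p > 2" | "p = 2" | "p < 2" by linarith
  then show ?thesis
  proof cases
    case 1
    have "q \<le> p" using 1 by (simp add: q field_simps)
    then have "C = p - 1" using C by simp
    then show ?thesis using that[of "bellman p"] bellman_nonneg[OF 1 q] bellman_le[OF 1 q]
        bellman_segment[OF 1] by simp
  next
    case 2
    then have [simp]: "q = 2" "C = 1" using q C by auto
    have seg: "(((cmod ((1 - s) *\<^sub>R xa + s *\<^sub>R xb))\<^sup>2 + (cmod ((1 - s) *\<^sub>R ya + s *\<^sub>R yb))\<^sup>2) / 2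
            + s * (1 - s) * (cmod (xb - xa) * cmod (yb - ya))
           \<le> (1 - s) * (((cmod xa)\<^sup>2 + (cmod ya)\<^sup>2) / 2) + s * (((cmod xb)\<^sup>2 + (cmod yb)\<^sup>2) / 2))"
      if s: "0 \<le> s" "s \<le> 1" for s xa xb ya yb
    proof -
      have "2 * (cmod (xb - xa) * cmod (yb - ya)) \<le> (cmod (xb - xa))\<^sup>2 + (cmod (yb - ya))\<^sup>2"
        using sum_squares_bound[of "cmod (xb - xa)" "cmod (yb - ya)"] by simp
      then have "s * (1 - s) * (2 * (cmod (xb - xa) * cmod (yb - ya)))
          \<le> s * (1 - s) * ((cmod (xb - xa))\<^sup>2 + (cmod (yb - ya))\<^sup>2)"
        using s by (intro mult_left_mono) auto
      then show ?thesis
        unfolding norm_sq_segment norm_minus_commute[of xa xb] norm_minus_commute[of ya yb]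
        by (simp add: field_simps)
    qed
    show ?thesis
      by (rule that[of "\<lambda>x y. ((cmod x)\<^sup>2 + (cmod y)\<^sup>2) / 2"]) (use seg in \<open>auto simp: \<open>p
          = 2\<close> powr_numeral add_divide_distrib\<close>)
  next
    case 3
    have q2: "q > 2" using 3 assms by (simp add: q field_simps)
    have pq: "p = q / (q - 1)" using assms by (simp add: q field_simps)
    have "p \<le> q" using 3 q2 by simp
    then have "C = q - 1" using C by simp
    show ?thesis
    proof (rule that[of "\<lambda>x y. bellman q y x"])
      show "bellman q y x \<le> C * (cmod x powr p / p + cmod y powr q / q)" for x y
        using bellman_le[OF q2 pq, of y x] \<open>C = q - 1\<close> by (simp add: add.commute)
      show "bellman q ((1 - s) *\<^sub>R ya + s *\<^sub>R yb) ((1 - s) *\<^sub>R xa + s *\<^sub>R xb)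
          + s * (1 - s) * (cmod (xb - xa) * cmod (yb - ya))
        \<le> (1 - s) * bellman q ya xa + s * bellman q yb xb"
        if "0 \<le> s" "s \<le> 1" for s xa xb ya yb
        using bellman_segment[OF q2 that, of ya yb xa xb] by (simp only: mult.commute[of "cmod (xb - xa)"])
    qed (rule bellman_nonneg[OF q2 pq])
  qed
qed

text \<open>A subgradient of the convex function can be improved by the gain term, because the latter
  enters the segment inequality at first order in the segment parameter.\<close>

lemma bellman_subgradient:
  fixes p q C :: real
  assumes "p > 1" and q: "q = p / (p - 1)" and C: "C = max p q - 1"
  obtains \<Phi> :: "complex \<Rightarrow> complex \<Rightarrow> real"
  where "\<And>x y. 0 \<le> \<Phi> x y"
    and "\<And>x y. \<Phi> x y \<le> C * (cmod x powr p / p + cmod y powr q / q)"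
    and "continuous_on UNIV (\<lambda>z. \<Phi> (fst z) (snd z))"
    and "\<And>x y. \<exists>l m. \<forall>x' y'. \<Phi> x y + l \<bullet> (x' - x) + m \<bullet> (y' - y) + cmod (x' - x) * cmod (y' - y) \<le> \<Phi> x' y'"
proof -
  obtain \<Phi> :: "complex \<Rightarrow> complex \<Rightarrow> real" where \<Phi>: "\<And>x y. 0 \<le> \<Phi> x y"
    "\<And>x y. \<Phi> x y \<le> C * (cmod x powr p / p + cmod y powr q / q)"
    and seg: "\<And>s xa xb ya yb. 0 \<le> s \<Longrightarrow> s \<le> 1 \<Longrightarrow>
           \<Phi> ((1 - s) *\<^sub>R xa + s *\<^sub>R xb) ((1 - s) *\<^sub>R ya + s *\<^sub>R yb)
             + s * (1 - s) * (cmod (xb - xa) * cmod (yb - ya))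
           \<le> (1 - s) * \<Phi> xa ya + s * \<Phi> xb yb"
    using bellman_exists[OF assms] by metis
  have cvx: "convex_on UNIV (\<lambda>z. \<Phi> (fst z) (snd z))"
  proof (rule convex_onI)
    fix s :: real and a b :: "complex \<times> complex" assume s: "0 < s" "s < 1"
    then have "0 \<le> s * (1 - s) * (cmod (fst b - fst a) * cmod (snd b - snd a))" by simp
    with seg[of s "fst a" "fst b" "snd a" "snd b"] s
    have "\<Phi> ((1 - s) *\<^sub>R fst a + s *\<^sub>R fst b) ((1 - s) *\<^sub>R snd a + s *\<^sub>R snd b)
        \<le> (1 - s) * \<Phi> (fst a) (snd a) + s * \<Phi> (fst b) (snd b)" by linarith
    then show "\<Phi> (fst ((1 - s) *\<^sub>R a + s *\<^sub>R b)) (snd ((1 - s) *\<^sub>R a + s *\<^sub>R b))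
        \<le> (1 - s) * \<Phi> (fst a) (snd a) + s * \<Phi> (fst b) (snd b)"
      by simp
  qed auto
  have "\<exists>l m. \<forall>x' y'. \<Phi> x y + l \<bullet> (x' - x) + m \<bullet> (y' - y) + cmod (x' - x) * cmod (y' - y) \<le> \<Phi> x' y'" for x y
  proof -
    obtain lm where lm: "\<And>z. \<Phi> x y + lm \<bullet> (z - (x, y)) \<le> \<Phi> (fst z) (snd z)"
      using convex_on_subgradient[OF cvx, of "(x, y)"] unfolding fst_conv snd_conv by blast
    have "\<Phi> x y + fst lm \<bullet> (x' - x) + snd lm \<bullet> (y' - y) + cmod (x' - x) * cmod (y' - y) \<le> \<Phi> x' y'" for x' y'
    proof -
      let ?d = "fst lm \<bullet> (x' - x) + snd lm \<bullet> (y' - y)"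
      \<comment> \<open>The plain subgradient is evaluated at the intermediate point with parameter
        \<open>s = 1 - r\<close> and compared with the segment inequality. After division by
        \<open>s\<close> a fraction \<open>r\<close> of the gain remains, and \<open>r\<close> may
        approach 1.\<close>
      have "r * (cmod (x' - x) * cmod (y' - y)) \<le> \<Phi> x' y' - \<Phi> x y - ?d" if r: "0 < r" "r < 1" for r
      proof -
        define s where "s = 1 - r"
        have s: "0 < s" "s < 1" using r by (auto simp: s_def)
        have "\<Phi> x y + s * ?d \<le> \<Phi> ((1 - s) *\<^sub>R x + s *\<^sub>R x') ((1 - s) *\<^sub>R y + s *\<^sub>R y')"
          using lm[of "((1 - s) *\<^sub>R x + s *\<^sub>R x', (1 - s) *\<^sub>R y + s *\<^sub>R y')"]
          by (cases lm) (simp add: inner_diff_right inner_add_right algebra_simps)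
        also have "\<dots> \<le> (1 - s) * \<Phi> x y + s * \<Phi> x' y' - s * (1 - s) * (cmod (x' - x) * cmod (y' - y))"
          using seg[of s x x' y y'] s by simp
        finally have "s * (r * (cmod (x' - x) * cmod (y' - y))) \<le> s * (\<Phi> x' y' - \<Phi> x y - ?d)"
          by (simp add: s_def algebra_simps)
        then show ?thesis using s by simp
      qed
      then have "cmod (x' - x) * cmod (y' - y) \<le> \<Phi> x' y' - \<Phi> x y - ?d"
        by (rule field_le_mult_one_interval)
      then show ?thesis by simp
    qed
    then show ?thesis by blast
  qed
  then show ?thesis
    using that[of \<Phi>] \<Phi> convex_on_continuous[OF open_UNIV cvx] by blast
qed

section \<open>Lebesgue spaces\<close>

lemma in_Lp_measurable [measurable_dest]: "in_Lp p f \<Longrightarrow> f \<in> borel_measurable lborel"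
  by (simp add: in_Lp_def)

lemma in_Lp_iff_integrable:
  "in_Lp p f \<longleftrightarrow> f \<in> borel_measurable lborel \<and> integrable lborel (\<lambda>x. cmod (f x) powr p)"
  by (auto simp: in_Lp_def integrable_iff_bounded)

lemma in_Lp_integrable: "in_Lp p f \<Longrightarrow> integrable lborel (\<lambda>x. cmod (f x) powr p)"
  by (simp add: in_Lp_iff_integrable)

lemma Lp_norm_nonneg [simp]: "0 \<le> Lp_norm p f"
  by (simp add: Lp_norm_def)

lemma Lp_norm_powr_ennreal:
  assumes "in_Lp p f" "p > 0"
  shows "(\<integral>\<^sup>+x. ennreal (cmod (f x) powr p) \<partial>lborel) = ennreal (Lp_norm p f powr p)"
  using assms by (simp add: Lp_norm_def powr_powr in_Lp_def less_top)

lemma Lp_norm_powr: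
  assumes "in_Lp p f" "p > 0"
  shows "Lp_norm p f powr p = (\<integral>x. cmod (f x) powr p \<partial>lborel)"
proof -
  have "ennreal (Lp_norm p f powr p) = ennreal (\<integral>x. cmod (f x) powr p \<partial>lborel)"
    using Lp_norm_powr_ennreal[OF assms] nn_integral_eq_integral[OF in_Lp_integrable[OF assms(1)]] by simp
  then show ?thesis by (subst (asm) ennreal_inj) (auto intro: integral_nonneg_AE)
qed

lemma Lp_norm_leI:
  assumes "p > 0" "B \<ge> 0" "f \<in> borel_measurable lborel"
    and "(\<integral>\<^sup>+x. ennreal (cmod (f x) powr p) \<partial>lborel) \<le> ennreal (B powr p)"
  shows "in_Lp p f" "Lp_norm p f \<le> B"
proof -
  show *: "in_Lp p f" using assms by (auto simp: in_Lp_def intro: le_less_trans)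
  have "Lp_norm p f powr p \<le> B powr p" using assms(4) Lp_norm_powr_ennreal[OF * assms(1)] by simp
  then show "Lp_norm p f \<le> B" using assms by (metis Lp_norm_nonneg not_less powr_less_mono2)
qed

lemma Lp_cong_ae:
  assumes "ae_eq f g" "in_Lp p f" "g \<in> borel_measurable lborel"
  shows "in_Lp p g" "Lp_norm p g = Lp_norm p f"
proof -
  have "(\<integral>\<^sup>+x. ennreal (cmod (g x) powr p) \<partial>lborel) = (\<integral>\<^sup>+x. ennreal (cmod (f x) powr p) \<partial>lborel)"
    using assms(1) by (intro nn_integral_cong_AE) (auto simp: ae_eq_def)
  then show "in_Lp p g" "Lp_norm p g = Lp_norm p f"
    using assms by (auto simp: in_Lp_def Lp_norm_def)
qed

lemma Lp_norm_eq_0_imp: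
  assumes "in_Lp p f" "p > 0" "Lp_norm p f = 0"
  shows "AE x in lborel. f x = 0"
proof -
  have [measurable]: "f \<in> borel_measurable lborel" using assms by (simp add: in_Lp_def)
  have "(\<integral>\<^sup>+x. ennreal (cmod (f x) powr p) \<partial>lborel) = 0"
    using Lp_norm_powr_ennreal[OF assms(1,2)] assms(3) by simp
  then have "AE x in lborel. ennreal (cmod (f x) powr p) = 0"
    by (subst (asm) nn_integral_0_iff_AE) auto
  then show ?thesis by (auto elim!: eventually_mono simp: ennreal_eq_0_iff)
qed

lemma ae_eq_if_Lp_norm_0:
  assumes "in_Lp p (\<lambda>x. f x - g x)" "p > 0" "Lp_norm p (\<lambda>x. f x - g x) \<le> 0"
  shows "ae_eq f g"
  using Lp_norm_eq_0_imp[OF assms(1,2)] assms(3) Lp_norm_nonneg[of p "\<lambda>x. f x - g x"]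
      by (auto simp: ae_eq_def)

lemma
  assumes "in_Lp p f" "p > 0"
  shows in_Lp_cmult: "in_Lp p (\<lambda>x. c * f x)"
    and Lp_norm_cmult: "Lp_norm p (\<lambda>x. c * f x) = cmod c * Lp_norm p f"
proof -
  have [measurable]: "f \<in> borel_measurable lborel" using assms by (simp add: in_Lp_def)
  have eq: "(\<integral>\<^sup>+x. ennreal (cmod (c * f x) powr p) \<partial>lborel) = ennreal ((cmod c * Lp_norm p f) powr p)"
  proof -
    have "(\<integral>\<^sup>+x. ennreal (cmod (c * f x) powr p) \<partial>lborel) = ennreal (cmod c powr p)
        * (\<integral>\<^sup>+x. ennreal (cmod (f x) powr p) \<partial>lborel)"
      by (subst nn_integral_cmult[symmetric]) (auto simp: norm_mult powr_mult ennreal_mult)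
    then show ?thesis
      by (simp add: Lp_norm_powr_ennreal[OF assms] powr_mult ennreal_mult)
  qed
  show *: "in_Lp p (\<lambda>x. c * f x)" by (simp add: in_Lp_def eq)
  show "Lp_norm p (\<lambda>x. c * f x) = cmod c * Lp_norm p f"
    using assms(2) by (simp add: Lp_norm_def eq[unfolded Lp_norm_def] powr_powr)
qed

lemma in_Lp_uminus: "in_Lp p f \<Longrightarrow> in_Lp p (\<lambda>x. - f x)"
  by (simp add: in_Lp_def)

lemma Lp_norm_minus_commute: "Lp_norm p (\<lambda>x. f x - g x) = Lp_norm p (\<lambda>x. g x - f x)"
  by (simp add: Lp_norm_def norm_minus_commute)

lemma in_Lp_zero [simp]: "in_Lp p (\<lambda>x. 0)" and Lp_norm_zero [simp]: "Lp_norm p (\<lambda>x. 0) = 0"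
  by (auto simp: in_Lp_def Lp_norm_def)

text \<open>Minkowski's inequality from convexity of the power, with weights
  \<open>a / (a + b)\<close> and \<open>b / (a + b)\<close>. Taking \<open>a\<close> and
  \<open>b\<close> strictly above the norms avoids division by a vanishing norm; afterwards they
  decrease to the norms.\<close>

lemma
  assumes f: "in_Lp p f" and g: "in_Lp p g" and p: "p \<ge> 1"
  shows in_Lp_add: "in_Lp p (\<lambda>x. f x + g x)"
    and Lp_norm_triangle: "Lp_norm p (\<lambda>x. f x + g x) \<le> Lp_norm p f + Lp_norm p g"
proof -
  have [measurable]: "f \<in> borel_measurable lborel" "g \<in> borel_measurable lborel"
    using f g by (auto simp: in_Lp_def)
  have *: "(\<integral>\<^sup>+x. ennreal (cmod (f x + g x) powr p) \<partial>lborel) \<le> ennreal ((a + b) powr p)"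
    if a: "a > Lp_norm p f" and b: "b > Lp_norm p g" for a b
  proof -
    have ab: "a > 0" "b > 0" using a b by (smt (verit) Lp_norm_nonneg)+
    define s where "s = b / (a + b)"
    have s: "0 \<le> s" "s \<le> 1" "1 - s = a / (a + b)" using ab by (auto simp: s_def field_simps)
    have pw: "cmod (f x + g x) powr p \<le> (a + b) powr p * ((1 - s) / a powr p * cmod (f x) powr p
        + s / b powr p * cmod (g x) powr p)" for x
    proof -
      have "cmod (f x + g x) \<le> (a + b) * ((1 - s) * (cmod (f x) / a) + s * (cmod (g x) / b))"
      proof -
        have "(a + b) * ((1 - s) * (cmod (f x) / a) + s * (cmod (g x) / b)) = cmod (f x) + cmod (g x)"
          unfolding s(3) unfolding s_def distrib_left using ab by simp
        then show ?thesis using norm_triangle_ineq[of "f x" "g x"] by simp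
      qed
      then have "cmod (f x + g x) powr p \<le> ((a + b) * ((1 - s) * (cmod (f x) / a) + s
          * (cmod (g x) / b))) powr p"
        using p by (intro powr_mono2) auto
      also have "\<dots> = (a + b) powr p * ((1 - s) * (cmod (f x) / a) + s * (cmod (g x) / b)) powr p"
        using ab s by (simp add: powr_mult)
      also have "\<dots> \<le> (a + b) powr p * ((1 - s) * (cmod (f x) / a) powr p + s * (cmod (g x) / b) powr p)"
        using ab s p by (intro mult_left_mono powr_convex_segment) auto
      also have "\<dots> = (a + b) powr p * ((1 - s) / a powr p * cmod (f x) powr p + s / b powr p
          * cmod (g x) powr p)"
        using ab by (simp add: powr_divide)
      finally show ?thesis .
    qed
    have int: "integrable lborel (\<lambda>x. (a + b) powr p * ((1 - s) / a powr p * cmod (f x) powr p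
        + s / b powr p * cmod (g x) powr p))"
      using in_Lp_integrable[OF f] in_Lp_integrable[OF g] by simp
    have "(\<integral>\<^sup>+x. ennreal (cmod (f x + g x) powr p) \<partial>lborel)
        \<le> (\<integral>\<^sup>+x. ennreal ((a + b) powr p * ((1 - s) / a powr p * cmod (f x) powr p + s / b powr p
            * cmod (g x) powr p)) \<partial>lborel)"
      using pw by (intro nn_integral_mono ennreal_leI)
    also have "\<dots> = ennreal (\<integral>x. (a + b) powr p * ((1 - s) / a powr p * cmod (f x) powr p + s / b powr p
        * cmod (g x) powr p) \<partial>lborel)"
      using s(1,2) by (intro nn_integral_eq_integral int AE_I2 mult_nonneg_nonneg add_nonneg_nonneg) auto
    also have "(\<integral>x. (a + b) powr p * ((1 - s) / a powr p * cmod (f x) powr p + s / b powr p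
        * cmod (g x) powr p) \<partial>lborel)
       = (a + b) powr p * ((1 - s) / a powr p * Lp_norm p f powr p + s / b powr p * Lp_norm p g powr p)"
      using in_Lp_integrable[OF f] in_Lp_integrable[OF g] Lp_norm_powr[OF f] Lp_norm_powr[OF g] p by simp
    also have "\<dots> \<le> (a + b) powr p * ((1 - s) / a powr p * a powr p + s / b powr p * b powr p)"
      using a b ab s p by (intro mult_left_mono add_mono powr_mono2) auto
    also have "\<dots> = (a + b) powr p" using ab by simp
    finally show ?thesis by (simp add: ennreal_leI)
  qed
  have m: "(\<lambda>x. f x + g x) \<in> borel_measurable lborel" by simp
  note I = Lp_norm_leI[OF _ _ m *, of "Lp_norm p f + e" "Lp_norm p g + e" for e]
  show "in_Lp p (\<lambda>x. f x + g x)" using I(1)[of 1] p by (simp add: add_nonneg_nonneg)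
  show "Lp_norm p (\<lambda>x. f x + g x) \<le> Lp_norm p f + Lp_norm p g"
  proof (rule field_le_epsilon)
    fix e :: real assume "e > 0"
    then show "Lp_norm p (\<lambda>x. f x + g x) \<le> Lp_norm p f + Lp_norm p g + e"
      using I(2)[of "e/2"] p by (simp add: add_nonneg_nonneg)
  qed
qed

lemma
  assumes "in_Lp p f" "in_Lp p g" "p \<ge> 1"
  shows in_Lp_diff: "in_Lp p (\<lambda>x. f x - g x)"
    and Lp_norm_triangle_ineq2: "Lp_norm p f \<le> Lp_norm p (\<lambda>x. f x - g x) + Lp_norm p g"
proof -
  show 1: "in_Lp p (\<lambda>x. f x - g x)"
    using in_Lp_add[OF assms(1) in_Lp_uminus[OF assms(2)] assms(3)] by simp
  show "Lp_norm p f \<le> Lp_norm p (\<lambda>x. f x - g x) + Lp_norm p g"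
    using Lp_norm_triangle[OF 1 assms(2,3)] by simp
qed

lemma Lp_norm_dist_triangle:
  assumes "in_Lp p f" "in_Lp p g" "in_Lp p h" "p \<ge> 1"
  shows "Lp_norm p (\<lambda>x. f x - h x) \<le> Lp_norm p (\<lambda>x. f x - g x) + Lp_norm p (\<lambda>x. g x - h x)"
  using Lp_norm_triangle[OF in_Lp_diff[OF assms(1,2,4)] in_Lp_diff[OF assms(2,3,4)] assms(4)] by simp

text \<open>Young's inequality after normalisation, again by numbers \<open>a\<close> and
  \<open>b\<close> strictly above the norms that are then lowered to them.\<close>

lemma
  assumes f: "in_Lp p f" and g: "in_Lp q g" and pq: "p > 1" "q > 1" "1 / p + 1 / q = 1"
  shows Holder_integrable: "integrable lborel (\<lambda>x. f x * g x)"
    and Holder_ineq: "cmod (\<integral>x. f x * g x \<partial>lborel) \<le> Lp_norm p f * Lp_norm q g"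
proof -
  have [measurable]: "f \<in> borel_measurable lborel" "g \<in> borel_measurable lborel"
    using f g by (auto simp: in_Lp_def)
  have *: "integrable lborel (\<lambda>x. f x * g x) \<and> cmod (\<integral>x. f x * g x \<partial>lborel) \<le> a * b"
    if a: "a > Lp_norm p f" and b: "b > Lp_norm q g" for a b
  proof -
    have ab: "a > 0" "b > 0" using a b by (smt (verit) Lp_norm_nonneg)+
    define B where "B x = (a * b / p / a powr p) * cmod (f x) powr p + (a * b / q / b powr q)
        * cmod (g x) powr q" for x
    have pw: "cmod (f x * g x) \<le> B x" for x
    proof -
      have "(cmod (f x) / a) * (cmod (g x) / b) \<le> (cmod (f x) / a) powr p / p + (cmod (g x) / b) powr q / q"
        using pq ab by (intro Youngs_inequality) auto
      then have "a * b * ((cmod (f x) / a) * (cmod (g x) / b)) \<le> a * b * ((cmod (f x) / a) powr p / p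
          + (cmod (g x) / b) powr q / q)"
        using ab by (intro mult_left_mono) auto
      then show ?thesis using ab by (simp add: B_def norm_mult powr_divide distrib_left mult.commute)
    qed
    have int: "integrable lborel B"
      unfolding B_def using in_Lp_integrable[OF f] in_Lp_integrable[OF g] by simp
    have i: "integrable lborel (\<lambda>x. f x * g x)"
      by (rule Bochner_Integration.integrable_bound[OF int]) (use pw in \<open>auto intro!: AE_I2 intro:
          order_trans[OF _ abs_ge_self]\<close>)
    have "cmod (\<integral>x. f x * g x \<partial>lborel) \<le> (\<integral>x. cmod (f x * g x) \<partial>lborel)" by (rule integral_norm_bound)
    also have "\<dots> \<le> (\<integral>x. B x \<partial>lborel)" using i int pw by (intro integral_mono) auto
    also have "\<dots> = (a * b / p / a powr p) * Lp_norm p f powr p + (a * b / q / b powr q)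
        * Lp_norm q g powr q"
      unfolding B_def using in_Lp_integrable[OF f] in_Lp_integrable[OF g] Lp_norm_powr[OF f]
          Lp_norm_powr[OF g] pq by simp
    also have "\<dots> \<le> (a * b / p / a powr p) * a powr p + (a * b / q / b powr q) * b powr q"
      using a b ab pq by (intro mult_left_mono add_mono powr_mono2) auto
    also have "\<dots> = a * b * (1 / p + 1 / q)" using ab by (simp add: distrib_left)
    finally show ?thesis using i pq by simp
  qed
  show "integrable lborel (\<lambda>x. f x * g x)"
    using *[of "Lp_norm p f + 1" "Lp_norm q g + 1"] by simp
  have "(\<lambda>n. (Lp_norm p f + inverse (real (Suc n))) * (Lp_norm q g + inverse (real (Suc n))))
      \<longlonglongrightarrow> (Lp_norm p f + 0) * (Lp_norm q g + 0)"
    by (intro tendsto_intros LIMSEQ_inverse_real_of_nat)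
  then show "cmod (\<integral>x. f x * g x \<partial>lborel) \<le> Lp_norm p f * Lp_norm q g"
    by (intro LIMSEQ_le_const[of _ "Lp_norm p f * Lp_norm q g"]) (use * in auto)
qed

section \<open>Completeness and extension by density\<close>

lemma Lp_Fatou:
  assumes p: "p > 0" and f: "\<And>n. in_Lp p (f n)" and [measurable]: "g \<in> borel_measurable lborel"
    and lim: "AE x in lborel. (\<lambda>n. f n x) \<longlonglongrightarrow> g x"
    and B: "\<And>n. Lp_norm p (f n) \<le> B n" "B \<longlonglongrightarrow> b"
  shows "in_Lp p g" "Lp_norm p g \<le> b"
proof -
  have [measurable]: "f n \<in> borel_measurable lborel" for n using f by (auto simp: in_Lp_def)
  have Bn: "B n \<ge> 0" for n using B(1)[of n] Lp_norm_nonneg[of p "f n"] by linarith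
  then have b: "b \<ge> 0" using B(2) by (auto intro: LIMSEQ_le_const)
  have "(\<integral>\<^sup>+x. ennreal (cmod (g x) powr p) \<partial>lborel)
      = (\<integral>\<^sup>+x. liminf (\<lambda>n. ennreal (cmod (f n x) powr p)) \<partial>lborel)"
  proof (rule nn_integral_cong_AE)
    show "AE x in lborel. ennreal (cmod (g x) powr p) = liminf (\<lambda>n. ennreal (cmod (f n x) powr p))"
      using lim
    proof eventually_elim
      case (elim x)
      have "(\<lambda>n. ennreal (cmod (f n x) powr p)) \<longlonglongrightarrow> ennreal (cmod (g x) powr p)"
        using elim p by (intro tendsto_ennrealI tendsto_powr' tendsto_norm tendsto_const) auto
      then show ?case by (rule lim_imp_Liminf[symmetric, rotated]) simp
    qed
  qed
  also have "\<dots> \<le> liminf (\<lambda>n. \<integral>\<^sup>+x. ennreal (cmod (f n x) powr p) \<partial>lborel)"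
    by (rule nn_integral_liminf) simp
  also have "\<dots> \<le> liminf (\<lambda>n. ennreal (B n powr p))"
    using B(1) p by (intro Liminf_mono always_eventually allI)
      (auto simp: Lp_norm_powr_ennreal[OF f p] intro!: ennreal_leI powr_mono2)
  also have "\<dots> = ennreal (b powr p)"
    using B(2) p Bn by (intro lim_imp_Liminf tendsto_ennrealI tendsto_powr' tendsto_const) auto
  finally show "in_Lp p g" "Lp_norm p g \<le> b" using Lp_norm_leI[OF p b assms(3)] by auto
qed

text \<open>The core of the Riesz-Fischer theorem: the partial sums \<open>G\<close> of the absolute
  increments increase with bounded norms, so by monotone convergence their supremum is finite almost
  everywhere.\<close>

lemma Lp_summable_increments_converge:
  assumes p: "p \<ge> 1" and f: "\<And>n. in_Lp p (f n)"
    and b: "\<And>n. Lp_norm p (\<lambda>x. f (Suc n) x - f n x) \<le> b n" and sb: "summable b"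
  shows "AE x in lborel. convergent (\<lambda>n. f n x)"
proof -
  have [measurable]: "f n \<in> borel_measurable lborel" for n using f by (auto simp: in_Lp_def)
  define G where "G n x = (\<Sum>k<n. cmod (f (Suc k) x - f k x))" for n x
  have [measurable]: "G n \<in> borel_measurable lborel" for n unfolding G_def[abs_def] by measurable
  have d: "in_Lp p (\<lambda>x. complex_of_real (cmod (f (Suc n) x - f n x)))"
    "Lp_norm p (\<lambda>x. complex_of_real (cmod (f (Suc n) x - f n x))) \<le> b n" for n
    using in_Lp_diff[OF f f p, of "Suc n" n] b[of n] by (auto simp: in_Lp_def Lp_norm_def)
  have b0: "b n \<ge> 0" for n using b[of n] Lp_norm_nonneg[of p "\<lambda>x. f (Suc n) x - f n x"] by linarith
  have GLp: "in_Lp p (\<lambda>x. complex_of_real (G n x)) \<and> Lp_norm p (\<lambda>x. complex_of_real (G n x))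
      \<le> (\<Sum>k<n. b k)" for n
  proof (induction n)
    case (Suc n)
    then show ?case
      using in_Lp_add[OF _ d(1) p, of "\<lambda>x. complex_of_real (G n x)" n]
        Lp_norm_triangle[OF _ d(1) p, of "\<lambda>x. complex_of_real (G n x)" n] d(2)[of n]
      by (simp add: G_def)
  qed (simp add: G_def)
  define B where "B = suminf b"
  have inc: "incseq (\<lambda>n. ennreal (G n x powr p))" for x
    using p by (intro incseq_SucI ennreal_leI powr_mono2) (auto simp: G_def intro: sum_nonneg)
  have G0: "G n x \<ge> 0" for n x by (auto simp: G_def intro: sum_nonneg)
  have "(\<integral>\<^sup>+x. (SUP n. ennreal (G n x powr p)) \<partial>lborel) = (SUP n. \<integral>\<^sup>+x. ennreal (G n x powr p) \<partial>lborel)"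
    using inc by (intro nn_integral_monotone_convergence_SUP) (auto simp: incseq_def le_fun_def)
  also have "\<dots> \<le> ennreal (B powr p)"
  proof (rule SUP_least)
    fix n
    have "Lp_norm p (\<lambda>x. complex_of_real (G n x)) \<le> B"
      using GLp[of n] sum_le_suminf[OF sb, of "{..<n}"] b0 by (auto simp: B_def)
    then show "(\<integral>\<^sup>+x. ennreal (G n x powr p) \<partial>lborel) \<le> ennreal (B powr p)"
      using Lp_norm_powr_ennreal[of p "\<lambda>x. complex_of_real (G n x)"] GLp[of n] p G0
      by (auto intro!: ennreal_leI powr_mono2)
  qed
  also have "\<dots> < \<infinity>" by simp
  finally have "AE x in lborel. (SUP n. ennreal (G n x powr p)) \<noteq> \<infinity>"
    by (intro nn_integral_PInf_AE) auto
  then show ?thesis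
  proof eventually_elim
    case (elim x)
    then obtain r where r: "r \<ge> 0" "(SUP n. ennreal (G n x powr p)) = ennreal r"
      by (cases "SUP n. ennreal (G n x powr p)") auto
    have "G n x \<le> r powr (1/p)" for n
    proof -
      have "ennreal (G n x powr p) \<le> ennreal r" unfolding r(2)[symmetric] by (rule SUP_upper) simp
      then have "G n x powr p \<le> r" using r by simp
      then have "(G n x powr p) powr (1/p) \<le> r powr (1/p)" using p by (intro powr_mono2) auto
      then show ?thesis using p G0 by (simp add: powr_powr)
    qed
    then have "summable (\<lambda>n. cmod (f (Suc n) x - f n x))"
      unfolding G_def
      by (intro bounded_imp_summable[where B="r powr (1/p)"]) (auto simp flip: lessThan_Suc_atMost simp
          del: sum.lessThan_Suc)
    then have "summable (\<lambda>n. f (Suc n) x - f n x)" by (rule summable_norm_cancel)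
    then have "convergent (\<lambda>n. (\<Sum>i<n. f (Suc i) x - f i x) + f 0 x)"
      by (intro convergent_add convergent_const) (simp add: summable_iff_convergent)
    then show ?case unfolding sum_lessThan_telescope[of "\<lambda>n. f n x"] by simp
  qed
qed

text \<open>Only a Lipschitz bound is asked of \<open>S\<close>, no linearity, so that it serves
  both the Fourier transform and the multiplier. The limit \<open>w\<close> is described by its
  distance to every \<open>S h\<close>; all further properties of an extension can be read off from
  that.\<close>

lemma Lp_extension:
  fixes f :: "'a::euclidean_space \<Rightarrow> complex"
  assumes p: "p \<ge> 1" and f: "in_Lp p f" and C: "C \<ge> 0"
    and dense: "\<And>e. e > 0 \<Longrightarrow> \<exists>h\<in>D. Lp_norm p (\<lambda>x. f x - h x) < e"
    and D: "\<And>h. h \<in> D \<Longrightarrow> in_Lp p h" "\<And>h. h \<in> D \<Longrightarrow> in_Lp p (S h)"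
    and lip: "\<And>h k. h \<in> D \<Longrightarrow> k \<in> D \<Longrightarrow>
      Lp_norm p (\<lambda>x. S h x - S k x) \<le> C * Lp_norm p (\<lambda>x. h x - k x)"
  obtains w :: "'a \<Rightarrow> complex" where "in_Lp p w"
    "\<And>h. h \<in> D \<Longrightarrow> Lp_norm p (\<lambda>x. w x - S h x) \<le> C * Lp_norm p (\<lambda>x. f x - h x)"
proof -
  \<comment> \<open>The geometric rate makes the increments of \<open>S (h n)\<close> summable,
    hence the sequence converges almost everywhere without passing to a subsequence.\<close>
  have "\<exists>h\<in>D. Lp_norm p (\<lambda>x. f x - h x) < (1/2)^n" for n by (rule dense) simp
  then obtain h where h: "\<And>n. h n \<in> D" "\<And>n. Lp_norm p (\<lambda>x. f x - h n x) < (1/2)^n" by metis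
  have hs: "Lp_norm p (\<lambda>x. S (h n) x - S k x) \<le> C * (Lp_norm p (\<lambda>x. f x - k x) + (1/2)^n)" if "k \<in> D"
      for n k
  proof -
    have "Lp_norm p (\<lambda>x. S (h n) x - S k x) \<le> C * Lp_norm p (\<lambda>x. h n x - k x)" using lip h that by auto
    also have "Lp_norm p (\<lambda>x. h n x - k x) \<le> Lp_norm p (\<lambda>x. h n x - f x) + Lp_norm p (\<lambda>x. f x - k x)"
      using Lp_norm_dist_triangle[OF D(1)[OF h(1)] f D(1)[OF that] p] .
    also have "\<dots> \<le> Lp_norm p (\<lambda>x. f x - k x) + (1/2)^n"
      using h(2)[of n] by (simp add: Lp_norm_minus_commute[of p "h n" f])
    finally show ?thesis using C by (simp add: mult_left_mono)
  qed
  have "Lp_norm p (\<lambda>x. S (h (Suc n)) x - S (h n) x) \<le> C * (2 * (1/2)^n)" for n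
  proof -
    have "Lp_norm p (\<lambda>x. S (h (Suc n)) x - S (h n) x) \<le> C * (Lp_norm p (\<lambda>x. f x - h n x) + (1/2)^Suc n)"
      using hs h(1) by blast
    also have "\<dots> \<le> C * (2 * (1/2)^n)"
    proof (rule mult_left_mono[OF _ C])
      have "(1/2::real) ^ Suc n \<le> (1/2) ^ n" by (rule power_decreasing) auto
      then show "Lp_norm p (\<lambda>x. f x - h n x) + (1/2) ^ Suc n \<le> 2 * (1/2) ^ n" using h(2)[of n] by linarith
    qed
    finally show ?thesis .
  qed
  then have conv: "AE x in lborel. convergent (\<lambda>n. S (h n) x)"
    by (intro Lp_summable_increments_converge[OF p D(2)[OF h(1)], where b="\<lambda>n. C * (2 * (1/2)^n)"])
       (auto intro!: summable_mult summable_geometric)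
  define w where "w x = lim (\<lambda>n. S (h n) x)" for x
  have Sm [measurable]: "S (h n) \<in> borel_measurable lborel" for n using D(2)[OF h(1)]
      by (auto simp: in_Lp_def)
  have wm [measurable]: "w \<in> borel_measurable lborel" unfolding w_def
      by (rule borel_measurable_lim_metric) simp
  have w: "AE x in lborel. (\<lambda>n. S (h n) x) \<longlonglongrightarrow> w x"
    using conv by eventually_elim (simp add: w_def convergent_LIMSEQ_iff)
  have *: "in_Lp p (\<lambda>x. w x - S k x) \<and> Lp_norm p (\<lambda>x. w x - S k x) \<le> C * Lp_norm p (\<lambda>x. f x - k x)"
      if k: "k \<in> D" for k
  proof -
    have [measurable]: "S k \<in> borel_measurable lborel" using D(2)[OF k] by (auto simp: in_Lp_def)
    have l: "AE x in lborel. (\<lambda>n. S (h n) x - S k x) \<longlonglongrightarrow> w x - S k x"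
      using w by eventually_elim (intro tendsto_intros)
    have "(\<lambda>n. C * (Lp_norm p (\<lambda>x. f x - k x) + (1/2)^n)) \<longlonglongrightarrow> C * (Lp_norm p (\<lambda>x. f x - k x) + 0)"
      by (intro tendsto_intros LIMSEQ_power_zero) auto
    then show ?thesis
      using Lp_Fatou[OF _ in_Lp_diff[OF D(2)[OF h(1)] D(2)[OF k] p] _ l hs[OF k]] p by auto
  qed
  have "in_Lp p w"
    using in_Lp_add[OF conjunct1[OF *[OF h(1)[of 0]]] D(2)[OF h(1)[of 0]] p] by simp
  then show ?thesis using that * by blast
qed

section \<open>A dense class common to all exponents\<close>

definition truncation :: "nat \<Rightarrow> ('a::euclidean_space \<Rightarrow> complex) \<Rightarrow> 'a \<Rightarrow> complex" where
  "truncation n f x = (if norm x \<le> real n \<and> cmod (f x) \<le> real n then f x else 0)"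

text \<open>Boundedness of the values is included: such functions lie in every \<open>L^p\<close> at
  once, and \<open>truncation\<close>, which cuts in space and in height, always produces
  one.\<close>

definition bounded_support :: "('a::euclidean_space \<Rightarrow> complex) \<Rightarrow> bool" where
  "bounded_support f \<longleftrightarrow> f \<in> borel_measurable lborel \<and> (\<exists>B R. \<forall>x. cmod (f x) \<le> B \<and> (norm x > R \<longrightarrow> f x = 0))"

lemma cball_emeasure_finite: "emeasure lborel (cball (0::'a::euclidean_space) R) < \<infinity>"
  using emeasure_bounded_finite[OF bounded_cball] by blast

lemma truncation_measurable [measurable]:
  assumes [measurable]: "f \<in> borel_measurable lborel"
  shows "truncation n f \<in> borel_measurable lborel"
  unfolding truncation_def[abs_def] by measurable

lemma truncation_bounded_support:
  assumes "f \<in> borel_measurable lborel"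
  shows "bounded_support (truncation n f)"
  unfolding bounded_support_def using assms
  by (auto intro!: exI[of _ "real n"] simp: truncation_def)

lemma bounded_support_in_Lp:
  fixes f :: "'a::euclidean_space \<Rightarrow> complex"
  assumes f: "bounded_support f" and p: "p > 0"
  shows "in_Lp p f"
proof -
  obtain B R where B: "\<And>x. cmod (f x) \<le> B" "\<And>x. norm x > R \<Longrightarrow> f x = 0"
    using f by (auto simp: bounded_support_def)
  have "(\<integral>\<^sup>+x. ennreal (cmod (f x) powr p) \<partial>lborel) \<le> (\<integral>\<^sup>+x. ennreal (B powr p)
      * indicator (cball (0::'a) R) x \<partial>lborel)"
  proof (rule nn_integral_mono)
    fix x
    have "cmod (f x) powr p \<le> B powr p" using B(1) p by (intro powr_mono2) auto
    then show "ennreal (cmod (f x) powr p) \<le> ennreal (B powr p) * indicator (cball 0 R) x"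
      using B(2)[of x] by (cases "norm x \<le> R") (auto simp: ennreal_leI)
  qed
  also have "\<dots> = ennreal (B powr p) * emeasure lborel (cball (0::'a) R)"
      by (simp add: nn_integral_cmult_indicator)
  also have "\<dots> < \<infinity>" using cball_emeasure_finite[where 'a='a, of R] by (simp add: ennreal_mult_less_top)
  finally show ?thesis using f by (simp add: in_Lp_def bounded_support_def)
qed

lemma bounded_support_integrable:
  assumes f: "bounded_support f"
  shows "integrable lborel f"
  using bounded_support_in_Lp[OF f, of 1] by (auto simp: in_Lp_iff_integrable integrable_norm_iff)

lemma truncation_tendsto:
  "(\<lambda>n. truncation n f x) \<longlonglongrightarrow> f x"
proof (rule tendsto_eventually)
  obtain N :: nat where N: "max (norm x) (cmod (f x)) \<le> real N" using real_arch_simple by blast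
  show "\<forall>\<^sub>F n in sequentially. truncation n f x = f x"
    using eventually_ge_at_top[of N]
    by eventually_elim (use N in \<open>auto simp: truncation_def\<close>)
qed

lemma cmod_truncation_le: "cmod (truncation n f x) \<le> cmod (f x)"
  by (simp add: truncation_def)

lemma Lp_dominated_convergence:
  fixes f :: "'a::euclidean_space \<Rightarrow> complex"
  assumes p: "p > 0" and g: "in_Lp p g" and [measurable]: "f \<in> borel_measurable lborel"
    and [measurable]: "\<And>n. h n \<in> borel_measurable lborel"
    and le: "\<And>n x. cmod (f x - h n x) \<le> cmod (g x)"
    and lim: "AE x in lborel. (\<lambda>n. h n x) \<longlonglongrightarrow> f x"
  shows "(\<lambda>n. Lp_norm p (\<lambda>x. f x - h n x)) \<longlonglongrightarrow> 0"
proof -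
  have [measurable]: "g \<in> borel_measurable lborel" using g by (simp add: in_Lp_def)
  have "(\<lambda>n. \<integral>\<^sup>+x. ennreal (cmod (f x - h n x) powr p) \<partial>lborel) \<longlonglongrightarrow> (\<integral>\<^sup>+x. 0 \<partial>(lborel :: 'a measure))"
  proof (rule nn_integral_dominated_convergence[where w="\<lambda>x. ennreal (cmod (g x) powr p)"])
    show "AE x in lborel. ennreal (cmod (f x - h j x) powr p) \<le> ennreal (cmod (g x) powr p)" for j
      using le p by (intro AE_I2 ennreal_leI powr_mono2) auto
    show "(\<integral>\<^sup>+x. ennreal (cmod (g x) powr p) \<partial>lborel) < \<infinity>" using g by (simp add: in_Lp_def)
    show "AE x in lborel. (\<lambda>i. ennreal (cmod (f x - h i x) powr p)) \<longlonglongrightarrow> 0"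
      using lim
    proof eventually_elim
      case (elim x)
      have "(\<lambda>i. cmod (f x - h i x)) \<longlonglongrightarrow> cmod (f x - f x)" using elim by (intro tendsto_intros)
      then have "(\<lambda>i. cmod (f x - h i x) powr p) \<longlonglongrightarrow> 0 powr p"
        using p by (intro tendsto_powr' tendsto_const) auto
      then have "(\<lambda>i. ennreal (cmod (f x - h i x) powr p)) \<longlonglongrightarrow> ennreal 0" by (intro tendsto_ennrealI) simp
      then show ?case by simp
    qed
  qed auto
  then have "(\<lambda>n. \<integral>\<^sup>+x. ennreal (cmod (f x - h n x) powr p) \<partial>lborel) \<longlonglongrightarrow> ennreal 0" by simp
  then have "(\<lambda>n. enn2real (\<integral>\<^sup>+x. ennreal (cmod (f x - h n x) powr p) \<partial>lborel)) \<longlonglongrightarrow> 0"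
    by (rule tendsto_enn2real) simp
  then have "(\<lambda>n. enn2real (\<integral>\<^sup>+x. ennreal (cmod (f x - h n x) powr p) \<partial>lborel) powr (1/p)) \<longlonglongrightarrow> 0 powr (1/p)"
    using p by (intro tendsto_powr' tendsto_const) auto
  then show ?thesis by (simp add: Lp_norm_def)
qed

lemma truncation_Lp_tendsto:
  assumes p: "p > 0" and f: "in_Lp p f"
  shows "(\<lambda>n. Lp_norm p (\<lambda>x. f x - truncation n f x)) \<longlonglongrightarrow> 0"
  using in_Lp_measurable[OF f]
  by (intro Lp_dominated_convergence[OF p f] AE_I2 truncation_tendsto truncation_measurable)
     (auto simp: truncation_def)

section \<open>Plancherel's theorem\<close>

lemma in_L2_iff: "in_Lp 2 f \<longleftrightarrow> f \<in> borel_measurable lborel \<and> integrable lborel (\<lambda>x. (cmod (f x))\<^sup>2)"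
  by (simp add: in_Lp_iff_integrable)

lemma L2_norm_sq: "in_Lp 2 f \<Longrightarrow> (Lp_norm 2 f)\<^sup>2 = (\<integral>x. (cmod (f x))\<^sup>2 \<partial>lborel)"
  using Lp_norm_powr[of 2 f] by simp

lemma cis_borel_measurable [measurable]: "cis \<in> borel_measurable borel"
  by (intro borel_measurable_continuous_onI continuous_on_cis continuous_on_id)

lemma complex_of_real_borel_measurable [measurable]: "complex_of_real \<in> borel_measurable borel"
  by (intro borel_measurable_continuous_onI continuous_on_of_real continuous_on_id)

lemma cnj_borel_measurable [measurable]: "cnj \<in> borel_measurable borel"
  by (intro borel_measurable_continuous_onI continuous_on_cnj continuous_on_id)

section \<open>Product integrals and affine substitutions\<close>

lemma pair_integrable_mult:
  fixes f :: "'a \<Rightarrow> complex" and g :: "'b \<Rightarrow> complex"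
  assumes "sigma_finite_measure M" "sigma_finite_measure N" and f: "integrable M f" and g: "integrable N g"
  shows "integrable (M \<Otimes>\<^sub>M N) (\<lambda>z. f (fst z) * g (snd z))"
    and "(\<integral>z. f (fst z) * g (snd z) \<partial>(M \<Otimes>\<^sub>M N)) = (\<integral>x. f x \<partial>M) * (\<integral>y. g y \<partial>N)"
proof -
  interpret M: sigma_finite_measure M by fact
  interpret N: sigma_finite_measure N by fact
  interpret pair_sigma_finite M N ..
  have [measurable]: "f \<in> borel_measurable M" "g \<in> borel_measurable N" using f g by auto
  show *: "integrable (M \<Otimes>\<^sub>M N) (\<lambda>z. f (fst z) * g (snd z))"
    using f g by (intro Fubini_integrable) (auto simp: norm_mult)
  show "(\<integral>z. f (fst z) * g (snd z) \<partial>(M \<Otimes>\<^sub>M N)) = (\<integral>x. f x \<partial>M) * (\<integral>y. g y \<partial>N)"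
    using integral_fst'[OF *] by simp
qed

lemma
  fixes f :: "'a::euclidean_space \<Rightarrow> 'b::{banach, second_countable_topology}"
  assumes [measurable]: "f \<in> borel_measurable borel" and c: "c \<noteq> 0"
  shows lborel_integral_affine: "(\<integral>x. f x \<partial>lborel) = (\<bar>c\<bar> ^ DIM('a)) *\<^sub>R (\<integral>x. f (t + c *\<^sub>R x) \<partial>lborel)"
    and lborel_integrable_affine: "integrable lborel f \<Longrightarrow> integrable lborel (\<lambda>x. f (t + c *\<^sub>R x))"
proof -
  have l: "lborel = density (distr lborel borel (\<lambda>x::'a. t + c *\<^sub>R x)) (\<lambda>_. ennreal (\<bar>c\<bar> ^ DIM('a)))"
    using lborel_affine[OF c, of t] by (simp add: ennreal_power)
  show "(\<integral>x. f x \<partial>lborel) = (\<bar>c\<bar> ^ DIM('a)) *\<^sub>R (\<integral>x. f (t + c *\<^sub>R x) \<partial>lborel)"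
    by (subst l) (simp add: integral_density integral_distr)
  assume "integrable lborel f"
  then have "integrable (density (distr lborel borel (\<lambda>x::'a. t
      + c *\<^sub>R x)) (\<lambda>_. ennreal (\<bar>c\<bar> ^ DIM('a)))) f"
    by (subst (asm) l)
  then have "integrable lborel (\<lambda>x. (\<bar>c\<bar> ^ DIM('a)) *\<^sub>R f (t + c *\<^sub>R x))"
    by (simp add: integrable_density integrable_distr_eq)
  then have "integrable lborel (\<lambda>x. inverse (\<bar>c\<bar> ^ DIM('a)) *\<^sub>R ((\<bar>c\<bar> ^ DIM('a)) *\<^sub>R f (t + c *\<^sub>R x)))"
    by (rule integrable_scaleR_right)
  then show "integrable lborel (\<lambda>x. f (t + c *\<^sub>R x))" using c by simp
qed

lemma
  fixes f :: "'a::euclidean_space \<Rightarrow> 'b::{banach, second_countable_topology}"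
  assumes [measurable]: "f \<in> borel_measurable borel"
  shows lborel_integral_translate: "(\<integral>x. f (x + t) \<partial>lborel) = (\<integral>x. f x \<partial>lborel)"
    and lborel_integrable_translate: "integrable lborel f \<Longrightarrow> integrable lborel (\<lambda>x. f (x + t))"
  using lborel_integral_affine[OF assms, of 1 t] lborel_integrable_affine[OF assms, of 1 t]
  by (simp_all add: add.commute)

lemma lborel_nn_integral_translate:
  fixes f :: "'a::euclidean_space \<Rightarrow> ennreal"
  assumes [measurable]: "f \<in> borel_measurable borel"
  shows "(\<integral>\<^sup>+x. f (x + t) \<partial>lborel) = (\<integral>\<^sup>+x. f x \<partial>lborel)"
  by (subst (2) lborel_distr_plus[symmetric, of t]) (simp add: nn_integral_distr add.commute)

lemma
  fixes f :: "'a::euclidean_space \<Rightarrow> real \<Rightarrow> complex"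
  assumes f: "\<And>b. b \<in> Basis \<Longrightarrow> integrable lborel (f b)"
  shows lborel_integrable_prod: "integrable lborel (\<lambda>x::'a. \<Prod>b\<in>Basis. f b (x \<bullet> b))"
    and lborel_integral_prod: "(\<integral>x. (\<Prod>b\<in>Basis. f b (x \<bullet> b)) \<partial>(lborel :: 'a measure))
        = (\<Prod>b\<in>Basis. \<integral>x. f b x \<partial>lborel)"
proof -
  interpret product_sigma_finite "\<lambda>_::'a. lborel :: real measure" ..
  have fm [measurable]: "f b \<in> borel_measurable borel" if "b \<in> Basis" for b using f[OF that] by auto
  have m [measurable]: "(\<lambda>x::'a. \<Prod>b\<in>Basis. f b (x \<bullet> b)) \<in> borel_measurable borel"
    by (intro borel_measurable_prod measurable_compose[OF _ fm]) auto
  have eq: "(\<Prod>b\<in>Basis. f b ((\<Sum>b\<in>Basis. x b *\<^sub>R b) \<bullet> b)) = (\<Prod>b\<in>Basis. f b (x b))" for x :: "'a \<Rightarrow> real"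
    by (intro prod.cong) auto
  have i: "integrable (Pi\<^sub>M Basis (\<lambda>_::'a. lborel)) (\<lambda>x. \<Prod>b\<in>Basis. f b (x b))"
    by (rule product_integrable_prod) (auto intro: f)
  show "integrable lborel (\<lambda>x::'a. \<Prod>b\<in>Basis. f b (x \<bullet> b))"
    by (subst lborel_eq, subst integrable_distr_eq) (use i in \<open>auto simp: eq\<close>)
  show "(\<integral>x. (\<Prod>b\<in>Basis. f b (x \<bullet> b)) \<partial>(lborel :: 'a measure)) = (\<Prod>b\<in>Basis. \<integral>x. f b x \<partial>lborel)"
    by (subst lborel_eq, subst integral_distr)
       (use product_integral_prod[of Basis f] f in \<open>auto simp: eq\<close>)
qed

lemma norm_sq_eq_sum_Basis: "(norm (x::'a::euclidean_space))\<^sup>2 = (\<Sum>b\<in>Basis. (x \<bullet> b)\<^sup>2)"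
  by (subst power2_norm_eq_inner, subst euclidean_inner) (simp add: power2_eq_square)

lemma prod_exp_Basis:
  "(\<Prod>b\<in>Basis. exp (- ((x \<bullet> b)\<^sup>2 / 2))) = exp (- ((norm (x::'a::euclidean_space))\<^sup>2 / 2))"
  by (simp add: norm_sq_eq_sum_Basis sum_divide_distrib sum_negf flip: exp_sum)

section \<open>The Gaussian density and its transform\<close>

definition gauss :: "'a::euclidean_space \<Rightarrow> real" where
  "gauss x = (1 / sqrt (2 * pi)) ^ DIM('a) * exp (- (norm x)\<^sup>2 / 2)"

lemma gauss_nonneg [simp]: "gauss x \<ge> 0" by (simp add: gauss_def)

lemma gauss_measurable [measurable]: "gauss \<in> borel_measurable borel"
  unfolding gauss_def[abs_def] by measurable

lemma gauss_prod: "gauss x = (\<Prod>b\<in>Basis. std_normal_density (x \<bullet> b))"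
  by (simp add: gauss_def std_normal_density_def prod.distrib prod_dividef prod_exp_Basis power_one_over)

text \<open>Both density and character factorise over the basis, leaving the characteristic function
  of the one-dimensional normal law.\<close>

lemma
  shows gauss_cis_integrable: "integrable lborel (\<lambda>x. cis (\<xi> \<bullet> x) * complex_of_real (gauss x))"
    and fourier_gauss: "fourier (\<lambda>x. complex_of_real (gauss x)) \<xi>
        = complex_of_real (exp (- (norm \<xi>)\<^sup>2 / 2))"
proof -
  have 1: "integrable lborel (\<lambda>x. cis (t * x) * complex_of_real (std_normal_density x))" for t
  proof (rule Bochner_Integration.integrable_bound)
    show "integrable lborel std_normal_density" by simp
  qed (auto simp: norm_mult)
  have 2: "(\<integral>x. cis (t * x) * complex_of_real (std_normal_density x) \<partial>lborel)
      = complex_of_real (exp (- t\<^sup>2 / 2))" for t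
  proof -
    have "(\<integral>x. cis (t * x) * complex_of_real (std_normal_density x) \<partial>lborel)
        = char std_normal_distribution t"
      unfolding char_def
      by (subst integral_density) (auto simp: cis_conv_exp scaleR_conv_of_real mult.commute)
    then show ?thesis by (simp add: char_std_normal_distribution)
  qed
  have eq: "cis (\<xi> \<bullet> x) * complex_of_real (gauss x) =
      (\<Prod>b\<in>Basis. cis ((\<xi> \<bullet> b) * (x \<bullet> b)) * complex_of_real (std_normal_density (x \<bullet> b)))" for x
  proof -
    have "cis (\<xi> \<bullet> x) = (\<Prod>b\<in>Basis. cis ((\<xi> \<bullet> b) * (x \<bullet> b)))"
      by (simp add: euclidean_inner[of \<xi> x] cis_conv_exp sum_distrib_left exp_sum)
    then show ?thesis by (simp add: gauss_prod prod.distrib)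
  qed
  show "integrable lborel (\<lambda>x. cis (\<xi> \<bullet> x) * complex_of_real (gauss x))"
    unfolding eq using 1 by (intro lborel_integrable_prod)
  have "(\<Prod>b\<in>Basis. complex_of_real (exp (- (\<xi> \<bullet> b)\<^sup>2 / 2))) = complex_of_real (exp (- (norm \<xi>)\<^sup>2 / 2))"
    by (simp add: prod_exp_Basis flip: of_real_prod)
  then show "fourier (\<lambda>x. complex_of_real (gauss x)) \<xi> = complex_of_real (exp (- (norm \<xi>)\<^sup>2 / 2))"
    unfolding fourier_def eq using 1 by (subst lborel_integral_prod) (simp_all add: 2)
qed

lemma gauss_integrable: "integrable lborel (gauss :: 'a::euclidean_space \<Rightarrow> real)"
  and gauss_integral: "(\<integral>x. gauss x \<partial>(lborel :: 'a measure)) = 1"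
proof -
  have "integrable lborel (\<lambda>x::'a. complex_of_real (gauss x))" using gauss_cis_integrable[of "0::'a"]
      by simp
  then show "integrable lborel (gauss :: 'a \<Rightarrow> real)" by (metis complex_of_real_integrable_eq)
  have "complex_of_real (\<integral>x. gauss x \<partial>(lborel :: 'a measure)) = 1"
    using fourier_gauss[of "0::'a"] by (simp add: fourier_def)
  then show "(\<integral>x. gauss x \<partial>(lborel :: 'a measure)) = 1" by simp
qed

lemma exp_norm_sq_eq_gauss: "exp (- (norm x)\<^sup>2 / 2) = sqrt (2 * pi) ^ DIM('a)
    * gauss (x::'a::euclidean_space)"
  by (simp add: gauss_def power_one_over)

text \<open>A wide Gaussian cut-off in \<xi> has a narrow Gaussian as transform. The Jacobian stands
  on the left, in the form in which \<open>plancherel_regularized\<close> meets it.\<close>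

lemma
  fixes \<epsilon> :: real and z :: "'a::euclidean_space"
  assumes "\<epsilon> > 0"
  shows integrable_scaled_gauss: "integrable lborel (\<lambda>\<xi>::'a. exp (- (norm (\<epsilon> *\<^sub>R \<xi>))\<^sup>2 / 2))"
    and integral_cis_scaled_gauss:
      "\<epsilon> ^ DIM('a) * (\<integral>\<xi>. cis (\<xi> \<bullet> (\<epsilon> *\<^sub>R z)) * complex_of_real (exp (- (norm (\<epsilon> *\<^sub>R \<xi>))\<^sup>2 / 2)) \<partial>lborel)
        = complex_of_real ((2 * pi) ^ DIM('a) * gauss z)"
proof -
  have i: "integrable lborel (\<lambda>\<xi>::'a. exp (- (norm \<xi>)\<^sup>2 / 2))"
    unfolding exp_norm_sq_eq_gauss using gauss_integrable by simp
  show "integrable lborel (\<lambda>\<xi>::'a. exp (- (norm (\<epsilon> *\<^sub>R \<xi>))\<^sup>2 / 2))"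
    using lborel_integrable_affine[OF _ _ i, of \<epsilon> 0] assms by simp
  define F where "F \<xi> = cis (\<xi> \<bullet> z) * complex_of_real (exp (- (norm \<xi>)\<^sup>2 / 2))" for \<xi>
  have [measurable]: "F \<in> borel_measurable borel" unfolding F_def[abs_def] by measurable
  have "(\<integral>\<xi>. F \<xi> \<partial>lborel) = (\<bar>\<epsilon>\<bar> ^ DIM('a)) *\<^sub>R (\<integral>\<xi>. F (0 + \<epsilon> *\<^sub>R \<xi>) \<partial>lborel)"
    using assms by (intro lborel_integral_affine) auto
  moreover have "(\<integral>\<xi>. F \<xi> \<partial>lborel) = complex_of_real ((2 * pi) ^ DIM('a) * gauss z)"
  proof -
    have "F \<xi> = complex_of_real (sqrt (2 * pi) ^ DIM('a)) * (cis (z \<bullet> \<xi>) * complex_of_real (gauss \<xi>))" for \<xi>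
      unfolding F_def exp_norm_sq_eq_gauss by (simp add: inner_commute)
    then have "(\<integral>\<xi>. F \<xi> \<partial>lborel) = complex_of_real (sqrt (2 * pi) ^ DIM('a))
        * fourier (\<lambda>x. complex_of_real (gauss x)) z"
      by (simp add: fourier_def)
    also have "\<dots> = complex_of_real ((sqrt (2 * pi) ^ DIM('a) * sqrt (2 * pi) ^ DIM('a)) * gauss z)"
      unfolding fourier_gauss exp_norm_sq_eq_gauss by simp
    \<comment> \<open>One factor comes from writing the exponential as \<open>gauss\<close>, the
      other from its transform, which is again an unnormalised Gaussian.\<close>
    also have "sqrt (2 * pi) ^ DIM('a) * sqrt (2 * pi) ^ DIM('a) = (2 * pi) ^ DIM('a)"
      unfolding power_mult_distrib[of "sqrt (2 * pi)" "sqrt (2 * pi)", symmetric] real_sqrt_mult_self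
          by simp
    finally show ?thesis .
  qed
  moreover have "F (0 + \<epsilon> *\<^sub>R \<xi>) = cis (\<xi> \<bullet> (\<epsilon> *\<^sub>R z))
      * complex_of_real (exp (- (norm (\<epsilon> *\<^sub>R \<xi>))\<^sup>2 / 2))" for \<xi>
    by (simp add: F_def)
  ultimately show "\<epsilon> ^ DIM('a) * (\<integral>\<xi>. cis (\<xi> \<bullet> (\<epsilon> *\<^sub>R z))
      * complex_of_real (exp (- (norm (\<epsilon> *\<^sub>R \<xi>))\<^sup>2 / 2)) \<partial>lborel)
        = complex_of_real ((2 * pi) ^ DIM('a) * gauss z)"
    using assms by (simp only: scaleR_conv_of_real abs_of_pos of_real_power)
qed

section \<open>Plancherel's identity on the intersection of L^1 and L^2\<close>

lemma fourier_measurable [measurable]: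
  assumes [measurable]: "f \<in> borel_measurable borel"
  shows "fourier f \<in> borel_measurable borel"
  unfolding fourier_def[abs_def] by measurable

lemma cmod_fourier_le: "cmod (fourier f \<xi>) \<le> (\<integral>x. cmod (f x) \<partial>lborel)"
  unfolding fourier_def using integral_norm_bound[of lborel "\<lambda>z. cis (\<xi> \<bullet> z) * f z"]
      by (simp add: norm_mult)

lemma cis_mult_integrable:
  assumes "integrable lborel f"
  shows "integrable lborel (\<lambda>z. cis (\<xi> \<bullet> z) * f z)"
  by (rule Bochner_Integration.integrable_bound[OF assms]) (use assms in \<open>auto simp: norm_mult\<close>)

lemma fourier_diff:
  assumes "integrable lborel f" "integrable lborel g"
  shows "fourier (\<lambda>x. f x - g x) = (\<lambda>\<xi>. fourier f \<xi> - fourier g \<xi>)"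
  unfolding fourier_def using assms by (simp add: right_diff_distrib cis_mult_integrable fun_eq_iff)

text \<open>The squared transform is a double integral over space. The Gaussian factor makes the
  triple integral absolutely convergent, so \<xi> can be integrated out first, which leaves an
  approximate identity at scale \<epsilon>.\<close>

lemma plancherel_regularized:
  fixes f :: "'a::euclidean_space \<Rightarrow> complex"
  assumes f: "integrable lborel f" and B: "\<And>x. cmod (f x) \<le> B" and \<epsilon>: "\<epsilon> > 0"
  shows "complex_of_real (\<integral>\<xi>. (cmod (fourier f \<xi>))\<^sup>2 * exp (- (norm (\<epsilon> *\<^sub>R \<xi>))\<^sup>2 / 2) \<partial>lborel)
    = (2 * pi) ^ DIM('a) * (\<integral>z. f (fst z) * cnj (f (fst z - \<epsilon> *\<^sub>R snd z))
        * gauss (snd z) \<partial>(lborel \<Otimes>\<^sub>M lborel))"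
proof -
  have fm [measurable]: "f \<in> borel_measurable borel" using f by auto
  let ?P = "lborel \<Otimes>\<^sub>M lborel :: ('a \<times> 'a) measure"
  have Psf: "sigma_finite_measure ?P" by (simp add: lborel_prod sigma_finite_lborel)
  interpret P: sigma_finite_measure ?P by (rule Psf)
  interpret LP: pair_sigma_finite "lborel :: 'a measure" ?P ..
  define E where "E \<xi> = exp (- (norm (\<epsilon> *\<^sub>R \<xi>))\<^sup>2 / 2)" for \<xi> :: 'a
  have [measurable]: "E \<in> borel_measurable borel" unfolding E_def[abs_def] by measurable
  have Ei: "integrable lborel (\<lambda>\<xi>. complex_of_real (E \<xi>))" unfolding E_def
      by (intro integrable_of_real integrable_scaled_gauss \<epsilon>)
  define k where "k z = f (fst z) * cnj (f (snd z))" for z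
  have ki: "integrable ?P k" unfolding k_def
    using f by (intro pair_integrable_mult(1) sigma_finite_lborel) auto
  have km [measurable]: "k \<in> borel_measurable ?P" using ki by auto
  have sq: "complex_of_real ((cmod (fourier f \<xi>))\<^sup>2) = (\<integral>z. cis (\<xi> \<bullet> (fst z - snd z)) * k z \<partial>?P)" for \<xi>
  proof -
    have "complex_of_real ((cmod (fourier f \<xi>))\<^sup>2) = fourier f \<xi> * cnj (fourier f \<xi>)"
      by (rule complex_norm_square)
    also have "\<dots> = (\<integral>x. cis (\<xi> \<bullet> x) * f x \<partial>lborel) * (\<integral>y. cnj (cis (\<xi> \<bullet> y) * f y) \<partial>lborel)"
      by (simp only: fourier_def Bochner_Integration.integral_cnj)
    also have "\<dots> = (\<integral>z. (cis (\<xi> \<bullet> fst z) * f (fst z)) * cnj (cis (\<xi> \<bullet> snd z) * f (snd z)) \<partial>?P)"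
      using cis_mult_integrable[OF f]
      by (intro pair_integrable_mult(2)[symmetric] sigma_finite_lborel integrable_cnj) auto
    also have "\<dots> = (\<integral>z. cis (\<xi> \<bullet> (fst z - snd z)) * k z \<partial>?P)"
    proof (rule Bochner_Integration.integral_cong)
      fix z :: "'a \<times> 'a"
      have "cis (\<xi> \<bullet> (fst z - snd z)) = cis (\<xi> \<bullet> fst z) * cnj (cis (\<xi> \<bullet> snd z))"
        by (simp add: inner_diff_right cis_cnj cis_mult)
      then show "(cis (\<xi> \<bullet> fst z) * f (fst z)) * cnj (cis (\<xi> \<bullet> snd z) * f (snd z)) = cis (\<xi> \<bullet> (fst z
          - snd z)) * k z"
        by (simp add: k_def mult_ac)
    qed simp
    finally show ?thesis .
  qed
  define H where "H w = (\<integral>\<xi>. cis (\<xi> \<bullet> w) * complex_of_real (E \<xi>) \<partial>lborel)" for w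
  have Hm [measurable]: "H \<in> borel_measurable borel" unfolding H_def[abs_def] by measurable
  have Hz: "complex_of_real \<epsilon> ^ DIM('a) * H (\<epsilon> *\<^sub>R z) = complex_of_real ((2 * pi) ^ DIM('a) * gauss z)"
      for z
    using integral_cis_scaled_gauss[OF \<epsilon>, of z] by (simp only: H_def E_def of_real_power)
  define T where "T y = cis (fst y \<bullet> (fst (snd y) - snd (snd y))) * k (snd y)
      * complex_of_real (E (fst y))" for y
  have Ti: "integrable (lborel \<Otimes>\<^sub>M ?P) T"
  proof (rule Bochner_Integration.integrable_bound)
    show "integrable (lborel \<Otimes>\<^sub>M ?P) (\<lambda>y. complex_of_real (E (fst y)) * k (snd y))"
      by (intro pair_integrable_mult(1) sigma_finite_lborel Psf Ei ki)
    show "T \<in> borel_measurable (lborel \<Otimes>\<^sub>M ?P)" unfolding T_def[abs_def] by measurable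
  qed (auto simp: T_def norm_mult)
  have inner: "(\<integral>\<xi>. T (\<xi>, z) \<partial>lborel) = k z * H (fst z - snd z)" for z
    by (simp add: T_def H_def mult_ac flip: integral_mult_right_zero)
  have "complex_of_real (\<integral>\<xi>. (cmod (fourier f \<xi>))\<^sup>2 * E \<xi> \<partial>lborel)
      = (\<integral>\<xi>. complex_of_real ((cmod (fourier f \<xi>))\<^sup>2) * complex_of_real (E \<xi>) \<partial>lborel)"
    by (simp flip: integral_complex_of_real)
  also have "\<dots> = (\<integral>\<xi>. (\<integral>z. T (\<xi>, z) \<partial>?P) \<partial>lborel)"
    unfolding sq T_def fst_conv snd_conv by simp
  also have "\<dots> = (\<integral>z. (\<integral>\<xi>. T (\<xi>, z) \<partial>lborel) \<partial>?P)"
    using LP.Fubini_integral[of "\<lambda>\<xi> z. T (\<xi>, z)"] Ti by (simp add: case_prod_unfold)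
  also have "\<dots> = (\<integral>z. k z * H (fst z - snd z) \<partial>?P)"
    by (simp only: inner)
  also have "\<dots> = (\<integral>x. (\<integral>y. k (x, y) * H (x - y) \<partial>lborel) \<partial>lborel)"
  proof -
    have "integrable ?P (\<lambda>z. k z * H (fst z - snd z))"
      using LP.integrable_snd[of "\<lambda>\<xi> z. T (\<xi>, z)"] Ti unfolding inner by (simp add: case_prod_unfold)
    from lborel_pair.integral_fst'[OF this] show ?thesis by simp
  qed
  also have "\<dots> = (\<integral>x. (\<integral>z. (2 * pi) ^ DIM('a) * (f x * cnj (f (x - \<epsilon> *\<^sub>R z)) * gauss z) \<partial>lborel) \<partial>lborel)"
  proof (rule Bochner_Integration.integral_cong)
    fix x :: 'a
    \<comment> \<open>Substitution of \<open>y = x - \<epsilon> *\<^sub>R z\<close>; its Jacobian is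
      what \<open>Hz\<close> needs to turn \<open>H\<close> into \<open>gauss\<close>.\<close>
    have "(\<integral>y. k (x, y) * H (x - y) \<partial>lborel) = (\<bar>-\<epsilon>\<bar> ^ DIM('a)) *\<^sub>R (\<integral>z. k (x, x + (-\<epsilon>) *\<^sub>R z) * H (x
        - (x + (-\<epsilon>) *\<^sub>R z)) \<partial>lborel)"
      using \<epsilon> by (intro lborel_integral_affine) (auto simp: k_def)
    also have "\<dots> = (\<integral>z. f x * cnj (f (x - \<epsilon> *\<^sub>R z)) * (\<epsilon> ^ DIM('a) * H (\<epsilon> *\<^sub>R z)) \<partial>lborel)"
      using \<epsilon> by (subst integral_scaleR_right[symmetric]) (simp add: k_def scaleR_conv_of_real mult_ac)
    also have "\<dots> = (\<integral>z. (2 * pi) ^ DIM('a) * (f x * cnj (f (x - \<epsilon> *\<^sub>R z)) * gauss z) \<partial>lborel)"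
      by (simp only: of_real_power Hz) (simp add: mult_ac)
    finally show "(\<integral>y. k (x, y) * H (x - y) \<partial>lborel) = (\<integral>z. (2 * pi) ^ DIM('a) * (f x * cnj (f (x
        - \<epsilon> *\<^sub>R z)) * gauss z) \<partial>lborel)" .
  qed simp
  also have "\<dots> = (2 * pi) ^ DIM('a) * (\<integral>x. (\<integral>z. f x * cnj (f (x - \<epsilon> *\<^sub>R z)) * gauss z \<partial>lborel) \<partial>lborel)"
    by simp
  also have "(\<integral>x. (\<integral>z. f x * cnj (f (x - \<epsilon> *\<^sub>R z)) * gauss z \<partial>lborel) \<partial>lborel)
      = (\<integral>z. f (fst z) * cnj (f (fst z - \<epsilon> *\<^sub>R snd z)) * gauss (snd z) \<partial>?P)"
  proof -
    have "integrable ?P (\<lambda>z. f (fst z) * cnj (f (fst z - \<epsilon> *\<^sub>R snd z)) * gauss (snd z))"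
    proof (rule Bochner_Integration.integrable_bound)
      show "integrable ?P (\<lambda>y. (complex_of_real B * f (fst y)) * complex_of_real (gauss (snd y)))"
        using f gauss_integrable by (intro pair_integrable_mult(1) sigma_finite_lborel) auto
      have "B \<ge> 0" using B[of 0] norm_ge_zero order_trans by blast
      then show "AE z in ?P. norm (f (fst z) * cnj (f (fst z - \<epsilon> *\<^sub>R snd z)) * gauss (snd z))
          \<le> norm ((complex_of_real B * f (fst z)) * complex_of_real (gauss (snd z)))"
        using B by (auto simp: norm_mult mult.commute[of B] intro!: AE_I2 mult_right_mono mult_left_mono)
    qed measurable
    from lborel_pair.integral_fst'[OF this] show ?thesis by simp
  qed
  finally show ?thesis by (simp add: E_def)
qed


text \<open>As \<epsilon> decreases, the frequency side increases and converges monotonically, while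
  the space side converges by domination and continuity of \<open>f\<close>. The nonnegative
  integral is used because finiteness of the left side is part of the claim.\<close>

lemma plancherel_continuous:
  fixes f :: "'a::euclidean_space \<Rightarrow> complex"
  assumes f: "continuous_on UNIV f" and B: "\<And>x. cmod (f x) \<le> B" and R: "\<And>x. norm x > R \<Longrightarrow> f x = 0"
  shows "(\<integral>\<^sup>+\<xi>. ennreal ((cmod (fourier f \<xi>))\<^sup>2) \<partial>lborel) = ennreal ((2 * pi) ^ DIM('a)
      * (\<integral>x. (cmod (f x))\<^sup>2 \<partial>lborel))"
proof -
  have fm [measurable]: "f \<in> borel_measurable borel" using f by (rule borel_measurable_continuous_onI)
  have bs: "bounded_support f" using B R by (auto simp: bounded_support_def)
  have fi: "integrable lborel f" by (rule bounded_support_integrable[OF bs])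
  let ?P = "lborel \<Otimes>\<^sub>M lborel :: ('a \<times> 'a) measure"
  define \<epsilon> where "\<epsilon> n = inverse (real (Suc n))" for n
  have \<epsilon>: "\<epsilon> n > 0" for n by (simp add: \<epsilon>_def)
  have \<epsilon>lim: "\<epsilon> \<longlonglongrightarrow> 0" unfolding \<epsilon>_def by (rule LIMSEQ_inverse_real_of_nat)
  define E where "E n \<xi> = exp (- (norm (\<epsilon> n *\<^sub>R \<xi>))\<^sup>2 / 2)" for n and \<xi> :: 'a
  have [measurable]: "E n \<in> borel_measurable borel" for n unfolding E_def[abs_def] by measurable
  define A where "A n = (\<integral>\<xi>. (cmod (fourier f \<xi>))\<^sup>2 * E n \<xi> \<partial>lborel)" for n
  define L where "L = (2 * pi) ^ DIM('a) * (\<integral>x. (cmod (f x))\<^sup>2 \<partial>lborel)"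
  have B0: "B \<ge> 0" using B[of 0] norm_ge_zero order_trans by blast
  have J: "(\<lambda>n. \<integral>z. f (fst z) * cnj (f (fst z - \<epsilon> n *\<^sub>R snd z)) * gauss (snd z) \<partial>?P)
      \<longlonglongrightarrow> (\<integral>z. f (fst z) * cnj (f (fst z)) * gauss (snd z) \<partial>?P)"
  proof (rule integral_dominated_convergence)
    show "integrable ?P (\<lambda>y. cmod ((complex_of_real B * f (fst y)) * complex_of_real (gauss (snd y))))"
      using fi by (intro integrable_norm pair_integrable_mult(1) sigma_finite_lborel integrable_of_real
          gauss_integrable) auto
    show "AE z in ?P. norm (f (fst z) * cnj (f (fst z - \<epsilon> n *\<^sub>R snd z)) * gauss (snd z))
          \<le> cmod ((complex_of_real B * f (fst z)) * complex_of_real (gauss (snd z)))" for n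
      using B B0 by (auto simp: norm_mult mult.commute[of B] intro!: AE_I2 mult_right_mono mult_left_mono)
    show "AE z in ?P. (\<lambda>n. f (fst z) * cnj (f (fst z - \<epsilon> n *\<^sub>R snd z)) * gauss (snd z)) \<longlonglongrightarrow> f (fst z)
        * cnj (f (fst z)) * gauss (snd z)"
    proof (rule AE_I2)
      fix z :: "'a \<times> 'a"
      have "(\<lambda>n. fst z - \<epsilon> n *\<^sub>R snd z) \<longlonglongrightarrow> fst z - 0 *\<^sub>R snd z"
        by (intro tendsto_intros \<epsilon>lim)
      then have "(\<lambda>n. f (fst z - \<epsilon> n *\<^sub>R snd z)) \<longlonglongrightarrow> f (fst z)"
        using f by (intro isCont_tendsto_compose[of _ f]) (auto simp: continuous_on_eq_continuous_at)
      then show "(\<lambda>n. f (fst z) * cnj (f (fst z - \<epsilon> n *\<^sub>R snd z)) * gauss (snd z)) \<longlonglongrightarrow> f (fst z)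
          * cnj (f (fst z)) * gauss (snd z)"
        by (intro tendsto_intros)
    qed
  qed measurable
  have "(\<integral>z. f (fst z) * cnj (f (fst z)) * gauss (snd z) \<partial>?P)
      = complex_of_real (\<integral>x. (cmod (f x))\<^sup>2 \<partial>lborel)"
  proof -
    have "in_Lp 2 f" by (rule bounded_support_in_Lp[OF bs]) simp
    then have i: "integrable lborel (\<lambda>x. complex_of_real ((cmod (f x))\<^sup>2))" using in_L2_iff
        by (intro integrable_of_real) auto
    have "(\<integral>z. complex_of_real ((cmod (f (fst z)))\<^sup>2) * complex_of_real (gauss (snd z)) \<partial>?P)
       = (\<integral>x. complex_of_real ((cmod (f x))\<^sup>2) \<partial>lborel)
           * (\<integral>x. complex_of_real (gauss x) \<partial>(lborel :: 'a measure))"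
      by (rule pair_integrable_mult(2)[OF sigma_finite_lborel sigma_finite_lborel i
          integrable_of_real[OF gauss_integrable]])
    then show ?thesis
      by (simp only: complex_norm_square[symmetric] integral_complex_of_real gauss_integral of_real_1
          mult_1_right)
  qed
  with J have "(\<lambda>n. (2 * pi) ^ DIM('a) * (\<integral>z. f (fst z) * cnj (f (fst z - \<epsilon> n *\<^sub>R snd z))
      * gauss (snd z) \<partial>?P))
      \<longlonglongrightarrow> complex_of_real ((2 * pi) ^ DIM('a)) * complex_of_real (\<integral>x. (cmod (f x))\<^sup>2 \<partial>lborel)"
    by (intro tendsto_mult) auto
  then have "(\<lambda>n. complex_of_real (A n)) \<longlonglongrightarrow> complex_of_real L"
    unfolding A_def E_def plancherel_regularized[OF fi B \<epsilon>] L_def of_real_mult .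
  then have AL: "A \<longlonglongrightarrow> L" by (simp only: tendsto_of_real_iff)
  have Ai: "integrable lborel (\<lambda>\<xi>. (cmod (fourier f \<xi>))\<^sup>2 * E n \<xi>)" for n
  proof (rule Bochner_Integration.integrable_bound)
    show "integrable lborel (\<lambda>\<xi>. (\<integral>x. cmod (f x) \<partial>lborel)\<^sup>2 * E n \<xi>)"
      unfolding E_def using integrable_scaled_gauss[OF \<epsilon>] by (intro integrable_mult_right)
    show "AE \<xi> in lborel. norm ((cmod (fourier f \<xi>))\<^sup>2 * E n \<xi>) \<le> norm ((\<integral>x. cmod (f x) \<partial>lborel)\<^sup>2 * E n \<xi>)"
      using cmod_fourier_le[of f] by (auto simp: abs_mult E_def intro!: AE_I2 power_mono)
  qed measurable
  have "(\<lambda>n. \<integral>\<^sup>+\<xi>. ennreal ((cmod (fourier f \<xi>))\<^sup>2 * E n \<xi>) \<partial>lborel)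
      \<longlonglongrightarrow> (\<integral>\<^sup>+\<xi>. ennreal ((cmod (fourier f \<xi>))\<^sup>2) \<partial>lborel)"
  proof (rule nn_integral_LIMSEQ)
    show "incseq (\<lambda>n \<xi>. ennreal ((cmod (fourier f \<xi>))\<^sup>2 * E n \<xi>))"
    proof (intro incseq_SucI le_funI ennreal_leI mult_left_mono)
      fix n and \<xi> :: 'a
      have "norm (\<epsilon> (Suc n) *\<^sub>R \<xi>) \<le> norm (\<epsilon> n *\<^sub>R \<xi>)" 
        using \<epsilon>[of n] \<epsilon>[of "Suc n"] le_imp_inverse_le[of "real (Suc n)" "real (Suc (Suc n))"]
        by (auto simp: \<epsilon>_def intro!: mult_right_mono simp del: of_nat_Suc)
      then have "(norm (\<epsilon> (Suc n) *\<^sub>R \<xi>))\<^sup>2 \<le> (norm (\<epsilon> n *\<^sub>R \<xi>))\<^sup>2" by (rule power_mono) simp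
      then show "E n \<xi> \<le> E (Suc n) \<xi>" unfolding E_def by simp
    qed simp
    fix \<xi> :: 'a
    have "(\<lambda>n. (cmod (fourier f \<xi>))\<^sup>2 * E n \<xi>) \<longlonglongrightarrow> (cmod (fourier f \<xi>))\<^sup>2 * exp (- (norm (0 *\<^sub>R \<xi>))\<^sup>2 / 2)"
      unfolding E_def by (intro tendsto_intros \<epsilon>lim) simp
    then show "(\<lambda>n. ennreal ((cmod (fourier f \<xi>))\<^sup>2 * E n \<xi>)) \<longlonglongrightarrow> ennreal ((cmod (fourier f \<xi>))\<^sup>2)"
      by (intro tendsto_ennrealI) simp
  qed measurable
  moreover have "(\<integral>\<^sup>+\<xi>. ennreal ((cmod (fourier f \<xi>))\<^sup>2 * E n \<xi>) \<partial>lborel) = ennreal (A n)" for n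
    unfolding A_def by (rule nn_integral_eq_integral[OF Ai]) (auto simp: E_def)
  ultimately have "(\<lambda>n. ennreal (A n)) \<longlonglongrightarrow> (\<integral>\<^sup>+\<xi>. ennreal ((cmod (fourier f \<xi>))\<^sup>2) \<partial>lborel)" by simp
  with tendsto_ennrealI[OF AL] show ?thesis unfolding L_def by (metis LIMSEQ_unique)
qed

text \<open>Continuous functions converging to \<open>f\<close> off a negligible set are forced into
  a common disc and a common ball, by operations that do not alter \<open>f\<close>.\<close>

lemma bounded_support_continuous_approx:
  fixes f :: "'a::euclidean_space \<Rightarrow> complex"
  assumes "bounded_support f"
  obtains h B R where "\<And>n. continuous_on UNIV (h n)" "\<And>n x. cmod (h n x) \<le> B" "\<And>n x. norm x > R \<Longrightarrow> h n x = 0"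
    "\<And>x. cmod (f x) \<le> B" "\<And>x. norm x > R \<Longrightarrow> f x = 0" "AE x in lborel. (\<lambda>n. h n x) \<longlonglongrightarrow> f x"
proof -
  obtain B0 R where B0: "\<And>x. cmod (f x) \<le> B0" "\<And>x. norm x > R \<Longrightarrow> f x
      = 0" and fm: "f \<in> borel_measurable lborel"
    using assms unfolding bounded_support_def by blast
  \<comment> \<open>Kept positive, so that the denominator in \<open>clip\<close> never
    vanishes.\<close>
  define B where "B = max B0 1"
  have B: "B > 0" "\<And>x. cmod (f x) \<le> B" using B0(1) by (auto simp: B_def max.coboundedI1)
  have "f \<in> borel_measurable (lebesgue_on UNIV)" using fm
      by (simp add: measurable_completion lebesgue_on_UNIV_eq)
  then have "f measurable_on UNIV" by (subst measurable_on_iff_borel_measurable) auto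
  then obtain N g where N: "negligible N" and g: "\<And>n::nat. continuous_on UNIV (g n)"
    and lim: "\<And>x. x \<notin> N \<Longrightarrow> (\<lambda>n. g n x) \<longlonglongrightarrow> f x"
    unfolding measurable_on_def by auto
  \<comment> \<open>The radial retraction onto the disc of radius \<open>B\<close>. The factor
    \<open>cut\<close> falls from 1 to 0 between the radii \<open>R\<close> and
    \<open>R + 1\<close>, so the supports lie in the larger ball.\<close>
  define clip where "clip w = (B / max B (cmod w)) *\<^sub>R w" for w
  have clipc: "continuous_on UNIV clip" unfolding clip_def using B by (intro continuous_intros) auto
  have clip: "cmod (clip w) \<le> B" for w
    using B(1) by (cases "cmod w \<le> B") (auto simp: clip_def max_def)
  have clip_id: "clip w = w" if "cmod w \<le> B" for w using that B(1) by (simp add: clip_def max_def)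
  define cut where "cut x = max 0 (min 1 (R + 1 - norm x))" for x :: 'a
  have cut: "continuous_on UNIV cut" unfolding cut_def by (intro continuous_intros)
  define h where "h n x = cut x *\<^sub>R clip (g n x)" for n x
  show ?thesis
  proof
    show "continuous_on UNIV (h n)" for n
      unfolding h_def by (intro continuous_intros cut continuous_on_compose2[OF clipc] g) auto
    show "cmod (h n x) \<le> B" for n x
    proof -
      have "cmod (h n x) \<le> 1 * B" unfolding h_def norm_scaleR by (intro mult_mono clip) (auto simp: cut_def)
      then show ?thesis by simp
    qed
    show "norm x > R + 1 \<Longrightarrow> h n x = 0" for n x by (simp add: h_def cut_def)
    show "norm x > R + 1 \<Longrightarrow> f x = 0" for x by (simp add: B0)
    have "N \<in> null_sets lebesgue" using N by (simp add: negligible_iff_null_sets)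
    then have "AE x in lebesgue. x \<notin> N" by (rule AE_not_in)
    then have "AE x in lborel. x \<notin> N" by (simp add: AE_completion_iff)
    then show "AE x in lborel. (\<lambda>n. h n x) \<longlonglongrightarrow> f x"
    proof eventually_elim
      case (elim x)
      have "isCont clip (f x)" using clipc by (simp add: continuous_on_eq_continuous_at)
      then have "(\<lambda>n. h n x) \<longlonglongrightarrow> cut x *\<^sub>R clip (f x)"
        unfolding h_def by (intro tendsto_intros isCont_tendsto_compose[of _ clip] lim elim)
      also have "cut x *\<^sub>R clip (f x) = f x"
        using clip_id[OF B(2)[of x]] B0(2)[of x] by (cases "norm x > R") (simp_all add: cut_def)
      finally show ?case .
    qed
  qed (rule B)
qed

text \<open>Collects the functions for which Plancherel's identity is already established, so that
  it can be propagated by approximation.\<close>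

definition plancherel_class :: "('a::euclidean_space \<Rightarrow> complex) set" where
  "plancherel_class = {f. in_Lp 1 f \<and> in_Lp 2 f \<and> in_Lp 2 (fourier f)
     \<and> Lp_norm 2 (fourier f) = sqrt ((2 * pi) ^ DIM('a)) * Lp_norm 2 f}"

lemma in_L1_iff: "in_Lp 1 f \<longleftrightarrow> integrable lborel f"
  by (auto simp: in_Lp_iff_integrable integrable_norm_iff)

lemma L1_norm_eq: "in_Lp 1 f \<Longrightarrow> Lp_norm 1 f = (\<integral>x. cmod (f x) \<partial>lborel)"
  using Lp_norm_powr[of 1 f] by simp

text \<open>Convergence in \<open>L^1\<close> gives pointwise convergence of the transforms, and the
  identity for the differences \<open>h n - h m\<close> carries over to \<open>f - h m\<close> by
  Fatou. The differences are a separate hypothesis because closure under subtraction does not follow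
  from the definition of the class.\<close>

lemma plancherel_class_closed:
  fixes f :: "'a::euclidean_space \<Rightarrow> complex"
  assumes f: "in_Lp 1 f" "in_Lp 2 f"
    and h: "\<And>n. h n \<in> plancherel_class" "\<And>n m. (\<lambda>x. h n x - h m x) \<in> plancherel_class"
    and lim1: "(\<lambda>n. Lp_norm 1 (\<lambda>x. f x - h n x)) \<longlonglongrightarrow> 0"
    and lim2: "(\<lambda>n. Lp_norm 2 (\<lambda>x. f x - h n x)) \<longlonglongrightarrow> 0"
  shows "f \<in> plancherel_class"
proof -
  define K where "K = sqrt ((2 * pi) ^ DIM('a))"
  have K: "K \<ge> 0" by (simp add: K_def)
  have h1: "in_Lp 1 (h n)" "in_Lp 2 (h n)" "in_Lp 2 (fourier (h n))" "Lp_norm 2 (fourier (h n)) = K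
      * Lp_norm 2 (h n)" for n
    using h(1) by (auto simp: plancherel_class_def K_def)
  have [measurable]: "f \<in> borel_measurable borel" "h n \<in> borel_measurable borel" for n
    using in_Lp_measurable[OF f(1)] in_Lp_measurable[OF h1(1)] by auto
  have d: "fourier (\<lambda>x. f x - h n x) \<xi> = fourier f \<xi> - fourier (h n) \<xi>" 
          "fourier (\<lambda>x. h m x - h n x) \<xi> = fourier (h m) \<xi> - fourier (h n) \<xi>" for m n \<xi>
    using f h1 by (simp_all add: fourier_diff in_L1_iff)
  have dh: "fourier (\<lambda>x. h m x - h n x) = (\<lambda>\<xi>. fourier (h m) \<xi> - fourier (h n) \<xi>)" for m n
    by (rule ext) (rule d)
  have pt: "(\<lambda>n. fourier (h n) \<xi>) \<longlonglongrightarrow> fourier f \<xi>" for \<xi>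
  proof (rule Lim_null_comparison[THEN LIM_zero_cancel])
    show "(\<lambda>n. Lp_norm 1 (\<lambda>x. f x - h n x)) \<longlonglongrightarrow> 0" by fact
    show "\<forall>\<^sub>F n in sequentially. norm (fourier (h n) \<xi> - fourier f \<xi>) \<le> Lp_norm 1 (\<lambda>x. f x - h n x)"
      using cmod_fourier_le[of "\<lambda>x. f x - h _ x" \<xi>] L1_norm_eq[OF in_Lp_diff[OF f(1) h1(1)]]
      by (simp add: d norm_minus_commute)
  qed
  have diff: "in_Lp 2 (\<lambda>\<xi>. fourier f \<xi> - fourier (h m) \<xi>)"
    "Lp_norm 2 (\<lambda>\<xi>. fourier f \<xi> - fourier (h m) \<xi>) \<le> K * Lp_norm 2 (\<lambda>x. f x - h m x)" for m
  proof -
    have 1: "in_Lp 2 (\<lambda>\<xi>. fourier (h n) \<xi> - fourier (h m) \<xi>)" for n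
      using h(2)[of n m] unfolding plancherel_class_def mem_Collect_eq dh by blast
    have 2: "Lp_norm 2 (\<lambda>\<xi>. fourier (h n) \<xi> - fourier (h m) \<xi>) \<le> K * (Lp_norm 2 (\<lambda>x. f x - h n x)
        + Lp_norm 2 (\<lambda>x. f x - h m x))" for n
    proof -
      have "Lp_norm 2 (\<lambda>\<xi>. fourier (h n) \<xi> - fourier (h m) \<xi>) = K * Lp_norm 2 (\<lambda>x. h n x - h m x)"
        using h(2)[of n m] unfolding plancherel_class_def mem_Collect_eq dh K_def by blast
      also have "\<dots> \<le> K * (Lp_norm 2 (\<lambda>x. h n x - f x) + Lp_norm 2 (\<lambda>x. f x - h m x))"
        using K h1 f by (intro mult_left_mono Lp_norm_dist_triangle) auto
      finally show ?thesis by (simp add: Lp_norm_minus_commute[of _ "h n" f])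
    qed
    have 3: "(\<lambda>n. K * (Lp_norm 2 (\<lambda>x. f x - h n x) + Lp_norm 2 (\<lambda>x. f x - h m x))) \<longlonglongrightarrow> K * (0
        + Lp_norm 2 (\<lambda>x. f x - h m x))"
      by (intro tendsto_intros lim2)
    have 4: "AE \<xi> in lborel. (\<lambda>n. fourier (h n) \<xi> - fourier (h m) \<xi>) \<longlonglongrightarrow> fourier f \<xi> - fourier (h m) \<xi>"
      by (intro AE_I2 tendsto_intros pt)
    have 5: "(\<lambda>\<xi>. fourier f \<xi> - fourier (h m) \<xi>) \<in> borel_measurable lborel" by simp
    show "in_Lp 2 (\<lambda>\<xi>. fourier f \<xi> - fourier (h m) \<xi>)"
      "Lp_norm 2 (\<lambda>\<xi>. fourier f \<xi> - fourier (h m) \<xi>) \<le> K * Lp_norm 2 (\<lambda>x. f x - h m x)"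
      using Lp_Fatou[OF _ 1 5 4 2 3] by auto
  qed
  have Ff: "in_Lp 2 (fourier f)" using in_Lp_add[OF diff(1)[of 0] h1(3)[of 0]] by simp
  have "\<bar>Lp_norm 2 (fourier f) - K * Lp_norm 2 f\<bar> \<le> 2 * K * Lp_norm 2 (\<lambda>x. f x - h n x)" for n
  proof -
    have "Lp_norm 2 (fourier f) \<le> K * Lp_norm 2 (\<lambda>x. f x - h n x) + K * Lp_norm 2 (h n)"
      "K * Lp_norm 2 (h n) \<le> K * Lp_norm 2 (\<lambda>x. f x - h n x) + Lp_norm 2 (fourier f)"
      using Lp_norm_triangle_ineq2[OF Ff h1(3)[of n]] Lp_norm_triangle_ineq2[OF h1(3)[of n] Ff]
          diff(2)[of n] h1(4)[of n]
      by (auto simp: Lp_norm_minus_commute[of _ "fourier (h n)"])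
    moreover have "K * Lp_norm 2 (h n) \<le> K * (Lp_norm 2 (\<lambda>x. f x - h n x) + Lp_norm 2 f)"
      "K * Lp_norm 2 f \<le> K * (Lp_norm 2 (\<lambda>x. f x - h n x) + Lp_norm 2 (h n))"
      using Lp_norm_triangle_ineq2[OF f(2) h1(2)[of n]] Lp_norm_triangle_ineq2[OF h1(2)[of n] f(2)] K
      by (auto simp: Lp_norm_minus_commute[of _ "h n"] intro!: mult_left_mono)
    ultimately show ?thesis by (auto simp: distrib_left)
  qed
  moreover have "(\<lambda>n. 2 * K * Lp_norm 2 (\<lambda>x. f x - h n x)) \<longlonglongrightarrow> 2 * K * 0" by (intro tendsto_intros lim2)
  ultimately have "\<bar>Lp_norm 2 (fourier f) - K * Lp_norm 2 f\<bar> \<le> 2 * K * 0"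
    by (intro LIMSEQ_le_const) auto
  then show ?thesis using f Ff by (simp add: plancherel_class_def K_def)
qed

lemma plancherel_class_continuous:
  fixes f :: "'a::euclidean_space \<Rightarrow> complex"
  assumes f: "continuous_on UNIV f" and B: "\<And>x. cmod (f x) \<le> B" and R: "\<And>x. norm x > R \<Longrightarrow> f x = 0"
  shows "f \<in> plancherel_class"
proof -
  have [measurable]: "f \<in> borel_measurable borel" using f by (rule borel_measurable_continuous_onI)
  have bs: "bounded_support f" using B R by (auto simp: bounded_support_def)
  have f12: "in_Lp 1 f" "in_Lp 2 f" using bounded_support_in_Lp[OF bs] by auto
  have eq: "(\<integral>\<^sup>+\<xi>. ennreal (cmod (fourier f \<xi>) powr 2) \<partial>lborel) = ennreal ((2 * pi) ^ DIM('a)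
      * (Lp_norm 2 f)\<^sup>2)"
    using plancherel_continuous[OF assms] by (simp add: L2_norm_sq[OF f12(2)])
  then have F: "in_Lp 2 (fourier f)" by (simp add: in_Lp_def)
  then have "ennreal ((Lp_norm 2 (fourier f))\<^sup>2) = ennreal ((2 * pi) ^ DIM('a) * (Lp_norm 2 f)\<^sup>2)"
    using Lp_norm_powr_ennreal[OF F] eq by simp
  then have "(Lp_norm 2 (fourier f))\<^sup>2 = (2 * pi) ^ DIM('a) * (Lp_norm 2 f)\<^sup>2"
    by (subst (asm) ennreal_inj) auto
  then have "sqrt ((Lp_norm 2 (fourier f))\<^sup>2) = sqrt ((2 * pi) ^ DIM('a) * (Lp_norm 2 f)\<^sup>2)"
      by (rule arg_cong)
  then have "Lp_norm 2 (fourier f) = sqrt ((2 * pi) ^ DIM('a)) * Lp_norm 2 f"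
    by (simp only: real_sqrt_mult real_sqrt_abs abs_of_nonneg Lp_norm_nonneg)
  then show ?thesis using f12 F by (simp add: plancherel_class_def)
qed

lemma plancherel_class_bounded_support:
  fixes f :: "'a::euclidean_space \<Rightarrow> complex"
  assumes f: "bounded_support f"
  shows "f \<in> plancherel_class"
proof -
  obtain h B R where h: "\<And>n. continuous_on UNIV (h n)" "\<And>n x. cmod (h n x) \<le> B" "\<And>n x. norm x > R
      \<Longrightarrow> h n x = 0"
    "\<And>x. cmod (f x) \<le> B" "\<And>x. norm x > R \<Longrightarrow> f x = 0" "AE x in lborel. (\<lambda>n. h n x) \<longlonglongrightarrow> f x"
    by (rule bounded_support_continuous_approx[OF f]) (rule that)
  have [measurable]: "h n \<in> borel_measurable borel" for n using h(1)
      by (rule borel_measurable_continuous_onI)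
  have [measurable]: "f \<in> borel_measurable lborel" using f by (simp add: bounded_support_def)
  have B0: "B \<ge> 0" using h(4)[of 0] norm_ge_zero order_trans by blast
  \<comment> \<open>A dominating function for all the differences \<open>f - h n\<close>; it lies in
    \<open>L^1\<close> and in \<open>L^2\<close>.\<close>
  define g where "g x = (if norm x \<le> R then complex_of_real (2 * B) else 0)" for x :: 'a
  have g: "bounded_support g"
    unfolding bounded_support_def
  proof (intro conjI exI allI)
    show "cmod (g x) \<le> 2 * B" for x using B0 by (simp add: g_def norm_mult)
    show "norm x > R \<longrightarrow> g x = 0" for x by (simp add: g_def)
    show "g \<in> borel_measurable lborel" unfolding g_def[abs_def] by measurable
  qed
  have le: "cmod (f x - h n x) \<le> cmod (g x)" for n x
  proof (cases "norm x \<le> R")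
    case True
    then show ?thesis using norm_triangle_ineq4[of "f x" "h n x"] h(2)[of n x] h(4)[of x] B0
        by (simp add: g_def norm_mult)
  qed (simp add: h)
  have lim: "(\<lambda>n. Lp_norm p (\<lambda>x. f x - h n x)) \<longlonglongrightarrow> 0" if "p > 0" for p
    using h(6) le that by (intro Lp_dominated_convergence[OF _ bounded_support_in_Lp[OF g]]) auto
  show ?thesis
  proof (rule plancherel_class_closed[of f h])
    show "h n \<in> plancherel_class" for n by (rule plancherel_class_continuous[OF h(1,2,3)])
    show "(\<lambda>x. h n x - h m x) \<in> plancherel_class" for n m
    proof (rule plancherel_class_continuous)
      show "continuous_on UNIV (\<lambda>x. h n x - h m x)" by (intro continuous_intros h)
      show "cmod (h n x - h m x) \<le> 2 * B" for x
        using norm_triangle_ineq4[of "h n x" "h m x"] h(2)[of n x] h(2)[of m x] by simp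
      show "norm x > R \<Longrightarrow> h n x - h m x = 0" for x by (simp add: h)
    qed
  qed (use lim bounded_support_in_Lp[OF f] in auto)
qed

theorem plancherel:
  fixes f :: "'a::euclidean_space \<Rightarrow> complex"
  assumes f: "in_Lp 1 f" "in_Lp 2 f"
  shows "in_Lp 2 (fourier f)" "Lp_norm 2 (fourier f) = sqrt ((2 * pi) ^ DIM('a)) * Lp_norm 2 f"
proof -
  have [measurable]: "f \<in> borel_measurable lborel" by (rule in_Lp_measurable[OF f(1)])
  have "f \<in> plancherel_class"
  proof (rule plancherel_class_closed[OF f, of "\<lambda>n. truncation n f"])
    show "(\<lambda>x. truncation n f x - truncation m f x) \<in> plancherel_class" for n m
    proof (rule plancherel_class_bounded_support)
      show "bounded_support (\<lambda>x. truncation n f x - truncation m f x)"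
        unfolding bounded_support_def
        by (auto intro!: exI[of _ "real n
            + real m"] order_trans[OF norm_triangle_ineq4] add_mono simp: truncation_def)
    qed
  qed (auto intro!: truncation_Lp_tendsto f plancherel_class_bounded_support truncation_bounded_support)
  then show "in_Lp 2 (fourier f)" "Lp_norm 2 (fourier f) = sqrt ((2 * pi) ^ DIM('a)) * Lp_norm 2 f"
    by (auto simp: plancherel_class_def)
qed

section \<open>The Fourier transform on square-integrable functions\<close>

text \<open>The truncation from the definition of \<open>L2_fourier\<close>. Unlike
  \<open>truncation\<close> it leaves large values alone, so its integrability comes from the
  Cauchy-Schwarz inequality.\<close>

definition ball_cut :: "nat \<Rightarrow> ('a::euclidean_space \<Rightarrow> complex) \<Rightarrow> 'a \<Rightarrow> complex" where
  "ball_cut n f z = indicator (cball 0 (real n)) z * f z"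

lemma L2_mult_integrable:
  assumes "in_Lp 2 f" "in_Lp 2 g"
  shows "integrable lborel (\<lambda>x. f x * g x)"
  using Holder_integrable[OF assms] by simp

lemma L2_Cauchy_Schwarz:
  assumes "in_Lp 2 f" "in_Lp 2 g"
  shows "cmod (\<integral>x. f x * g x \<partial>lborel) \<le> Lp_norm 2 f * Lp_norm 2 g"
  using Holder_ineq[OF assms] by simp

lemma in_Lp_cnj: "in_Lp p f \<Longrightarrow> in_Lp p (\<lambda>x. cnj (f x))"
  unfolding in_Lp_def by auto

lemma ball_cut_measurable [measurable]:
  assumes [measurable]: "f \<in> borel_measurable lborel"
  shows "ball_cut n f \<in> borel_measurable lborel"
proof -
  have [measurable]: "(cball 0 (real n) :: 'a set) \<in> sets borel" by simp
  show ?thesis unfolding ball_cut_def[abs_def] by measurable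
qed

lemma
  assumes f: "in_Lp 2 f"
  shows ball_cut_L1: "in_Lp 1 (ball_cut n f)" and ball_cut_L2: "in_Lp 2 (ball_cut n f)"
    and ball_cut_tendsto: "(\<lambda>n. Lp_norm 2 (\<lambda>x. f x - ball_cut n f x)) \<longlonglongrightarrow> 0"
proof -
  have [measurable]: "f \<in> borel_measurable lborel" by (rule in_Lp_measurable[OF f])
  have [measurable]: "(cball 0 (real n) :: 'a set) \<in> sets borel" by simp
  have bs: "bounded_support (\<lambda>x::'a. indicator (cball 0 (real n)) x)"
    unfolding bounded_support_def
  proof (intro conjI exI allI)
    show "cmod (indicator (cball 0 (real n)) x) \<le> 1" for x :: 'a by (simp add: indicator_def)
    show "norm x > real n \<longrightarrow> indicator (cball 0 (real n)) x = (0::complex)" for x :: 'a by simp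
  qed measurable
  show "in_Lp 1 (ball_cut n f)"
    unfolding in_L1_iff ball_cut_def[abs_def]
    by (intro L2_mult_integrable f bounded_support_in_Lp[OF bs]) simp
  have "integrable lborel (\<lambda>x. (cmod (ball_cut n f x))\<^sup>2)"
    by (rule Bochner_Integration.integrable_bound[where f="\<lambda>x. (cmod (f x))\<^sup>2"])
       (use f in \<open>auto simp: in_L2_iff ball_cut_def indicator_def\<close>)
  then show "in_Lp 2 (ball_cut n f)" by (simp add: in_L2_iff)
  show "(\<lambda>n. Lp_norm 2 (\<lambda>x. f x - ball_cut n f x)) \<longlonglongrightarrow> 0"
  proof (rule Lp_dominated_convergence[OF _ f])
    show "AE x in lborel. (\<lambda>n. ball_cut n f x) \<longlonglongrightarrow> f x"
    proof (rule AE_I2, rule tendsto_eventually)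
      fix x :: 'a
      obtain N :: nat where N: "norm x \<le> real N" using real_arch_simple by blast
      show "\<forall>\<^sub>F n in sequentially. ball_cut n f x = f x"
        using eventually_ge_at_top[of N] by eventually_elim (use N in \<open>auto simp: ball_cut_def\<close>)
    qed
    show "cmod (f x - ball_cut n f x) \<le> cmod (f x)" for n x by (simp add: ball_cut_def indicator_def)
  qed auto
qed

lemma L2_fourier_iff:
  "L2_fourier f h \<longleftrightarrow> in_Lp 2 f \<and> in_Lp 2 h \<and> (\<lambda>n. Lp_norm 2 (\<lambda>\<xi>. fourier (ball_cut n f) \<xi> - h \<xi>)) \<longlonglongrightarrow> 0"
proof (cases "in_Lp 2 f \<and> in_Lp 2 h")
  case True
  define a where "a n = Lp_norm 2 (\<lambda>\<xi>. fourier (ball_cut n f) \<xi> - h \<xi>)" for n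
  have a0: "a n \<ge> 0" for n by (simp add: a_def)
  have "in_Lp 2 (\<lambda>\<xi>. fourier (ball_cut n f) \<xi> - h \<xi>)" for n
    using True plancherel(1)[OF ball_cut_L1 ball_cut_L2] by (intro in_Lp_diff) auto
  then have eq: "(\<integral>\<^sup>+\<xi>. ennreal ((cmod (fourier (ball_cut n f) \<xi> - h \<xi>))\<^sup>2) \<partial>lborel)
      = ennreal ((a n)\<^sup>2)" for n
    using Lp_norm_powr_ennreal[of 2 "\<lambda>\<xi>. fourier (ball_cut n f) \<xi> - h \<xi>"] by (simp add: a_def)
  have bc: "(\<lambda>z. indicator (cball 0 (real n)) z * f z) = ball_cut n f" for n
    by (simp add: ball_cut_def fun_eq_iff)
  have "(\<lambda>n. ennreal ((a n)\<^sup>2)) \<longlonglongrightarrow> 0 \<longleftrightarrow> a \<longlonglongrightarrow> 0"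
  proof
    assume "(\<lambda>n. ennreal ((a n)\<^sup>2)) \<longlonglongrightarrow> 0"
    then have "(\<lambda>n. ennreal ((a n)\<^sup>2)) \<longlonglongrightarrow> ennreal 0" by simp
    then have "(\<lambda>n. (a n)\<^sup>2) \<longlonglongrightarrow> 0" by (subst (asm) tendsto_ennreal_iff) auto
    then have "(\<lambda>n. sqrt ((a n)\<^sup>2)) \<longlonglongrightarrow> sqrt 0" by (rule tendsto_real_sqrt)
    then show "a \<longlonglongrightarrow> 0" using a0 by simp
  next
    assume "a \<longlonglongrightarrow> 0"
    then have "(\<lambda>n. (a n)\<^sup>2) \<longlonglongrightarrow> 0\<^sup>2" by (rule tendsto_power)
    then have "(\<lambda>n. ennreal ((a n)\<^sup>2)) \<longlonglongrightarrow> ennreal (0\<^sup>2)" by (rule tendsto_ennrealI)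
    then show "(\<lambda>n. ennreal ((a n)\<^sup>2)) \<longlonglongrightarrow> 0" by simp
  qed
  then show ?thesis
    using True unfolding L2_fourier_def bc eq a_def by simp
qed (auto simp: L2_fourier_def)

lemma
  assumes "L2_fourier f h"
  shows L2_fourier_dom: "in_Lp 2 f" and L2_fourier_ran: "in_Lp 2 h"
    and L2_fourier_lim: "(\<lambda>n. Lp_norm 2 (\<lambda>\<xi>. fourier (ball_cut n f) \<xi> - h \<xi>)) \<longlonglongrightarrow> 0"
  using assms by (auto simp: L2_fourier_iff)

lemma Lp_norm_tendsto:
  assumes p: "p \<ge> 1" and "\<And>n. in_Lp p (f n)" "in_Lp p g" "(\<lambda>n. Lp_norm p (\<lambda>x. f n x - g x)) \<longlonglongrightarrow> 0"
  shows "(\<lambda>n. Lp_norm p (f n)) \<longlonglongrightarrow> Lp_norm p g"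
proof (rule Lim_null_comparison[THEN LIM_zero_cancel])
  show "\<forall>\<^sub>F n in sequentially. norm (Lp_norm p (f n) - Lp_norm p g) \<le> Lp_norm p (\<lambda>x. f n x - g x)"
  proof (rule always_eventually, rule allI)
    fix n
    show "norm (Lp_norm p (f n) - Lp_norm p g) \<le> Lp_norm p (\<lambda>x. f n x - g x)"
      using Lp_norm_triangle_ineq2[OF assms(2)[of n] assms(3) p] Lp_norm_triangle_ineq2[OF assms(3)
          assms(2)[of n] p]
      by (simp add: Lp_norm_minus_commute[of p g])
  qed
qed fact

lemma L2_fourier_norm:
  fixes f :: "'a::euclidean_space \<Rightarrow> complex"
  assumes h: "L2_fourier f h"
  shows "Lp_norm 2 h = sqrt ((2 * pi) ^ DIM('a)) * Lp_norm 2 f"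
proof -
  note f = L2_fourier_dom[OF h]
  have "(\<lambda>n. Lp_norm 2 (fourier (ball_cut n f))) \<longlonglongrightarrow> Lp_norm 2 h"
    using plancherel(1)[OF ball_cut_L1 ball_cut_L2] f
    by (intro Lp_norm_tendsto L2_fourier_ran[OF h] L2_fourier_lim[OF h]) auto
  moreover have "(\<lambda>n. Lp_norm 2 (ball_cut n f)) \<longlonglongrightarrow> Lp_norm 2 f"
    using ball_cut_tendsto[OF f] ball_cut_L2[OF f] f
    by (intro Lp_norm_tendsto) (auto simp: Lp_norm_minus_commute[of _ "ball_cut _ f"])
  then have "(\<lambda>n. sqrt ((2 * pi) ^ DIM('a)) * Lp_norm 2 (ball_cut n f)) \<longlonglongrightarrow> sqrt ((2 * pi) ^ DIM('a))
      * Lp_norm 2 f"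
    by (rule tendsto_mult_left)
  then have "(\<lambda>n. Lp_norm 2 (fourier (ball_cut n f))) \<longlonglongrightarrow> sqrt ((2 * pi) ^ DIM('a)) * Lp_norm 2 f"
    by (simp only: plancherel(2)[OF ball_cut_L1[OF f] ball_cut_L2[OF f]])
  ultimately show ?thesis by (rule LIMSEQ_unique)
qed

lemma L2_fourier_L1:
  fixes f :: "'a::euclidean_space \<Rightarrow> complex"
  assumes f: "in_Lp 1 f" "in_Lp 2 f"
  shows "L2_fourier f (fourier f)"
proof -
  let ?K = "sqrt ((2 * pi) ^ DIM('a))"
  have "Lp_norm 2 (\<lambda>\<xi>. fourier (ball_cut n f) \<xi> - fourier f \<xi>) = ?K * Lp_norm 2 (\<lambda>x. f x
      - ball_cut n f x)" for n
  proof -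
    have "Lp_norm 2 (\<lambda>\<xi>. fourier (ball_cut n f) \<xi> - fourier f \<xi>)
        = Lp_norm 2 (fourier (\<lambda>x. ball_cut n f x - f x))"
      using ball_cut_L1[OF f(2)] f(1) by (simp add: in_L1_iff fourier_diff)
    also have "\<dots> = ?K * Lp_norm 2 (\<lambda>x. ball_cut n f x - f x)"
      using f ball_cut_L1[OF f(2)] ball_cut_L2[OF f(2)] by (intro plancherel(2) in_Lp_diff) auto
    finally show ?thesis by (simp only: Lp_norm_minus_commute[of _ f])
  qed
  moreover have "(\<lambda>n. ?K * Lp_norm 2 (\<lambda>x. f x - ball_cut n f x)) \<longlonglongrightarrow> ?K * 0"
    by (intro tendsto_mult_left ball_cut_tendsto f)
  ultimately show ?thesis unfolding L2_fourier_iff using f plancherel(1)[OF f]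
      by (simp del: real_sqrt_power)
qed

text \<open>By Plancherel, \<open>fourier\<close> is Lipschitz in the \<open>L^2\<close> norm on
  functions that are also in \<open>L^1\<close>; the limit provided by \<open>Lp_extension\<close>
  is the one along the prescribed truncations, since those belong to \<open>D\<close>.\<close>

lemma L2_fourier_exists:
  fixes f :: "'a::euclidean_space \<Rightarrow> complex"
  assumes f: "in_Lp 2 f"
  obtains h where "L2_fourier f h"
proof -
  define K where "K = sqrt ((2 * pi) ^ DIM('a))"
  define D where "D = {h :: 'a \<Rightarrow> complex. in_Lp 1 h \<and> in_Lp 2 h}"
  have cutD: "ball_cut n f \<in> D" for n using ball_cut_L1[OF f] ball_cut_L2[OF f] by (simp add: D_def)
  obtain w where w: "in_Lp 2 w" "\<And>h. h \<in> D \<Longrightarrow> Lp_norm 2 (\<lambda>x. w x - fourier h x) \<le> K * Lp_norm 2 (\<lambda>x. f x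
      - h x)"
  proof (rule Lp_extension[where p=2 and f=f and C=K and D=D and S=fourier])
    show "\<exists>h\<in>D. Lp_norm 2 (\<lambda>x. f x - h x) < e" if "e > 0" for e
    proof -
      have "\<forall>\<^sub>F n in sequentially. Lp_norm 2 (\<lambda>x. f x - ball_cut n f x) < e"
        using ball_cut_tendsto[OF f] that by (rule order_tendstoD)
      then show ?thesis using cutD by (auto simp: eventually_sequentially)
    qed
    show "in_Lp 2 (fourier h)" if "h \<in> D" for h using that by (auto simp: D_def intro: plancherel(1))
    show "Lp_norm 2 (\<lambda>x. fourier h x - fourier k x) \<le> K * Lp_norm 2 (\<lambda>x. h x - k x)" if "h \<in> D" "k \<in> D"
        for h k
    proof -
      have "Lp_norm 2 (\<lambda>x. fourier h x - fourier k x) = Lp_norm 2 (fourier (\<lambda>x. h x - k x))"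
        using that by (simp add: D_def in_L1_iff fourier_diff)
      also have "\<dots> = K * Lp_norm 2 (\<lambda>x. h x - k x)"
        unfolding K_def using that by (intro plancherel(2) in_Lp_diff) (auto simp: D_def)
      finally show ?thesis by simp
    qed
  qed (use f in \<open>auto simp: K_def D_def\<close>)
  have "(\<lambda>n. Lp_norm 2 (\<lambda>\<xi>. fourier (ball_cut n f) \<xi> - w \<xi>)) \<longlonglongrightarrow> 0"
  proof (rule tendsto_sandwich[where f="\<lambda>_. 0"])
    show "(\<lambda>n. K * Lp_norm 2 (\<lambda>x. f x - ball_cut n f x)) \<longlonglongrightarrow> 0"
      using tendsto_mult_left[OF ball_cut_tendsto[OF f], of K] by simp
    show "\<forall>\<^sub>F n in sequentially. Lp_norm 2 (\<lambda>\<xi>. fourier (ball_cut n f) \<xi> - w \<xi>) \<le> K * Lp_norm 2 (\<lambda>x. f x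
        - ball_cut n f x)"
      using w(2)[OF cutD] by (simp add: Lp_norm_minus_commute[of _ w])
  qed auto
  then have "L2_fourier f w" using f w(1) by (simp add: L2_fourier_iff)
  then show ?thesis using that by blast
qed

lemma L2_fourier_add:
  assumes f: "L2_fourier f F" and g: "L2_fourier g G"
  shows "L2_fourier (\<lambda>x. f x + g x) (\<lambda>\<xi>. F \<xi> + G \<xi>)"
proof -
  note d = L2_fourier_dom[OF f] L2_fourier_dom[OF g] L2_fourier_ran[OF f] L2_fourier_ran[OF g]
  have eq: "fourier (ball_cut n (\<lambda>x. f x + g x)) \<xi> = fourier (ball_cut n f) \<xi>
      + fourier (ball_cut n g) \<xi>" for n \<xi>
    using cis_mult_integrable[of "ball_cut n f" \<xi>] cis_mult_integrable[of "ball_cut n g" \<xi>]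
        ball_cut_L1[OF d(1)] ball_cut_L1[OF d(2)]
    by (simp add: fourier_def in_L1_iff ball_cut_def distrib_left)
  have "(\<lambda>n. Lp_norm 2 (\<lambda>\<xi>. fourier (ball_cut n (\<lambda>x. f x + g x)) \<xi> - (F \<xi> + G \<xi>))) \<longlonglongrightarrow> 0"
  proof (rule tendsto_sandwich[where f="\<lambda>_. 0"])
    show "(\<lambda>n. Lp_norm 2 (\<lambda>\<xi>. fourier (ball_cut n f) \<xi> - F \<xi>) + Lp_norm 2 (\<lambda>\<xi>. fourier (ball_cut n g) \<xi>
        - G \<xi>)) \<longlonglongrightarrow> 0"
      using tendsto_add[OF L2_fourier_lim[OF f] L2_fourier_lim[OF g]] by simp
    have "Lp_norm 2 (\<lambda>\<xi>. (fourier (ball_cut n f) \<xi> - F \<xi>) + (fourier (ball_cut n g) \<xi> - G \<xi>))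
      \<le> Lp_norm 2 (\<lambda>\<xi>. fourier (ball_cut n f) \<xi> - F \<xi>) + Lp_norm 2 (\<lambda>\<xi>. fourier (ball_cut n g) \<xi> - G \<xi>)"
          for n
      using d plancherel(1)[OF ball_cut_L1 ball_cut_L2] by (intro Lp_norm_triangle in_Lp_diff) auto
    then show "\<forall>\<^sub>F n in sequentially. Lp_norm 2 (\<lambda>\<xi>. fourier (ball_cut n (\<lambda>x. f x + g x)) \<xi> - (F \<xi> + G \<xi>))
      \<le> Lp_norm 2 (\<lambda>\<xi>. fourier (ball_cut n f) \<xi> - F \<xi>) + Lp_norm 2 (\<lambda>\<xi>. fourier (ball_cut n g) \<xi> - G \<xi>)"
      unfolding eq by (simp add: algebra_simps)
  qed auto
  then show ?thesis unfolding L2_fourier_iff using d by (simp add: in_Lp_add)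
qed

lemma L2_fourier_cmult:
  assumes f: "L2_fourier f F"
  shows "L2_fourier (\<lambda>x. c * f x) (\<lambda>\<xi>. c * F \<xi>)"
proof -
  note d = L2_fourier_dom[OF f] L2_fourier_ran[OF f]
  have eq: "fourier (ball_cut n (\<lambda>x. c * f x)) \<xi> = c * fourier (ball_cut n f) \<xi>" for n \<xi>
    unfolding fourier_def ball_cut_def by (simp flip: integral_mult_right_zero add: mult_ac)
  have "Lp_norm 2 (\<lambda>\<xi>. c * (fourier (ball_cut n f) \<xi> - F \<xi>)) = cmod c
      * Lp_norm 2 (\<lambda>\<xi>. fourier (ball_cut n f) \<xi> - F \<xi>)" for n
    using d plancherel(1)[OF ball_cut_L1 ball_cut_L2] by (intro Lp_norm_cmult in_Lp_diff) auto
  then have "(\<lambda>n. Lp_norm 2 (\<lambda>\<xi>. fourier (ball_cut n (\<lambda>x. c * f x)) \<xi> - c * F \<xi>)) \<longlonglongrightarrow> cmod c * 0"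
    unfolding eq right_diff_distrib[symmetric] using tendsto_mult_left[OF L2_fourier_lim[OF f]] by simp
  then show ?thesis unfolding L2_fourier_iff using d by (simp add: in_Lp_cmult)
qed

lemma L2_fourier_diff:
  assumes "L2_fourier f F" "L2_fourier g G"
  shows "L2_fourier (\<lambda>x. f x - g x) (\<lambda>\<xi>. F \<xi> - G \<xi>)"
  using L2_fourier_add[OF assms(1) L2_fourier_cmult[OF assms(2), of "-1"]] by simp

lemma ae_eq_sym: "ae_eq f g \<Longrightarrow> ae_eq g f"
  by (auto simp: ae_eq_def)

lemma L2_fourier_cong:
  assumes F: "L2_fourier f F" and f: "ae_eq f f'" and G: "ae_eq F F'"
    and m [measurable]: "f' \<in> borel_measurable lborel" "F' \<in> borel_measurable lborel"
  shows "L2_fourier f' F'"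
proof -
  note d = L2_fourier_dom[OF F] L2_fourier_ran[OF F]
  have [measurable]: "f \<in> borel_measurable lborel" by (rule in_Lp_measurable[OF d(1)])
  have "fourier (ball_cut n f') \<xi> = fourier (ball_cut n f) \<xi>" for n \<xi>
    unfolding fourier_def
  proof (rule integral_cong_AE)
    show "AE z in lborel. cis (\<xi> \<bullet> z) * ball_cut n f' z = cis (\<xi> \<bullet> z) * ball_cut n f z"
      using f unfolding ae_eq_def by eventually_elim (simp add: ball_cut_def)
  qed measurable
  then have "Lp_norm 2 (\<lambda>\<xi>. fourier (ball_cut n f') \<xi> - F' \<xi>) = Lp_norm 2 (\<lambda>\<xi>. fourier (ball_cut n f) \<xi>
      - F \<xi>)" for n
    using G d plancherel(1)[OF ball_cut_L1 ball_cut_L2]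
    by (intro Lp_cong_ae(2) in_Lp_diff) (auto simp: ae_eq_def)
  then show ?thesis
    using L2_fourier_lim[OF F] Lp_cong_ae(1)[OF f d(1) m(1)] Lp_cong_ae(1)[OF G d(2) m(2)]
    by (simp add: L2_fourier_iff)
qed

lemma L2_fourier_inj:
  fixes f g :: "'a::euclidean_space \<Rightarrow> complex"
  assumes "L2_fourier f F" "L2_fourier g G" "ae_eq F G"
  shows "ae_eq f g"
proof -
  have *: "L2_fourier (\<lambda>x. f x - g x) (\<lambda>\<xi>. F \<xi> - G \<xi>)" by (rule L2_fourier_diff[OF assms(1,2)])
  have "Lp_norm 2 (\<lambda>\<xi>. F \<xi> - G \<xi>) = Lp_norm 2 (\<lambda>\<xi>::'a. 0)"
    using assms(3) in_Lp_measurable[OF L2_fourier_ran[OF *]] by (intro Lp_cong_ae(2)) (auto simp: ae_eq_def)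
  then have "Lp_norm 2 (\<lambda>x. f x - g x) = 0" using L2_fourier_norm[OF *] by simp
  then show ?thesis using L2_fourier_dom[OF *] by (intro ae_eq_if_Lp_norm_0) auto
qed

lemma L2_fourier_unique:
  assumes "L2_fourier f F" "L2_fourier f G"
  shows "ae_eq F G"
proof -
  have *: "L2_fourier (\<lambda>x. f x - f x) (\<lambda>\<xi>. F \<xi> - G \<xi>)" by (rule L2_fourier_diff[OF assms])
  then have "Lp_norm 2 (\<lambda>\<xi>. F \<xi> - G \<xi>) = 0" using L2_fourier_norm[OF *] by simp
  then show ?thesis using L2_fourier_ran[OF *] by (intro ae_eq_if_Lp_norm_0) auto
qed

section \<open>Multiplication formula, Parseval's relation and surjectivity\<close>

lemma L2_product_tendsto:
  assumes "\<And>n. in_Lp 2 (a n)" "\<And>n. in_Lp 2 (b n)" "in_Lp 2 f" "in_Lp 2 g"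
    and lim: "(\<lambda>n. Lp_norm 2 (\<lambda>x. a n x - f x)) \<longlonglongrightarrow> 0" "(\<lambda>n. Lp_norm 2 (\<lambda>x. b n x - g x)) \<longlonglongrightarrow> 0"
  shows "(\<lambda>n. \<integral>x. a n x * b n x \<partial>lborel) \<longlonglongrightarrow> (\<integral>x. f x * g x \<partial>lborel)"
proof (rule Lim_null_comparison[THEN LIM_zero_cancel])
  have "(\<lambda>n. Lp_norm 2 (b n)) \<longlonglongrightarrow> Lp_norm 2 g" using assms by (intro Lp_norm_tendsto) auto
  then have "(\<lambda>n. Lp_norm 2 (\<lambda>x. a n x - f x) * Lp_norm 2 (b n) + Lp_norm 2 f * Lp_norm 2 (\<lambda>x. b n x - g x))
     \<longlonglongrightarrow> 0 * Lp_norm 2 g + Lp_norm 2 f * 0"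
    by (intro tendsto_intros lim)
  then show "(\<lambda>n. Lp_norm 2 (\<lambda>x. a n x - f x) * Lp_norm 2 (b n) + Lp_norm 2 f * Lp_norm 2 (\<lambda>x. b n x
      - g x)) \<longlonglongrightarrow> 0" by simp
  have "norm ((\<integral>x. a n x * b n x \<partial>lborel) - (\<integral>x. f x * g x \<partial>lborel))
      \<le> Lp_norm 2 (\<lambda>x. a n x - f x) * Lp_norm 2 (b n) + Lp_norm 2 f * Lp_norm 2 (\<lambda>x. b n x - g x)" for n
  proof -
    have d: "in_Lp 2 (\<lambda>x. a n x - f x)" "in_Lp 2 (\<lambda>x. b n x - g x)" using assms by (auto intro!: in_Lp_diff)
    have "(\<integral>x. a n x * b n x \<partial>lborel) - (\<integral>x. f x * g x \<partial>lborel)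
        = (\<integral>x. a n x * b n x - f x * g x \<partial>lborel)"
      using assms by (intro Bochner_Integration.integral_diff[symmetric] L2_mult_integrable)
    also have "\<dots> = (\<integral>x. (a n x - f x) * b n x + f x * (b n x - g x) \<partial>lborel)"
      by (simp add: algebra_simps)
    also have "\<dots> = (\<integral>x. (a n x - f x) * b n x \<partial>lborel) + (\<integral>x. f x * (b n x - g x) \<partial>lborel)"
      using assms d by (intro Bochner_Integration.integral_add L2_mult_integrable)
    finally show ?thesis
      using L2_Cauchy_Schwarz[OF d(1) assms(2)[of n]] L2_Cauchy_Schwarz[OF assms(3) d(2)]
      by (smt (verit) norm_triangle_ineq)
  qed
  then show "\<forall>\<^sub>F n in sequentially. norm ((\<integral>x. a n x * b n x \<partial>lborel) - (\<integral>x. f x * g x \<partial>lborel))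
      \<le> Lp_norm 2 (\<lambda>x. a n x - f x) * Lp_norm 2 (b n) + Lp_norm 2 f * Lp_norm 2 (\<lambda>x. b n x - g x)"
    by simp
qed

text \<open>The kernel \<open>cis (x \<bullet> y)\<close> is symmetric, so Fubini moves the
  transform to the other factor.\<close>

lemma fourier_multiplication:
  fixes f g :: "'a::euclidean_space \<Rightarrow> complex"
  assumes f: "integrable lborel f" and g: "integrable lborel g"
  shows "(\<integral>\<xi>. fourier f \<xi> * g \<xi> \<partial>lborel) = (\<integral>x. f x * fourier g x \<partial>lborel)"
proof -
  have [measurable]: "f \<in> borel_measurable borel" "g \<in> borel_measurable borel" using f g by auto
  define T where "T z = cis (fst z \<bullet> snd z) * f (snd z) * g (fst z)" for z
  have Ti: "integrable (lborel \<Otimes>\<^sub>M lborel) T"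
  proof (rule Bochner_Integration.integrable_bound)
    show "integrable (lborel \<Otimes>\<^sub>M lborel) (\<lambda>z. g (fst z) * f (snd z))"
      by (intro pair_integrable_mult(1) sigma_finite_lborel f g)
    show "T \<in> borel_measurable (lborel \<Otimes>\<^sub>M lborel)" unfolding T_def[abs_def] by measurable
  qed (auto simp: T_def norm_mult)
  have "(\<integral>\<xi>. fourier f \<xi> * g \<xi> \<partial>lborel) = (\<integral>\<xi>. (\<integral>x. T (\<xi>, x) \<partial>lborel) \<partial>lborel)"
    by (simp add: fourier_def T_def)
  also have "\<dots> = (\<integral>x. (\<integral>\<xi>. T (\<xi>, x) \<partial>lborel) \<partial>lborel)"
    using lborel_pair.Fubini_integral[of "\<lambda>\<xi> x. T (\<xi>, x)"] Ti by (simp add: case_prod_unfold)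
  also have "\<dots> = (\<integral>x. f x * fourier g x \<partial>lborel)"
    by (simp add: fourier_def T_def inner_commute mult_ac flip: integral_mult_right_zero)
  finally show ?thesis .
qed

lemma L2_fourier_multiplication:
  assumes f: "L2_fourier f F" and g: "L2_fourier g G"
  shows "(\<integral>\<xi>. F \<xi> * g \<xi> \<partial>lborel) = (\<integral>x. f x * G x \<partial>lborel)"
proof -
  note d = L2_fourier_dom[OF f] L2_fourier_dom[OF g] L2_fourier_ran[OF f] L2_fourier_ran[OF g]
  have c: "in_Lp 2 (ball_cut n f)" "in_Lp 2 (ball_cut n g)" "in_Lp 2 (fourier (ball_cut n f))" "in_Lp 2
      (fourier (ball_cut n g))" for n
    using plancherel(1)[OF ball_cut_L1 ball_cut_L2] ball_cut_L2 d by auto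
  have l: "(\<lambda>n. Lp_norm 2 (\<lambda>x. ball_cut n f x - f x)) \<longlonglongrightarrow> 0" "(\<lambda>n. Lp_norm 2 (\<lambda>x. ball_cut n g x - g x)) \<longlonglongrightarrow> 0"
    using ball_cut_tendsto d by (auto simp: Lp_norm_minus_commute[of _ "ball_cut _ _"])
  have "(\<lambda>n. \<integral>\<xi>. fourier (ball_cut n f) \<xi> * ball_cut n g \<xi> \<partial>lborel) \<longlonglongrightarrow> (\<integral>\<xi>. F \<xi> * g \<xi> \<partial>lborel)"
    by (intro L2_product_tendsto c d l L2_fourier_lim[OF f])
  moreover have "(\<lambda>n. \<integral>x. ball_cut n f x * fourier (ball_cut n g) x \<partial>lborel) \<longlonglongrightarrow> (\<integral>x. f x * G x \<partial>lborel)"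
    by (intro L2_product_tendsto c d l L2_fourier_lim[OF g])
  moreover have "(\<integral>\<xi>. fourier (ball_cut n f) \<xi> * ball_cut n g \<xi> \<partial>lborel) = (\<integral>x. ball_cut n f x
      * fourier (ball_cut n g) x \<partial>lborel)" for n
    using ball_cut_L1[OF d(1)] ball_cut_L1[OF d(2)] by (intro fourier_multiplication) (auto simp: in_L1_iff)
  ultimately show ?thesis using LIMSEQ_unique by simp
qed

lemma complex_polarization:
  "4 * (a * cnj b) = complex_of_real ((cmod (a + b))\<^sup>2) - complex_of_real ((cmod (a - b))\<^sup>2)
     + \<i> * complex_of_real ((cmod (a + \<i> * b))\<^sup>2) - \<i> * complex_of_real ((cmod (a - \<i> * b))\<^sup>2)"
  unfolding complex_norm_square by (simp add: algebra_simps)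

lemma L2_polarization:
  assumes "in_Lp 2 f" "in_Lp 2 g"
  shows "4 * (\<integral>x. f x * cnj (g x) \<partial>lborel) = complex_of_real ((Lp_norm 2 (\<lambda>x. f x + g x))\<^sup>2)
      - complex_of_real ((Lp_norm 2 (\<lambda>x. f x - g x))\<^sup>2)
     + \<i> * complex_of_real ((Lp_norm 2 (\<lambda>x. f x + \<i> * g x))\<^sup>2) - \<i>
         * complex_of_real ((Lp_norm 2 (\<lambda>x. f x - \<i> * g x))\<^sup>2)"
proof -
  have L: "in_Lp 2 (\<lambda>x. f x + g x)" "in_Lp 2 (\<lambda>x. f x - g x)" "in_Lp 2 (\<lambda>x. f x + \<i>
      * g x)" "in_Lp 2 (\<lambda>x. f x - \<i> * g x)"
    using assms by (auto intro!: in_Lp_add in_Lp_diff in_Lp_cmult)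
  have i: "integrable lborel (\<lambda>x. complex_of_real ((cmod (f x
      + g x))\<^sup>2))" "integrable lborel (\<lambda>x. complex_of_real ((cmod (f x - g x))\<^sup>2))"
    "integrable lborel (\<lambda>x. complex_of_real ((cmod (f x + \<i>
        * g x))\<^sup>2))" "integrable lborel (\<lambda>x. complex_of_real ((cmod (f x - \<i> * g x))\<^sup>2))"
    using L unfolding in_L2_iff by (auto intro!: integrable_of_real simp del: of_real_power)
  have "4 * (\<integral>x. f x * cnj (g x) \<partial>lborel) = (\<integral>x. 4 * (f x * cnj (g x)) \<partial>lborel)" by simp
  also have "\<dots> = (\<integral>x. complex_of_real ((cmod (f x + g x))\<^sup>2) \<partial>lborel) - (\<integral>x. complex_of_real ((cmod (f x
      - g x))\<^sup>2) \<partial>lborel)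
     + \<i> * (\<integral>x. complex_of_real ((cmod (f x + \<i> * g x))\<^sup>2) \<partial>lborel) - \<i>
         * (\<integral>x. complex_of_real ((cmod (f x - \<i> * g x))\<^sup>2) \<partial>lborel)"
    unfolding complex_polarization using i by (simp del: of_real_power)
  finally show ?thesis unfolding L2_norm_sq[OF L(1)] L2_norm_sq[OF L(2)] L2_norm_sq[OF L(3)]
      L2_norm_sq[OF L(4)] integral_complex_of_real .
qed

text \<open>The norm identity \<open>L2_fourier_norm\<close> for the four combinations of
  \<open>f\<close> and \<open>g\<close> in the polarization identity.\<close>

lemma L2_fourier_parseval:
  fixes f g :: "'a::euclidean_space \<Rightarrow> complex"
  assumes f: "L2_fourier f F" and g: "L2_fourier g G"
  shows "(\<integral>\<xi>. F \<xi> * cnj (G \<xi>) \<partial>lborel) = complex_of_real ((2 * pi) ^ DIM('a)) * (\<integral>x. f x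
      * cnj (g x) \<partial>lborel)"
proof -
  define K where "K = (2 * pi) ^ DIM('a)"
  have K: "K \<ge> 0" by (simp add: K_def)
  have n: "(Lp_norm 2 H)\<^sup>2 = K * (Lp_norm 2 h)\<^sup>2" if "L2_fourier h H" for h H :: "'a \<Rightarrow> complex"
    unfolding L2_fourier_norm[OF that] K_def[symmetric] using K by (simp add: power_mult_distrib)
  have ig: "L2_fourier (\<lambda>x. \<i> * g x) (\<lambda>\<xi>. \<i> * G \<xi>)" by (rule L2_fourier_cmult[OF g])
  have "4 * (\<integral>\<xi>. F \<xi> * cnj (G \<xi>) \<partial>lborel) = complex_of_real K * (4 * (\<integral>x. f x * cnj (g x) \<partial>lborel))"
    unfolding L2_polarization[OF L2_fourier_dom[OF f] L2_fourier_dom[OF g]]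
      L2_polarization[OF L2_fourier_ran[OF f] L2_fourier_ran[OF g]]
      n[OF L2_fourier_add[OF f g]] n[OF L2_fourier_diff[OF f g]] n[OF L2_fourier_add[OF f ig]] n[OF
          L2_fourier_diff[OF f ig]]
    by (simp add: algebra_simps)
  then show ?thesis by (simp add: K_def)
qed

text \<open>A candidate is built by conjugation and its transform is compared with \<open>h\<close>:
  the multiplication formula and Parseval's relation give both the same pairing with any test
  function.\<close>

lemma L2_fourier_surj:
  fixes h :: "'a::euclidean_space \<Rightarrow> complex"
  assumes h: "in_Lp 2 h"
  obtains u where "L2_fourier u h"
proof -
  define K where "K = complex_of_real ((2 * pi) ^ DIM('a))"
  have K: "K \<noteq> 0" by (simp add: K_def)
  obtain w where w: "L2_fourier (\<lambda>x. cnj (h x)) w" using L2_fourier_exists[OF in_Lp_cnj[OF h]] .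
  \<comment> \<open>Up to the factor \<open>K\<close>, the inverse transform of \<open>h\<close> is
    the conjugate of the transform of \<open>cnj h\<close>.\<close>
  define u where "u x = inverse K * cnj (w x)" for x
  have u: "in_Lp 2 u" unfolding u_def by (intro in_Lp_cmult in_Lp_cnj L2_fourier_ran[OF w]) simp
  obtain U where U: "L2_fourier u U" using L2_fourier_exists[OF u] .
  have d: "in_Lp 2 (\<lambda>x. U x - h x)" using in_Lp_diff[OF L2_fourier_ran[OF U] h] by simp
  \<comment> \<open>Testing with the conjugate of the defect turns the pairing into the squared norm
    of the defect.\<close>
  define g where "g x = cnj (U x - h x)" for x
  have g: "in_Lp 2 g" unfolding g_def by (rule in_Lp_cnj[OF d])
  obtain G where G: "L2_fourier g G" using L2_fourier_exists[OF g] .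
  have "(\<integral>x. U x * g x \<partial>lborel) = (\<integral>x. u x * G x \<partial>lborel)" by (rule L2_fourier_multiplication[OF U G])
  also have "\<dots> = inverse K * (\<integral>x. G x * cnj (w x) \<partial>lborel)"
    by (simp add: u_def mult_ac)
  also have "(\<integral>x. G x * cnj (w x) \<partial>lborel) = K * (\<integral>x. g x * h x \<partial>lborel)"
    using L2_fourier_parseval[OF G w] by (simp add: K_def)
  finally have "(\<integral>x. U x * g x \<partial>lborel) = (\<integral>x. h x * g x \<partial>lborel)" using K by (simp add: mult.commute)
  then have "(\<integral>x. (U x - h x) * g x \<partial>lborel) = 0"
    using L2_mult_integrable[OF L2_fourier_ran[OF U] g] L2_mult_integrable[OF h g]
        by (simp add: left_diff_distrib)
  then have "(\<integral>x. complex_of_real ((cmod (U x - h x))\<^sup>2) \<partial>lborel) = 0"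
    unfolding complex_norm_square g_def .
  then have "(Lp_norm 2 (\<lambda>x. U x - h x))\<^sup>2 = 0"
    unfolding L2_norm_sq[OF d] by (simp only: integral_complex_of_real of_real_eq_0_iff)
  then have "ae_eq U h" using d by (intro ae_eq_if_Lp_norm_0) auto
  then have "L2_fourier u h"
    by (intro L2_fourier_cong[OF U]) (use in_Lp_measurable[OF u] in_Lp_measurable[OF h] in \<open>auto simp:
        ae_eq_def\<close>)
  then show ?thesis using that by blast
qed

section \<open>The symmetric random walk of a finite jump measure\<close>

text \<open>A class that is stable under the walk. Bounded support would be lost, since jumps may be
  arbitrarily long.\<close>

definition bdd_L1 :: "('a::euclidean_space \<Rightarrow> complex) \<Rightarrow> bool" where
  "bdd_L1 u \<longleftrightarrow> integrable lborel u \<and> (\<exists>B. \<forall>x. cmod (u x) \<le> B)"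

lemma bdd_L1_integrable: "bdd_L1 u \<Longrightarrow> integrable lborel u"
  by (simp add: bdd_L1_def)

lemma bdd_L1_measurable: "bdd_L1 u \<Longrightarrow> u \<in> borel_measurable borel"
  by (auto simp: bdd_L1_def)

lemma bdd_L1_in_L1: "bdd_L1 u \<Longrightarrow> in_Lp 1 u"
  by (simp add: bdd_L1_def in_L1_iff)

lemma bdd_L1_in_L2:
  assumes u: "bdd_L1 u"
  shows "in_Lp 2 u"
proof -
  obtain B where B: "\<And>x. cmod (u x) \<le> B" using u by (auto simp: bdd_L1_def)
  have [measurable]: "u \<in> borel_measurable borel" by (rule bdd_L1_measurable[OF u])
  have "integrable lborel (\<lambda>x. (cmod (u x))\<^sup>2)"
  proof (rule Bochner_Integration.integrable_bound)
    show "integrable lborel (\<lambda>x. B * cmod (u x))" using bdd_L1_integrable[OF u] by simp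
    have "(cmod (u x))\<^sup>2 \<le> B * cmod (u x)" for x
      unfolding power2_eq_square using B by (intro mult_right_mono) auto
    then show "AE x in lborel. norm ((cmod (u x))\<^sup>2) \<le> norm (B * cmod (u x))"
      by (intro AE_I2) (auto intro: order_trans[OF _ abs_ge_self])
  qed simp
  then show ?thesis by (simp add: in_L2_iff)
qed

lemma bounded_support_bdd_L1: "bounded_support f \<Longrightarrow> bdd_L1 f"
  using bounded_support_integrable[of f] unfolding bdd_L1_def bounded_support_def by blast

lemma bdd_L1_translate:
  assumes u: "bdd_L1 u" shows "bdd_L1 (\<lambda>x. u (x + z))"
  using u lborel_integrable_translate[OF bdd_L1_measurable[OF u] bdd_L1_integrable[OF u]]
      by (auto simp: bdd_L1_def)

lemma bdd_L1_diff:
  assumes "bdd_L1 u" "bdd_L1 v" shows "bdd_L1 (\<lambda>x. u x - v x)"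
proof -
  obtain B B' where B: "\<And>x. cmod (u x) \<le> B" "\<And>x. cmod (v x) \<le> B'" using assms by (auto simp: bdd_L1_def)
  have "cmod (u x - v x) \<le> B + B'" for x using norm_triangle_ineq4[of "u x" "v x"] B[of x] by simp
  then show ?thesis using assms by (auto simp: bdd_L1_def)
qed

lemma bdd_L1_parseval:
  fixes u v :: "'a::euclidean_space \<Rightarrow> complex"
  assumes "bdd_L1 u" "bdd_L1 v"
  shows "(\<integral>\<xi>. fourier u \<xi> * cnj (fourier v \<xi>) \<partial>lborel) = complex_of_real ((2 * pi) ^ DIM('a)) * (\<integral>x. u x
      * cnj (v x) \<partial>lborel)"
  by (intro L2_fourier_parseval L2_fourier_L1 bdd_L1_in_L1 bdd_L1_in_L2 assms)

lemma bdd_L1_fourier_product_integrable: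
  assumes "bdd_L1 u" "bdd_L1 v"
  shows "integrable lborel (\<lambda>\<xi>. fourier u \<xi> * cnj (fourier v \<xi>))"
  by (intro L2_mult_integrable in_Lp_cnj plancherel(1) bdd_L1_in_L1 bdd_L1_in_L2 assms)

lemma fourier_translate:
  assumes [measurable]: "u \<in> borel_measurable borel"
  shows "fourier (\<lambda>x. u (x + z)) \<xi> = cis (- (\<xi> \<bullet> z)) * fourier u \<xi>"
proof -
  have "fourier (\<lambda>x. u (x + z)) \<xi> = (\<integral>x. cis (\<xi> \<bullet> ((x + z) - z)) * u (x + z) \<partial>lborel)"
      by (simp add: fourier_def)
  also have "\<dots> = (\<integral>x. cis (\<xi> \<bullet> (x - z)) * u x \<partial>lborel)"
    by (rule lborel_integral_translate[of "\<lambda>x. cis (\<xi> \<bullet> (x - z)) * u x"]) measurable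
  also have "\<dots> = (\<integral>x. cis (- (\<xi> \<bullet> z)) * (cis (\<xi> \<bullet> x) * u x) \<partial>lborel)"
    by (intro Bochner_Integration.integral_cong) (simp_all add: inner_diff_right cis_mult
        mult.assoc[symmetric])
  finally show ?thesis by (simp add: fourier_def)
qed

text \<open>No integrability is required: without it the Bochner integral has the default value
  0.\<close>

lemma norm_integral_le_nn_integral:
  fixes f :: "'a \<Rightarrow> 'b::{banach, second_countable_topology}"
  shows "ennreal (norm (\<integral>x. f x \<partial>M)) \<le> (\<integral>\<^sup>+x. ennreal (norm (f x)) \<partial>M)"
  by (cases "integrable M f") (simp_all add: integral_norm_bound_ennreal not_integrable_integral_eq)

text \<open>The bound on \<delta> makes \<open>1 - \<delta> * measure \<nu> UNIV\<close> a
  probability, so that one step is an average and Jensen's inequality applies.\<close>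

locale symmetric_walk = finite_measure \<nu> for \<nu> :: "'a::euclidean_space measure" +
  fixes \<delta> :: real
  assumes sets_\<nu> [measurable_cong]: "sets \<nu> = sets borel"
    and sym: "distr \<nu> borel uminus = \<nu>"
    and \<delta>_nonneg: "0 \<le> \<delta>" and \<delta>_le: "\<delta> * measure \<nu> UNIV \<le> 1"
begin

lemma space_\<nu> [simp]: "space \<nu> = UNIV"
  using sets_eq_imp_space_eq[OF sets_\<nu>] by simp

sublocale P: pair_sigma_finite \<nu> lborel
  by unfold_locales

lemma bounded_integrable:
  fixes f :: "'a \<Rightarrow> 'b::{banach, second_countable_topology}"
  assumes "f \<in> borel_measurable borel" "\<And>x. norm (f x) \<le> B"
  shows "integrable \<nu> f"
  by (rule integrable_const_bound[where B=B]) (use assms in \<open>auto simp: measurable_cong_sets[OF sets_\<nu>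
      refl]\<close>)

text \<open>An Euler step of length \<delta> for the compound Poisson generator, which integrates
  \<open>u (x + z) - u x\<close> against \<nu>.\<close>

definition step :: "('a \<Rightarrow> complex) \<Rightarrow> 'a \<Rightarrow> complex" where
  "step u x = complex_of_real (1 - \<delta> * measure \<nu> UNIV) * u x + complex_of_real \<delta> * (\<integral>z. u (x + z) \<partial>\<nu>)"

text \<open>The Levy exponent of \<nu>, which is the denominator of the multiplier; the symbol of
  \<open>step\<close> is \<open>r\<close>.\<close>

definition \<psi> :: "'a \<Rightarrow> real" where
  "\<psi> \<xi> = (\<integral>z. cos (\<xi> \<bullet> z) - 1 \<partial>\<nu>)"

definition r :: "'a \<Rightarrow> real" where
  "r \<xi> = 1 + \<delta> * \<psi> \<xi>"

lemma cos_integrable: "integrable \<nu> (\<lambda>z. cos (\<xi> \<bullet> z))"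
  by (rule bounded_integrable[where B=1]) auto

lemma \<psi>_eq: "\<psi> \<xi> = (\<integral>z. cos (\<xi> \<bullet> z) \<partial>\<nu>) - measure \<nu> UNIV"
  unfolding \<psi>_def using cos_integrable by simp

lemma \<psi>_measurable [measurable]: "\<psi> \<in> borel_measurable borel"
  unfolding \<psi>_def[abs_def] by measurable

lemma r_measurable [measurable]: "r \<in> borel_measurable borel"
  unfolding r_def[abs_def] by measurable

lemma \<psi>_nonpos: "\<psi> \<xi> \<le> 0"
proof -
  have "0 \<le> (\<integral>z. - (cos (\<xi> \<bullet> z) - 1) \<partial>\<nu>)" by (rule integral_nonneg_AE) auto
  then show ?thesis unfolding \<psi>_def Bochner_Integration.integral_minus by simp
qed

lemma \<psi>_ge: "- 2 * measure \<nu> UNIV \<le> \<psi> \<xi>"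
proof -
  have "(\<integral>z. -2 \<partial>\<nu>) \<le> \<psi> \<xi>"
    unfolding \<psi>_def
  proof (rule integral_mono)
    fix z
    show "-2 \<le> cos (\<xi> \<bullet> z) - 1" using cos_ge_minus_one[of "\<xi> \<bullet> z"] by linarith
  qed (use cos_integrable in auto)
  then show ?thesis by simp
qed

text \<open>Averaging over \<open>z\<close> and \<open>- z\<close> cancels the sine, so the symbol
  of the walk is real.\<close>

lemma integral_cis: "(\<integral>z. cis (- (\<xi> \<bullet> z)) \<partial>\<nu>) = complex_of_real (\<psi> \<xi> + measure \<nu> UNIV)"
proof -
  have m: "uminus \<in> \<nu> \<rightarrow>\<^sub>M borel" by (simp add: measurable_cong_sets[OF sets_\<nu> refl])
  have "(\<integral>z. cis (- (\<xi> \<bullet> z)) \<partial>\<nu>) = (\<integral>z. cis (\<xi> \<bullet> z) \<partial>(distr \<nu> borel uminus))"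
    by (subst integral_distr[OF m]) (auto simp: inner_minus_right)
  then have e: "(\<integral>z. cis (- (\<xi> \<bullet> z)) \<partial>\<nu>) = (\<integral>z. cis (\<xi> \<bullet> z) \<partial>\<nu>)" by (simp add: sym)
  have i: "integrable \<nu> (\<lambda>z. cis (c * (\<xi> \<bullet> z)))" for c by (rule bounded_integrable[where B=1]) auto
  have "2 * (\<integral>z. cis (- (\<xi> \<bullet> z)) \<partial>\<nu>) = (\<integral>z. cis (\<xi> \<bullet> z) + cis (- (\<xi> \<bullet> z)) \<partial>\<nu>)"
    using i[of 1] i[of "-1"] e by simp
  also have "\<dots> = (\<integral>z. complex_of_real (2 * cos (\<xi> \<bullet> z)) \<partial>\<nu>)"
    by (intro Bochner_Integration.integral_cong) (auto simp: complex_eq_iff)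
  also have "\<dots> = complex_of_real (2 * (\<integral>z. cos (\<xi> \<bullet> z) \<partial>\<nu>))"
    unfolding integral_complex_of_real by simp
  finally show ?thesis by (simp add: \<psi>_eq)
qed

lemma translate_pair_integrable:
  fixes u :: "'a \<Rightarrow> complex"
  assumes u: "integrable lborel u"
  shows "integrable (\<nu> \<Otimes>\<^sub>M lborel) (\<lambda>w. u (snd w + fst w))"
proof (rule P.Fubini_integrable)
  have [measurable]: "u \<in> borel_measurable borel" using u by auto
  have m: "(\<lambda>x. cmod (u x)) \<in> borel_measurable borel" by measurable
  show "(\<lambda>w. u (snd w + fst w)) \<in> borel_measurable (\<nu> \<Otimes>\<^sub>M lborel)" by measurable
  show "integrable \<nu> (\<lambda>z. \<integral>x. norm (u (snd (z, x) + fst (z, x))) \<partial>lborel)"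
    using lborel_integral_translate[OF m] by simp
  show "AE z in \<nu>. integrable lborel (\<lambda>x. u (snd (z, x) + fst (z, x)))"
    using lborel_integrable_translate[OF _ u] by simp
qed

lemma bdd_L1_step:
  assumes u: "bdd_L1 u"
  shows "bdd_L1 (step u)"
proof -
  have [measurable]: "u \<in> borel_measurable borel" by (rule bdd_L1_measurable[OF u])
  obtain B where B: "\<And>x. cmod (u x) \<le> B" using u by (auto simp: bdd_L1_def)
  have "integrable lborel (\<lambda>x. \<integral>z. u (x + z) \<partial>\<nu>)"
    using P.integrable_snd[of "\<lambda>z x. u (x + z)"] translate_pair_integrable[OF bdd_L1_integrable[OF u]]
    by (simp add: case_prod_unfold)
  then have i: "integrable lborel (step u)"
    unfolding step_def[abs_def] using bdd_L1_integrable[OF u] by simp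
  have "cmod (step u x) \<le> (1 - \<delta> * measure \<nu> UNIV) * B + \<delta> * (measure \<nu> UNIV * B)" for x
  proof -
    have "cmod (\<integral>z. u (x + z) \<partial>\<nu>) \<le> (\<integral>z. cmod (u (x + z)) \<partial>\<nu>)" by (rule integral_norm_bound)
    also have "\<dots> \<le> (\<integral>z. B \<partial>\<nu>)"
    proof (rule integral_mono)
      show "integrable \<nu> (\<lambda>z. cmod (u (x + z)))" by (rule bounded_integrable[where B=B]) (use B in auto)
    qed (use B in auto)
    finally have *: "cmod (\<integral>z. u (x + z) \<partial>\<nu>) \<le> measure \<nu> UNIV * B" by simp
    have "cmod (step u x) \<le> cmod (complex_of_real (1 - \<delta> * measure \<nu> UNIV) * u x)
        + cmod (complex_of_real \<delta> * (\<integral>z. u (x + z) \<partial>\<nu>))"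
      unfolding step_def by (rule norm_triangle_ineq)
    also have "\<dots> = (1 - \<delta> * measure \<nu> UNIV) * cmod (u x) + \<delta> * cmod (\<integral>z. u (x + z) \<partial>\<nu>)"
      using \<delta>_nonneg \<delta>_le by (simp add: norm_mult del: of_real_diff of_real_mult)
    also have "\<dots> \<le> (1 - \<delta> * measure \<nu> UNIV) * B + \<delta> * (measure \<nu> UNIV * B)"
      using \<delta>_nonneg \<delta>_le B * by (intro add_mono mult_left_mono) auto
    finally show ?thesis .
  qed
  then show ?thesis using i by (auto simp: bdd_L1_def)
qed

lemma fourier_step:
  assumes u: "bdd_L1 u"
  shows "fourier (step u) \<xi> = complex_of_real (r \<xi>) * fourier u \<xi>"
proof -
  have um [measurable]: "u \<in> borel_measurable borel" by (rule bdd_L1_measurable[OF u])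
  define T where "T w = cis (\<xi> \<bullet> snd w) * u (snd w + fst w)" for w :: "'a \<times> 'a"
  have Ti: "integrable (\<nu> \<Otimes>\<^sub>M lborel) T"
    by (rule Bochner_Integration.integrable_bound[OF translate_pair_integrable[OF bdd_L1_integrable[OF u]]])
       (auto simp: T_def[abs_def] norm_mult)
  have "integrable lborel (\<lambda>x. \<integral>z. u (x + z) \<partial>\<nu>)"
    using P.integrable_snd[of "\<lambda>z x. u (x + z)"] translate_pair_integrable[OF bdd_L1_integrable[OF u]]
    by (simp add: case_prod_unfold)
  note i = cis_mult_integrable[OF this, of \<xi>] cis_mult_integrable[OF bdd_L1_integrable[OF u], of \<xi>]
  have "(\<integral>x. cis (\<xi> \<bullet> x) * (\<integral>z. u (x + z) \<partial>\<nu>) \<partial>lborel) = (\<integral>x. (\<integral>z. T (z, x) \<partial>\<nu>) \<partial>lborel)"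
    by (simp add: T_def)
  also have "\<dots> = (\<integral>z. (\<integral>x. T (z, x) \<partial>lborel) \<partial>\<nu>)"
    using P.Fubini_integral[of "\<lambda>z x. T (z, x)"] Ti by (simp add: case_prod_unfold)
  also have "\<dots> = (\<integral>z. cis (- (\<xi> \<bullet> z)) * fourier u \<xi> \<partial>\<nu>)"
    by (simp add: T_def fourier_translate[OF um, symmetric]) (simp add: fourier_def)
  finally have *: "(\<integral>x. cis (\<xi> \<bullet> x) * (\<integral>z. u (x + z) \<partial>\<nu>) \<partial>lborel) = complex_of_real (\<psi> \<xi>
      + measure \<nu> UNIV) * fourier u \<xi>"
    by (simp add: integral_cis)
  have "fourier (step u) \<xi> = (\<integral>x. complex_of_real (1 - \<delta> * measure \<nu> UNIV) * (cis (\<xi> \<bullet> x) * u x)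
      + complex_of_real \<delta> * (cis (\<xi> \<bullet> x) * (\<integral>z. u (x + z) \<partial>\<nu>)) \<partial>lborel)"
    unfolding fourier_def step_def by (intro Bochner_Integration.integral_cong) (auto simp: algebra_simps)
  also have "\<dots> = complex_of_real (1 - \<delta> * measure \<nu> UNIV) * fourier u \<xi> + complex_of_real \<delta>
      * (complex_of_real (\<psi> \<xi> + measure \<nu> UNIV) * fourier u \<xi>)"
    unfolding *[symmetric] using i by (simp add: fourier_def)
  finally show ?thesis by (simp add: r_def algebra_simps)
qed

text \<open>Jensen's inequality for one step of the walk, where the subgradient of the Bellman function
  at the averaged point contributes the gain term.\<close>

lemma bellman_step:
  fixes \<Phi> :: "complex \<Rightarrow> complex \<Rightarrow> real"
  assumes nonneg: "\<And>x y. 0 \<le> \<Phi> x y"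
    and cont: "continuous_on UNIV (\<lambda>z. \<Phi> (fst z) (snd z))"
    and sub: "\<And>x y. \<exists>l m. \<forall>x' y'. \<Phi> x y + l \<bullet> (x' - x) + m \<bullet> (y' - y) + cmod (x' - x) * cmod (y' - y)
        \<le> \<Phi> x' y'"
    and u: "bdd_L1 u" and v: "bdd_L1 v"
  shows "(\<integral>\<^sup>+x. ennreal (\<Phi> (step u x) (step v x)) \<partial>lborel)
      + ennreal \<delta> * (\<integral>\<^sup>+z. (\<integral>\<^sup>+x. ennreal (cmod (u (x + z) - step u x) * cmod (v (x + z)
          - step v x)) \<partial>lborel) \<partial>\<nu>)
      \<le> (\<integral>\<^sup>+x. ennreal (\<Phi> (u x) (v x)) \<partial>lborel)"
proof -
  have \<Phi>m [measurable]: "(\<lambda>z. \<Phi> (fst z) (snd z)) \<in> borel_measurable borel"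
    using cont by (rule borel_measurable_continuous_onI)
  have \<Phi>c: "(\<lambda>x. \<Phi> (f x) (g x)) \<in> borel_measurable M"
    if "f \<in> borel_measurable M" "g \<in> borel_measurable M" for f g and M :: "'c measure"
    using measurable_compose[OF borel_measurable_Pair[OF that] \<Phi>m] by simp
  have [measurable]: "u \<in> borel_measurable borel" "v \<in> borel_measurable borel" "step u \<in>
      borel_measurable borel" "step v \<in> borel_measurable borel"
    using u v bdd_L1_step by (auto intro: bdd_L1_measurable)
  obtain Bu Bv where B: "\<And>x. cmod (u x) \<le> Bu" "\<And>x. cmod (v x) \<le> Bv" using u v by (auto simp: bdd_L1_def)
  define m where "m = measure \<nu> UNIV"
  define q where "q z x = cmod (u (x + z) - step u x) * cmod (v (x + z) - step v x)" for z x
  define F where "F x = \<Phi> (u x) (v x)" for x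
  have Fm [measurable]: "F \<in> borel_measurable borel" unfolding F_def[abs_def] by (rule \<Phi>c) measurable
  have qm [measurable]: "(\<lambda>w. q (fst w) (snd w)) \<in> borel_measurable (\<nu> \<Otimes>\<^sub>M lborel)" unfolding q_def
      by measurable
  \<comment> \<open>The values of \<open>u\<close> and \<open>v\<close> stay in a compact product of
    discs, on which \<Phi> is bounded; this makes the integrals against the finite measure \<nu>
    converge.\<close>
  have Fb: "\<exists>K. \<forall>x. F x \<le> K"
  proof -
    have "compact ((\<lambda>z. \<Phi> (fst z) (snd z)) ` (cball 0 Bu \<times> cball 0 Bv))"
      by (intro compact_continuous_image continuous_on_subset[OF cont] compact_Times) auto
    then have "bounded ((\<lambda>z. \<Phi> (fst z) (snd z)) ` (cball 0 Bu \<times> cball 0 Bv))" by (rule compact_imp_bounded)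
    then obtain K where "\<forall>y\<in>(\<lambda>z. \<Phi> (fst z) (snd z)) ` (cball 0 Bu \<times> cball 0 Bv). norm y \<le> K"
      unfolding bounded_iff by blast
    then have "norm (\<Phi> (u x) (v x)) \<le> K" for x using B by force
    then have "F x \<le> K" for x unfolding F_def using abs_ge_self order_trans by (metis real_norm_def)
    then show ?thesis by blast
  qed
  then obtain K where K: "\<And>x. F x \<le> K" by blast
  have pt: "ennreal (\<Phi> (step u x) (step v x)) + ennreal \<delta> * (\<integral>\<^sup>+z. ennreal (q z x) \<partial>\<nu>)
      \<le> ennreal (1 - \<delta> * m) * ennreal (F x) + ennreal \<delta> * (\<integral>\<^sup>+z. ennreal (F (x + z)) \<partial>\<nu>)" for x
  proof -
    define a b where "a = step u x" and "b = step v x"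
    \<comment> \<open>The supporting hyperplane is taken at the mean \<open>(a, b)\<close> of the
      step and not at \<open>(u x, v x)\<close>: then \<open>la\<close> and \<open>lb\<close> make
      the linear terms average to zero.\<close>
    obtain l l' where l: "\<And>x' y'. \<Phi> a b + l \<bullet> (x' - a) + l' \<bullet> (y' - b) + cmod (x' - a) * cmod (y' - b)
        \<le> \<Phi> x' y'"
      using sub by blast
    have iu: "integrable \<nu> (\<lambda>z. u (x + z))" "integrable \<nu> (\<lambda>z. v (x + z))"
      using B by (auto intro!: bounded_integrable)
    have iF: "integrable \<nu> (\<lambda>z. F (x + z))"
    proof (rule bounded_integrable[where B=K])
      show "norm (F (x + z)) \<le> K" for z using K[of "x + z"] nonneg by (simp add: F_def)
    qed measurable
    have iq: "integrable \<nu> (\<lambda>z. q z x)"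
    proof (rule bounded_integrable[where B="(Bu + cmod a) * (Bv + cmod b)"])
      show "norm (q z x) \<le> (Bu + cmod a) * (Bv + cmod b)" for z
      proof -
        have "cmod (u (x + z) - a) \<le> Bu + cmod a" "cmod (v (x + z) - b) \<le> Bv + cmod b"
          using norm_triangle_ineq4[of "u (x + z)" a] norm_triangle_ineq4[of "v (x
              + z)" b] B(1)[of "x+z"] B(2)[of "x+z"] by auto
        then show ?thesis unfolding q_def a_def[symmetric] b_def[symmetric]
          by (auto intro!: mult_mono intro: order_trans[OF norm_ge_zero])
      qed
    qed (simp add: q_def)
    have "(\<integral>z. \<Phi> a b + (l \<bullet> u (x + z) - l \<bullet> a) + (l' \<bullet> v (x + z) - l' \<bullet> b) + q z x \<partial>\<nu>) \<le> (\<integral>z. F (x + z) \<partial>\<nu>)"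
      using l iu iq iF by (intro integral_mono) (auto simp: F_def q_def a_def b_def inner_diff_right)
    then have 1: "m * \<Phi> a b + (l \<bullet> (\<integral>z. u (x + z) \<partial>\<nu>) - m * (l \<bullet> a)) + (l' \<bullet> (\<integral>z. v (x + z) \<partial>\<nu>) - m
        * (l' \<bullet> b)) + (\<integral>z. q z x \<partial>\<nu>) \<le> (\<integral>z. F (x + z) \<partial>\<nu>)"
      using iu iq by (simp add: m_def)
    \<comment> \<open>For the mass that stays at \<open>x\<close> the gain is dropped;
      \<open>q\<close> records only the jumps.\<close>
    have "\<Phi> a b + l \<bullet> (u x - a) + l' \<bullet> (v x - b) \<le> F x"
      using l[of "u x" "v x"] unfolding F_def by (smt (verit) mult_nonneg_nonneg norm_ge_zero)
    then have 2: "(1 - \<delta> * m) * (\<Phi> a b + l \<bullet> (u x - a) + l' \<bullet> (v x - b)) \<le> (1 - \<delta> * m) * F x"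
      using \<delta>_le by (intro mult_left_mono) (auto simp: m_def)
    have 3: "\<delta> * (m * \<Phi> a b + (l \<bullet> (\<integral>z. u (x + z) \<partial>\<nu>) - m * (l \<bullet> a)) + (l' \<bullet> (\<integral>z. v (x + z) \<partial>\<nu>) - m
        * (l' \<bullet> b)) + (\<integral>z. q z x \<partial>\<nu>)) \<le> \<delta> * (\<integral>z. F (x + z) \<partial>\<nu>)"
      using 1 \<delta>_nonneg by (rule mult_left_mono)
    have la: "l \<bullet> a = (1 - \<delta> * m) * (l \<bullet> u x) + \<delta> * (l \<bullet> (\<integral>z. u (x + z) \<partial>\<nu>))" 
      unfolding a_def step_def m_def[symmetric]
          by (simp add: inner_add_right scaleR_conv_of_real[symmetric] del: of_real_diff of_real_mult)
    have lb: "l' \<bullet> b = (1 - \<delta> * m) * (l' \<bullet> v x) + \<delta> * (l' \<bullet> (\<integral>z. v (x + z) \<partial>\<nu>))" 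
      unfolding b_def step_def m_def[symmetric]
          by (simp add: inner_add_right scaleR_conv_of_real[symmetric] del: of_real_diff of_real_mult)
    have "\<Phi> a b + \<delta> * (\<integral>z. q z x \<partial>\<nu>) = (1 - \<delta> * m) * (\<Phi> a b + l \<bullet> (u x - a) + l' \<bullet> (v x - b))
       + \<delta> * (m * \<Phi> a b + (l \<bullet> (\<integral>z. u (x + z) \<partial>\<nu>) - m * (l \<bullet> a)) + (l' \<bullet> (\<integral>z. v (x + z) \<partial>\<nu>) - m
           * (l' \<bullet> b)) + (\<integral>z. q z x \<partial>\<nu>))"
      using la lb by (simp add: inner_diff_right algebra_simps)
    then have main: "\<Phi> a b + \<delta> * (\<integral>z. q z x \<partial>\<nu>) \<le> (1 - \<delta> * m) * F x + \<delta> * (\<integral>z. F (x + z) \<partial>\<nu>)"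
      using 2 3 by linarith
    have q0: "0 \<le> (\<integral>z. q z x \<partial>\<nu>)" "0 \<le> (\<integral>z. F (x + z) \<partial>\<nu>)"
        by (auto intro!: integral_nonneg_AE simp: q_def F_def nonneg)
    have F0: "0 \<le> F x" by (simp add: F_def nonneg)
    have m1: "0 \<le> 1 - \<delta> * m" using \<delta>_le by (simp add: m_def)
    have "ennreal (\<Phi> a b) + ennreal \<delta> * (\<integral>\<^sup>+z. ennreal (q z x) \<partial>\<nu>) = ennreal (\<Phi> a b + \<delta> * (\<integral>z. q z x \<partial>\<nu>))"
      using q0 nonneg \<delta>_nonneg by (subst nn_integral_eq_integral[OF iq]) (auto simp: q_def ennreal_plus
          ennreal_mult simp del: ennreal_plus[symmetric])
    also have "\<dots> \<le> ennreal ((1 - \<delta> * m) * F x + \<delta> * (\<integral>z. F (x + z) \<partial>\<nu>))" using main by (rule ennreal_leI)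
    also have "\<dots> = ennreal (1 - \<delta> * m) * ennreal (F x) + ennreal \<delta> * (\<integral>\<^sup>+z. ennreal (F (x + z)) \<partial>\<nu>)"
      using q0 nonneg \<delta>_nonneg F0 m1 by (subst nn_integral_eq_integral[OF iF]) (auto simp: F_def
          ennreal_plus ennreal_mult)
    finally show ?thesis by (simp only: a_def b_def)
  qed
  have Fxm: "(\<lambda>w. ennreal (F (snd w + fst w))) \<in> borel_measurable (\<nu> \<Otimes>\<^sub>M lborel)" by measurable
  have sw1: "(\<integral>\<^sup>+x. (\<integral>\<^sup>+z. ennreal (q z x) \<partial>\<nu>) \<partial>lborel) = (\<integral>\<^sup>+z. (\<integral>\<^sup>+x. ennreal (q z x) \<partial>lborel) \<partial>\<nu>)"
    using P.Fubini'[of "\<lambda>z x. ennreal (q z x)"] by (simp add: case_prod_unfold)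
  have sw2: "(\<integral>\<^sup>+x. (\<integral>\<^sup>+z. ennreal (F (x + z)) \<partial>\<nu>) \<partial>lborel) = (\<integral>\<^sup>+z. (\<integral>\<^sup>+x. ennreal (F (x
      + z)) \<partial>lborel) \<partial>\<nu>)"
    using P.Fubini'[of "\<lambda>z x. ennreal (F (x + z))"] Fxm by (simp add: case_prod_unfold)
  have qx: "(\<lambda>x. \<integral>\<^sup>+z. ennreal (q z x) \<partial>\<nu>) \<in> borel_measurable borel" unfolding q_def by measurable
  have Fmm: "(\<lambda>x. ennreal (F x)) \<in> borel_measurable borel" by measurable
  have m1: "0 \<le> 1 - \<delta> * m" "0 \<le> m" using \<delta>_le by (auto simp: m_def)
  have \<Phi>s [measurable]: "(\<lambda>x. \<Phi> (step u x) (step v x)) \<in> borel_measurable borel" by (rule \<Phi>c) measurable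
  have "(\<integral>\<^sup>+x. ennreal (\<Phi> (step u x) (step v x)) \<partial>lborel) + ennreal \<delta>
      * (\<integral>\<^sup>+z. (\<integral>\<^sup>+x. ennreal (q z x) \<partial>lborel) \<partial>\<nu>)
     = (\<integral>\<^sup>+x. ennreal (\<Phi> (step u x) (step v x)) + ennreal \<delta> * (\<integral>\<^sup>+z. ennreal (q z x) \<partial>\<nu>) \<partial>lborel)"
    unfolding sw1[symmetric] using qx by (simp add: nn_integral_add nn_integral_cmult)
  also have "\<dots> \<le> (\<integral>\<^sup>+x. ennreal (1 - \<delta> * m) * ennreal (F x) + ennreal \<delta> * (\<integral>\<^sup>+z. ennreal (F (x
      + z)) \<partial>\<nu>) \<partial>lborel)"
    by (intro nn_integral_mono pt)
  also have "\<dots> = ennreal (1 - \<delta> * m) * (\<integral>\<^sup>+x. ennreal (F x) \<partial>lborel) + ennreal \<delta>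
      * (\<integral>\<^sup>+x. (\<integral>\<^sup>+z. ennreal (F (x + z)) \<partial>\<nu>) \<partial>lborel)"
    by (simp add: nn_integral_add nn_integral_cmult)
  \<comment> \<open>By translation invariance the inner integral does not depend on the jump, so the
    weights of staying and jumping add up to 1.\<close>
  also have "\<dots> = ennreal (1 - \<delta> * m) * (\<integral>\<^sup>+x. ennreal (F x) \<partial>lborel) + ennreal \<delta> * (ennreal m
      * (\<integral>\<^sup>+x. ennreal (F x) \<partial>lborel))"
    unfolding sw2 lborel_nn_integral_translate[OF Fmm] by (simp add: m_def emeasure_eq_measure mult.commute)
  also have "\<dots> = (ennreal (1 - \<delta> * m) + ennreal (\<delta> * m)) * (\<integral>\<^sup>+x. ennreal (F x) \<partial>lborel)"
    using \<delta>_nonneg m1 by (simp add: distrib_right ennreal_mult mult.assoc)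
  also have "ennreal (1 - \<delta> * m) + ennreal (\<delta> * m) = 1"
    using \<delta>_nonneg m1 by (subst ennreal_plus[symmetric]) auto
  finally show ?thesis by (simp add: q_def F_def)
qed

section \<open>Iterating the walk and summing the jump energies\<close>

lemma bdd_L1_iterate: "bdd_L1 u \<Longrightarrow> bdd_L1 ((step ^^ k) u)"
  by (induction k) (auto intro: bdd_L1_step)

lemma fourier_iterate:
  assumes u: "bdd_L1 u"
  shows "fourier ((step ^^ k) u) \<xi> = complex_of_real (r \<xi> ^ k) * fourier u \<xi>"
  by (induction k) (simp_all add: fourier_step[OF bdd_L1_iterate[OF u]])

text \<open>The gain term of \<open>bellman_step\<close> without the factor \<delta>. The absolute
  values inside are what later absorbs the weight \<phi>.\<close>

definition jump_energy :: "('a \<Rightarrow> complex) \<Rightarrow> ('a \<Rightarrow> complex) \<Rightarrow> ennreal" where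
  "jump_energy u v = (\<integral>\<^sup>+z. (\<integral>\<^sup>+x. ennreal (cmod (u (x + z) - step u x) * cmod (v (x + z)
      - step v x)) \<partial>lborel) \<partial>\<nu>)"

text \<open>\<open>bellman_step\<close> telescopes. The integral at time \<open>n\<close> is carried
  through the induction and dropped at the end.\<close>

lemma sum_jump_energy_le:
  fixes \<Phi> :: "complex \<Rightarrow> complex \<Rightarrow> real"
  assumes \<Phi>: "\<And>x y. 0 \<le> \<Phi> x y"
    "continuous_on UNIV (\<lambda>z. \<Phi> (fst z) (snd z))"
    "\<And>x y. \<exists>l m. \<forall>x' y'. \<Phi> x y + l \<bullet> (x' - x) + m \<bullet> (y' - y) + cmod (x' - x) * cmod (y' - y) \<le> \<Phi> x' y'"
    and f: "bdd_L1 f" and g: "bdd_L1 g"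
  shows "(\<Sum>k<n. ennreal \<delta> * jump_energy ((step ^^ k) f) ((step ^^ k) g))
      \<le> (\<integral>\<^sup>+x. ennreal (\<Phi> (f x) (g x)) \<partial>lborel)"
proof -
  have "(\<integral>\<^sup>+x. ennreal (\<Phi> ((step ^^ n) f x) ((step ^^ n) g x)) \<partial>lborel)
     + (\<Sum>k<n. ennreal \<delta> * jump_energy ((step ^^ k) f) ((step ^^ k) g))
         \<le> (\<integral>\<^sup>+x. ennreal (\<Phi> (f x) (g x)) \<partial>lborel)"
  proof (induction n)
    case (Suc n)
    have "(\<integral>\<^sup>+x. ennreal (\<Phi> ((step ^^ Suc n) f x) ((step ^^ Suc n) g x)) \<partial>lborel) + ennreal \<delta>
        * jump_energy ((step ^^ n) f) ((step ^^ n) g)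
        \<le> (\<integral>\<^sup>+x. ennreal (\<Phi> ((step ^^ n) f x) ((step ^^ n) g x)) \<partial>lborel)"
      using bellman_step[OF \<Phi> bdd_L1_iterate[OF f, of n] bdd_L1_iterate[OF g, of n]]
          by (simp add: jump_energy_def)
    from order_trans[OF add_right_mono[OF this, of "\<Sum>k<n. ennreal \<delta>
        * jump_energy ((step ^^ k) f) ((step ^^ k) g)"] Suc]
    show ?case by (simp add: ac_simps)
  qed simp
  then show ?thesis by (rule order_trans[rotated]) simp
qed


text \<open>On the Fourier side the increment of the walk along the jump \<open>z\<close> is multiplication by
  \<open>cis (- \<xi> \<bullet> z) - r \<xi>\<close>, whose squared modulus is \<open>1 - 2 r cos (\<xi> \<bullet> z) + r\<^sup>2\<close>.\<close>

lemma jump_form_fourier: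
  fixes u v :: "'a \<Rightarrow> complex"
  assumes u: "bdd_L1 u" and v: "bdd_L1 v"
  shows "complex_of_real ((2 * pi) ^ DIM('a)) * (\<integral>x. (u (x + z) - step u x) * cnj (v (x + z)
      - step v x) \<partial>lborel)
    = (\<integral>\<xi>. complex_of_real (1 - 2 * r \<xi> * cos (\<xi> \<bullet> z) + (r \<xi>)\<^sup>2) * (fourier u \<xi>
        * cnj (fourier v \<xi>)) \<partial>lborel)"
proof -
  have F: "fourier (\<lambda>x. w (x + z) - step w x) \<xi> = (cis (- (\<xi> \<bullet> z)) - complex_of_real (r \<xi>))
      * fourier w \<xi>" if w: "bdd_L1 w" for w \<xi>
    using fourier_diff[OF bdd_L1_integrable[OF bdd_L1_translate[OF w]] bdd_L1_integrable[OF
        bdd_L1_step[OF w]]]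
    by (simp add: fourier_translate[OF bdd_L1_measurable[OF w]] fourier_step[OF w] left_diff_distrib)
  have sq: "(cis (- (\<xi> \<bullet> z)) - complex_of_real (r \<xi>)) * cnj (cis (- (\<xi> \<bullet> z)) - complex_of_real (r \<xi>))
      = complex_of_real (1 - 2 * r \<xi> * cos (\<xi> \<bullet> z) + (r \<xi>)\<^sup>2)" for \<xi>
  proof -
    have "(cos (\<xi> \<bullet> z))\<^sup>2 + (sin (\<xi> \<bullet> z))\<^sup>2 = 1" by simp
    then have "(cos (\<xi> \<bullet> z) - r \<xi>)\<^sup>2 + (sin (\<xi> \<bullet> z))\<^sup>2 = 1 - 2 * r \<xi> * cos (\<xi> \<bullet> z) + (r \<xi>)\<^sup>2"
      by (simp add: power2_eq_square algebra_simps)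
    then show ?thesis unfolding complex_norm_square[symmetric] by (simp add: cmod_power2)
  qed
  have "complex_of_real ((2 * pi) ^ DIM('a)) * (\<integral>x. (u (x + z) - step u x) * cnj (v (x + z)
      - step v x) \<partial>lborel)
    = (\<integral>\<xi>. fourier (\<lambda>x. u (x + z) - step u x) \<xi> * cnj (fourier (\<lambda>x. v (x + z) - step v x) \<xi>) \<partial>lborel)"
    by (intro bdd_L1_parseval[symmetric] bdd_L1_diff bdd_L1_translate bdd_L1_step u v)
  also have "\<dots> = (\<integral>\<xi>. complex_of_real (1 - 2 * r \<xi> * cos (\<xi> \<bullet> z) + (r \<xi>)\<^sup>2) * (fourier u \<xi>
      * cnj (fourier v \<xi>)) \<partial>lborel)"
    unfolding F[OF u] F[OF v] sq[symmetric] by (simp only: complex_cnj_mult mult_ac)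
  finally show ?thesis .
qed

lemma r_bounds: "\<bar>r \<xi>\<bar> \<le> 1"
  using \<psi>_nonpos[of \<xi>] \<psi>_ge[of \<xi>] \<delta>_nonneg \<delta>_le mult_left_mono[OF \<psi>_ge[of \<xi>] \<delta>_nonneg]
    mult_nonneg_nonpos[OF \<delta>_nonneg \<psi>_nonpos[of \<xi>]]
  by (simp add: r_def abs_le_iff)

lemma jump_multiplier_bound: "\<bar>1 - 2 * r \<xi> * cos (\<xi> \<bullet> z) + (r \<xi>)\<^sup>2\<bar> \<le> 4"
proof -
  have "\<bar>r \<xi> * cos (\<xi> \<bullet> z)\<bar> \<le> 1 * 1" unfolding abs_mult by (intro mult_mono r_bounds) auto
  moreover have "(r \<xi>)\<^sup>2 \<le> 1" using r_bounds[of \<xi>] by (simp add: abs_square_le_1)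
  ultimately show ?thesis using zero_le_power2[of "r \<xi>"] unfolding abs_le_iff mult.assoc by linarith
qed

definition jump_multiplier :: "('a \<Rightarrow> complex) \<Rightarrow> 'a \<Rightarrow> complex" where
  "jump_multiplier \<phi> \<xi> = (\<integral>z. \<phi> z * complex_of_real (1 - 2 * r \<xi> * cos (\<xi> \<bullet> z) + (r \<xi>)\<^sup>2) \<partial>\<nu>)"

lemma jump_multiplier_measurable [measurable]:
  assumes [measurable]: "\<phi> \<in> borel_measurable borel"
  shows "jump_multiplier \<phi> \<in> borel_measurable borel"
  unfolding jump_multiplier_def[abs_def] by measurable

text \<open>Parseval's relation for each single jump, integrated over the jumps by Fubini. The
  weight \<phi> has modulus at most 1 and disappears when the modulus is taken inside both
  integrals.\<close>

lemma jump_multiplier_form: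
  fixes u v :: "'a \<Rightarrow> complex"
  assumes u: "bdd_L1 u" and v: "bdd_L1 v" and \<phi> [measurable]: "\<phi> \<in> borel_measurable borel" "\<And>z. cmod (\<phi>
      z) \<le> 1"
  shows "integrable lborel (\<lambda>\<xi>. jump_multiplier \<phi> \<xi> * (fourier u \<xi> * cnj (fourier v \<xi>)))"
    and "ennreal (cmod (\<integral>\<xi>. jump_multiplier \<phi> \<xi> * (fourier u \<xi> * cnj (fourier v \<xi>)) \<partial>lborel))
      \<le> ennreal ((2 * pi) ^ DIM('a)) * jump_energy u v"
proof -
  have [measurable]: "u \<in> borel_measurable borel" "v \<in> borel_measurable borel"
      by (auto intro: bdd_L1_measurable u v)
  define h where "h \<xi> = fourier u \<xi> * cnj (fourier v \<xi>)" for \<xi>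
  have hi: "integrable lborel h" unfolding h_def by (rule bdd_L1_fourier_product_integrable[OF u v])
  have [measurable]: "h \<in> borel_measurable borel" using hi by auto
  define A where "A \<xi> z = 1 - 2 * r \<xi> * cos (\<xi> \<bullet> z) + (r \<xi>)\<^sup>2" for \<xi> z
  define T where "T w = \<phi> (fst w) * (complex_of_real (A (snd w) (fst w)) * h (snd w))" for w
  have Ti: "integrable (\<nu> \<Otimes>\<^sub>M lborel) T"
  proof (rule Bochner_Integration.integrable_bound)
    show "integrable (\<nu> \<Otimes>\<^sub>M lborel) (\<lambda>w. 4 * h (snd w))"
      using pair_integrable_mult(1)[of \<nu> lborel "\<lambda>_. 4" h] hi sigma_finite_measure_axioms
          sigma_finite_lborel by simp
    show "T \<in> borel_measurable (\<nu> \<Otimes>\<^sub>M lborel)" unfolding T_def[abs_def] A_def by measurable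
    have "cmod (\<phi> z) * (\<bar>A \<xi> z\<bar> * cmod (h \<xi>)) \<le> 1 * (4 * cmod (h \<xi>))" for z \<xi>
      unfolding A_def by (intro mult_mono \<phi>(2) jump_multiplier_bound) auto
    then show "AE w in \<nu> \<Otimes>\<^sub>M lborel. norm (T w) \<le> norm (4 * h (snd w))"
      by (auto simp: T_def norm_mult)
  qed
  have inner: "(\<integral>z. T (z, \<xi>) \<partial>\<nu>) = jump_multiplier \<phi> \<xi> * h \<xi>" for \<xi>
    by (simp add: T_def jump_multiplier_def A_def mult.assoc[symmetric])
  show "integrable lborel (\<lambda>\<xi>. jump_multiplier \<phi> \<xi> * (fourier u \<xi> * cnj (fourier v \<xi>)))"
    using P.integrable_snd[of "\<lambda>z \<xi>. T (z, \<xi>)"] Ti unfolding inner h_def by (simp add: case_prod_unfold)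
  define I where "I z = (\<integral>x. (u (x + z) - step u x) * cnj (v (x + z) - step v x) \<partial>lborel)" for z
  define K where "K = (2 * pi) ^ DIM('a)"
  have K: "K \<ge> 0" by (simp add: K_def)
  have "(\<integral>\<xi>. jump_multiplier \<phi> \<xi> * h \<xi> \<partial>lborel) = (\<integral>z. (\<integral>\<xi>. T (z, \<xi>) \<partial>lborel) \<partial>\<nu>)"
    using P.Fubini_integral[of "\<lambda>z \<xi>. T (z, \<xi>)"] Ti unfolding inner by (simp add: case_prod_unfold)
  also have "\<dots> = (\<integral>z. \<phi> z * (complex_of_real K * I z) \<partial>\<nu>)"
    unfolding T_def fst_conv snd_conv A_def h_def integral_mult_right_zero jump_form_fourier[OF u v,
        symmetric] I_def K_def ..
  finally have "ennreal (cmod (\<integral>\<xi>. jump_multiplier \<phi> \<xi> * h \<xi> \<partial>lborel)) \<le> (\<integral>\<^sup>+z. ennreal (cmod (\<phi> z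
      * (complex_of_real K * I z))) \<partial>\<nu>)"
    using norm_integral_le_nn_integral[of \<nu> "\<lambda>z. \<phi> z * (complex_of_real K * I z)"] by simp
  also have "\<dots> \<le> (\<integral>\<^sup>+z. ennreal K * (\<integral>\<^sup>+x. ennreal (cmod (u (x + z) - step u x) * cmod (v (x + z)
      - step v x)) \<partial>lborel) \<partial>\<nu>)"
  proof (rule nn_integral_mono)
    fix z
    have "cmod (\<phi> z * (complex_of_real K * I z)) \<le> 1 * (K * cmod (I z))"
      unfolding norm_mult using K \<phi>(2)[of z] by (intro mult_mono) auto
    then have "ennreal (cmod (\<phi> z * (complex_of_real K * I z))) \<le> ennreal (K * cmod (I z))"
        by (intro ennreal_leI) simp
    also have "\<dots> = ennreal K * ennreal (cmod (I z))" using K by (simp add: ennreal_mult)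
    also have "\<dots> \<le> ennreal K * (\<integral>\<^sup>+x. ennreal (cmod ((u (x + z) - step u x) * cnj (v (x + z)
        - step v x))) \<partial>lborel)"
      unfolding I_def by (intro mult_left_mono norm_integral_le_nn_integral) auto
    finally show "ennreal (cmod (\<phi> z * (complex_of_real K * I z))) \<le> ennreal K
        * (\<integral>\<^sup>+x. ennreal (cmod (u (x + z) - step u x) * cmod (v (x + z) - step v x)) \<partial>lborel)"
      by (simp only: norm_mult complex_mod_cnj)
  qed
  also have "\<dots> = ennreal K * jump_energy u v"
  proof -
    have [measurable]: "step u \<in> borel_measurable borel" "step v \<in> borel_measurable borel"
      using bdd_L1_step u v by (auto intro: bdd_L1_measurable)
    show ?thesis unfolding jump_energy_def by (rule nn_integral_cmult) measurable
  qed
  finally show "ennreal (cmod (\<integral>\<xi>. jump_multiplier \<phi> \<xi> * (fourier u \<xi> * cnj (fourier v \<xi>)) \<partial>lborel))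
      \<le> ennreal ((2 * pi) ^ DIM('a)) * jump_energy u v"
    by (simp only: h_def K_def)
qed

text \<open>The symbol of the \<phi>-weighted form summed over \<open>n\<close> steps: the
  transforms of the two iterates contribute the real factor \<open>r \<xi> ^ k\<close> each, and
  \<delta> is the rate at which jumps occur in \<open>bellman_step\<close>.\<close>

definition walk_multiplier :: "nat \<Rightarrow> ('a \<Rightarrow> complex) \<Rightarrow> 'a \<Rightarrow> complex" where
  "walk_multiplier n \<phi> \<xi> = (\<Sum>k<n. complex_of_real (\<delta> * r \<xi> ^ (2 * k)) * jump_multiplier \<phi> \<xi>)"

lemma walk_multiplier_measurable [measurable]:
  assumes [measurable]: "\<phi> \<in> borel_measurable borel"
  shows "walk_multiplier n \<phi> \<in> borel_measurable borel"
  unfolding walk_multiplier_def[abs_def] by measurable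

text \<open>The right side involves neither \<open>n\<close> nor \<delta>, so the bound survives the
  passage to the limit.\<close>

lemma walk_multiplier_bound:
  fixes f g :: "'a \<Rightarrow> complex" and \<Phi> :: "complex \<Rightarrow> complex \<Rightarrow> real"
  assumes \<Phi>: "\<And>x y. 0 \<le> \<Phi> x y"
    "continuous_on UNIV (\<lambda>z. \<Phi> (fst z) (snd z))"
    "\<And>x y. \<exists>l m. \<forall>x' y'. \<Phi> x y + l \<bullet> (x' - x) + m \<bullet> (y' - y) + cmod (x' - x) * cmod (y' - y) \<le> \<Phi> x' y'"
    and f: "bdd_L1 f" and g: "bdd_L1 g" and \<phi>: "\<phi> \<in> borel_measurable borel" "\<And>z. cmod (\<phi> z) \<le> 1"
  shows "ennreal (cmod (\<integral>\<xi>. walk_multiplier n \<phi> \<xi> * (fourier f \<xi> * cnj (fourier g \<xi>)) \<partial>lborel))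
    \<le> ennreal ((2 * pi) ^ DIM('a)) * (\<integral>\<^sup>+x. ennreal (\<Phi> (f x) (g x)) \<partial>lborel)"
proof -
  define fk gk where "fk k = (step ^^ k) f" and "gk k = (step ^^ k) g" for k
  define J where "J k = (\<integral>\<xi>. jump_multiplier \<phi> \<xi> * (fourier (fk k) \<xi> * cnj (fourier (gk k) \<xi>)) \<partial>lborel)"
      for k
  note B = bdd_L1_iterate[OF f, folded fk_def] bdd_L1_iterate[OF g, folded gk_def]
  have eq: "walk_multiplier n \<phi> \<xi> * (fourier f \<xi> * cnj (fourier g \<xi>))
      = (\<Sum>k<n. complex_of_real \<delta> * (jump_multiplier \<phi> \<xi> * (fourier (fk k) \<xi> * cnj (fourier (gk k) \<xi>))))"
          for \<xi>
    unfolding walk_multiplier_def sum_distrib_right fk_def gk_def fourier_iterate[OF f]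
        fourier_iterate[OF g]
    by (intro sum.cong) (simp_all add: power_mult power2_eq_square mult_2 power_add mult_ac)
  have "(\<integral>\<xi>. walk_multiplier n \<phi> \<xi> * (fourier f \<xi> * cnj (fourier g \<xi>)) \<partial>lborel)
      = (\<Sum>k<n. complex_of_real \<delta> * J k)"
    unfolding eq J_def using jump_multiplier_form(1)[OF B \<phi>]
        by (subst Bochner_Integration.integral_sum) auto
  then have "cmod (\<integral>\<xi>. walk_multiplier n \<phi> \<xi> * (fourier f \<xi> * cnj (fourier g \<xi>)) \<partial>lborel) \<le> (\<Sum>k<n. \<delta>
      * cmod (J k))"
    using \<delta>_nonneg by (auto intro!: order_trans[OF norm_sum] sum_mono simp: norm_mult)
  then have "ennreal (cmod (\<integral>\<xi>. walk_multiplier n \<phi> \<xi> * (fourier f \<xi> * cnj (fourier g \<xi>)) \<partial>lborel))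
      \<le> (\<Sum>k<n. ennreal (\<delta> * cmod (J k)))"
    using \<delta>_nonneg by (subst sum_ennreal) (auto intro!: ennreal_leI)
  also have "\<dots> \<le> (\<Sum>k<n. ennreal ((2 * pi) ^ DIM('a)) * (ennreal \<delta> * jump_energy (fk k) (gk k)))"
  proof (rule sum_mono)
    fix k
    have "ennreal (\<delta> * cmod (J k)) = ennreal \<delta> * ennreal (cmod (J k))" using \<delta>_nonneg
        by (simp add: ennreal_mult)
    also have "\<dots> \<le> ennreal \<delta> * (ennreal ((2 * pi) ^ DIM('a)) * jump_energy (fk k) (gk k))"
      unfolding J_def by (intro mult_left_mono jump_multiplier_form(2)[OF B \<phi>]) auto
    finally show "ennreal (\<delta> * cmod (J k)) \<le> ennreal ((2 * pi) ^ DIM('a)) * (ennreal \<delta>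
        * jump_energy (fk k) (gk k))"
      by (simp only: mult_ac)
  qed
  also have "\<dots> \<le> ennreal ((2 * pi) ^ DIM('a)) * (\<integral>\<^sup>+x. ennreal (\<Phi> (f x) (g x)) \<partial>lborel)"
    unfolding sum_distrib_left[of "ennreal ((2 * pi) ^ DIM('a))", symmetric] fk_def gk_def
        by (intro mult_left_mono sum_jump_energy_le[OF \<Phi> f g]) auto
  finally show ?thesis .
qed

section \<open>Closed form and uniform bound of the walk multiplier\<close>

lemma num_integrable:
  assumes "\<phi> \<in> borel_measurable borel" "\<And>z. cmod (\<phi> z) \<le> 1"
  shows "integrable \<nu> (\<lambda>z. complex_of_real (cos (\<xi> \<bullet> z) - 1) * \<phi> z)" "integrable \<nu> \<phi>"
proof -
  have [measurable]: "\<phi> \<in> borel_measurable borel" by fact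
  have "cmod (complex_of_real (cos (\<xi> \<bullet> z) - 1) * \<phi> z) \<le> 2 * 1" for z
    unfolding norm_mult norm_of_real using assms(2)[of z] cos_ge_minus_one[of "\<xi> \<bullet> z"] cos_le_one[of "\<xi>
        \<bullet> z"]
    by (intro mult_mono) (auto simp: abs_le_iff)
  then show "integrable \<nu> (\<lambda>z. complex_of_real (cos (\<xi> \<bullet> z) - 1) * \<phi> z)"
    by (intro bounded_integrable[where B=2]) auto
  show "integrable \<nu> \<phi>" by (rule bounded_integrable[where B=1]) (use assms in auto)
qed

text \<open>Expanding 1 - 2 r cos + r^2 as -2 r (cos - 1) + (1 - r)^2 isolates the numerator of the
  multiplier; since 1 - r = -\<delta>\<psi>, the rest is of second order in \<delta>.\<close>

lemma jump_multiplier_eq: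
  assumes \<phi>: "\<phi> \<in> borel_measurable borel" "\<And>z. cmod (\<phi> z) \<le> 1"
  shows "jump_multiplier \<phi> \<xi> = - 2 * complex_of_real (r \<xi>) * (\<integral>z. complex_of_real (cos (\<xi> \<bullet> z) - 1)
      * \<phi> z \<partial>\<nu>)
     + complex_of_real ((\<delta> * \<psi> \<xi>)\<^sup>2) * (\<integral>z. \<phi> z \<partial>\<nu>)"
proof -
  have "\<phi> z * complex_of_real (1 - 2 * r \<xi> * cos (\<xi> \<bullet> z) + (r \<xi>)\<^sup>2)
     = - 2 * complex_of_real (r \<xi>) * (complex_of_real (cos (\<xi> \<bullet> z) - 1) * \<phi> z) + complex_of_real ((\<delta>
         * \<psi> \<xi>)\<^sup>2) * \<phi> z" for z
  proof -
    have "1 - 2 * r \<xi> * cos (\<xi> \<bullet> z) + (r \<xi>)\<^sup>2 = - 2 * r \<xi> * (cos (\<xi> \<bullet> z) - 1) + (\<delta> * \<psi> \<xi>)\<^sup>2"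
      by (simp add: r_def power2_eq_square algebra_simps)
    then show ?thesis by (simp add: algebra_simps)
  qed
  then show ?thesis unfolding jump_multiplier_def using num_integrable[OF \<phi>] by simp
qed

lemma cmod_num_le:
  assumes \<phi>: "\<phi> \<in> borel_measurable borel" "\<And>z. cmod (\<phi> z) \<le> 1"
  shows "cmod (\<integral>z. complex_of_real (cos (\<xi> \<bullet> z) - 1) * \<phi> z \<partial>\<nu>) \<le> - \<psi> \<xi>"
    and "cmod (\<integral>z. \<phi> z \<partial>\<nu>) \<le> measure \<nu> UNIV"
proof -
  have "cmod (\<integral>z. complex_of_real (cos (\<xi> \<bullet> z) - 1) * \<phi> z \<partial>\<nu>) \<le> (\<integral>z. cmod (complex_of_real (cos (\<xi> \<bullet> z)
      - 1) * \<phi> z) \<partial>\<nu>)"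
    by (rule integral_norm_bound)
  also have "\<dots> \<le> (\<integral>z. - (cos (\<xi> \<bullet> z) - 1) \<partial>\<nu>)"
  proof (rule integral_mono)
    show "integrable \<nu> (\<lambda>z. cmod (complex_of_real (cos (\<xi> \<bullet> z) - 1) * \<phi> z))"
        by (intro integrable_norm num_integrable[OF \<phi>])
    show "integrable \<nu> (\<lambda>z. - (cos (\<xi> \<bullet> z) - 1))" using cos_integrable by auto
    fix z
    have "cmod (complex_of_real (cos (\<xi> \<bullet> z) - 1) * \<phi> z) \<le> \<bar>cos (\<xi> \<bullet> z) - 1\<bar> * 1"
      unfolding norm_mult norm_of_real using \<phi>(2)[of z] by (intro mult_left_mono) auto
    then show "cmod (complex_of_real (cos (\<xi> \<bullet> z) - 1) * \<phi> z) \<le> - (cos (\<xi> \<bullet> z) - 1)"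
        using cos_le_one[of "\<xi> \<bullet> z"] by simp
  qed
  also have "\<dots> = - \<psi> \<xi>" unfolding \<psi>_def by (rule Bochner_Integration.integral_minus)
  finally show "cmod (\<integral>z. complex_of_real (cos (\<xi> \<bullet> z) - 1) * \<phi> z \<partial>\<nu>) \<le> - \<psi> \<xi>" .
  have "cmod (\<integral>z. \<phi> z \<partial>\<nu>) \<le> (\<integral>z. cmod (\<phi> z) \<partial>\<nu>)" by (rule integral_norm_bound)
  also have "\<dots> \<le> (\<integral>z. 1 \<partial>\<nu>)" using \<phi>(2) num_integrable(2)[OF \<phi>] by (intro integral_mono) auto
  finally show "cmod (\<integral>z. \<phi> z \<partial>\<nu>) \<le> measure \<nu> UNIV" by simp
qed

text \<open>The numerator is dominated by the modulus of the denominator and vanishes with it, which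
  agrees with the convention in \<open>mult_symbol\<close>.\<close>

lemma walk_multiplier_zero:
  assumes \<phi>: "\<phi> \<in> borel_measurable borel" "\<And>z. cmod (\<phi> z) \<le> 1" and "\<psi> \<xi> = 0"
  shows "walk_multiplier n \<phi> \<xi> = 0"
  using cmod_num_le(1)[OF \<phi>, of \<xi>] assms(3) by (simp add: walk_multiplier_def jump_multiplier_eq[OF \<phi>])

text \<open>A geometric series in r^2: the factor \<delta> cancels against 1 - r^2 = -\<delta>\<psi>
  (2 + \<delta>\<psi>), leaving the denominator of the multiplier up to a factor close to 2.\<close>

lemma walk_multiplier_eq:
  assumes "\<psi> \<xi> \<noteq> 0" "\<delta> > 0" "2 + \<delta> * \<psi> \<xi> \<noteq> 0"
  shows "walk_multiplier n \<phi> \<xi> = complex_of_real ((1 - r \<xi> ^ (2 * n)) / (- \<psi> \<xi> * (2 + \<delta> * \<psi> \<xi>)))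
      * jump_multiplier \<phi> \<xi>"
proof -
  have r2: "1 - (r \<xi>)\<^sup>2 = \<delta> * (- \<psi> \<xi> * (2 + \<delta> * \<psi> \<xi>))" by (simp add: r_def power2_eq_square algebra_simps)
  then have "(r \<xi>)\<^sup>2 \<noteq> 1" using assms
      by (metis eq_iff_diff_eq_0 less_irrefl mult_eq_0_iff neg_equal_0_iff_equal)
  have "(\<Sum>k<n. \<delta> * r \<xi> ^ (2 * k)) = \<delta> * (\<Sum>k<n. ((r \<xi>)\<^sup>2) ^ k)"
    by (simp add: sum_distrib_left power_mult)
  also have "\<dots> = \<delta> * ((1 - ((r \<xi>)\<^sup>2) ^ n) / (1 - (r \<xi>)\<^sup>2))"
    using \<open>(r \<xi>)\<^sup>2 \<noteq> 1\<close> by (simp add: sum_gp_strict)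
  also have "\<dots> = (1 - r \<xi> ^ (2 * n)) / (- \<psi> \<xi> * (2 + \<delta> * \<psi> \<xi>))"
    unfolding r2 using assms by (simp add: power_mult)
  finally show ?thesis unfolding walk_multiplier_def sum_distrib_right[symmetric] of_real_sum[symmetric]
      by simp
qed

text \<open>A bound independent of \<open>n\<close> and \<delta>, for dominated convergence. The
  quarter in the assumption keeps \<open>r\<close> in [0, 1] and 2 + \<delta>\<psi> above 3/2, and
  the jump multiplier is at most 3 |\<psi>|; the quotient of these constants is 2.\<close>

lemma cmod_walk_multiplier_le:
  assumes \<phi>: "\<phi> \<in> borel_measurable borel" "\<And>z. cmod (\<phi> z) \<le> 1" and \<delta>: "\<delta> > 0" "\<delta> * measure \<nu> UNIV \<le> 1/4"
  shows "cmod (walk_multiplier n \<phi> \<xi>) \<le> 2"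
proof (cases "\<psi> \<xi> = 0")
  case True
  then show ?thesis by (simp add: walk_multiplier_zero[OF \<phi>])
next
  case False
  define s where "s = - \<psi> \<xi>"
  have s: "s > 0" using False \<psi>_nonpos[of \<xi>] by (simp add: s_def)
  have ds: "\<delta> * s \<le> 1/2"
    using mult_left_mono[OF \<psi>_ge[of \<xi>], of \<delta>] \<delta> by (simp add: s_def)
  have ne: "2 + \<delta> * \<psi> \<xi> \<ge> 3/2" using ds by (simp add: s_def)
  have rb: "0 \<le> r \<xi>" "r \<xi> \<le> 1" using ds s \<delta> by (auto simp: r_def s_def mult_le_0_iff)
  have pw: "0 \<le> r \<xi> ^ (2 * n)" "r \<xi> ^ (2 * n) \<le> 1" using rb by (auto intro: power_le_one)
  have J: "cmod (jump_multiplier \<phi> \<xi>) \<le> 3 * s"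
  proof -
    have "cmod (jump_multiplier \<phi> \<xi>) \<le> cmod (- 2 * complex_of_real (r \<xi>)
        * (\<integral>z. complex_of_real (cos (\<xi> \<bullet> z) - 1) * \<phi> z \<partial>\<nu>))
       + cmod (complex_of_real ((\<delta> * \<psi> \<xi>)\<^sup>2) * (\<integral>z. \<phi> z \<partial>\<nu>))"
      unfolding jump_multiplier_eq[OF \<phi>] by (rule norm_triangle_ineq)
    also have "\<dots> = 2 * r \<xi> * cmod (\<integral>z. complex_of_real (cos (\<xi> \<bullet> z) - 1) * \<phi> z \<partial>\<nu>) + (\<delta> * \<psi> \<xi>)\<^sup>2
        * cmod (\<integral>z. \<phi> z \<partial>\<nu>)"
      using rb by (simp add: norm_mult norm_power power_mult_distrib)
    also have "\<dots> \<le> 2 * 1 * s + (\<delta> * \<psi> \<xi>)\<^sup>2 * measure \<nu> UNIV"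
      unfolding s_def using rb cmod_num_le(1)[OF \<phi>, of \<xi>] cmod_num_le(2)[OF \<phi>]
          by (intro add_mono mult_mono) auto
    also have "(\<delta> * \<psi> \<xi>)\<^sup>2 * measure \<nu> UNIV = (\<delta> * s) * (s * (\<delta> * measure \<nu> UNIV))"
      by (simp add: s_def power2_eq_square mult_ac)
    also have "\<dots> \<le> 1 * (s * 1)" using ds s \<delta> by (intro mult_mono) auto
    finally show ?thesis by simp
  qed
  have "cmod (walk_multiplier n \<phi> \<xi>) = (1 - r \<xi> ^ (2 * n)) / (s * (2 + \<delta> * \<psi> \<xi>))
      * cmod (jump_multiplier \<phi> \<xi>)"
  proof -
    have "0 \<le> (1 - r \<xi> ^ (2 * n)) / (s * (2 + \<delta> * \<psi> \<xi>))" using ne s pw by simp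
    moreover have "2 + \<delta> * \<psi> \<xi> \<noteq> 0" using ne by linarith
    ultimately show ?thesis
      unfolding walk_multiplier_eq[OF False \<delta>(1) \<open>2 + \<delta> * \<psi> \<xi> \<noteq> 0\<close>] s_def[symmetric] norm_mult norm_of_real
      by (simp only: abs_of_nonneg)
  qed
  also have "\<dots> \<le> 1 / (s * (3/2)) * (3 * s)"
    using ne s pw J by (intro mult_mono frac_le) auto
  also have "\<dots> = 2" using s by simp
  finally show ?thesis .
qed

end

section \<open>Symbols of Levy measures\<close>

text \<open>The step length is of order 1/n, yet (n+1)^2 steps are made. Hence the error term
  vanishes with \<delta>, while the elapsed time grows linearly and kills the power of
  \<open>r\<close>. The added 1 keeps \<open>\<delta> n\<close> positive for the zero
  measure.\<close>

lemma walk_multiplier_tendsto: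
  fixes \<nu> :: "'a::euclidean_space measure"
  assumes W: "\<And>n. symmetric_walk \<nu> (\<delta> n)" and \<delta>: "\<And>n. \<delta> n = 1 / (4 * (measure \<nu> UNIV + 1) * real (Suc n))"
    and \<phi>: "\<phi> \<in> borel_measurable borel" "\<And>z. cmod (\<phi> z) \<le> 1"
  shows "(\<lambda>n. symmetric_walk.walk_multiplier \<nu> (\<delta> n) ((Suc n)\<^sup>2) \<phi> \<xi>) \<longlonglongrightarrow> mult_symbol \<nu> \<phi> \<xi>"
proof -
  define m where "m = measure \<nu> UNIV"
  have m: "m \<ge> 0" by (simp add: m_def)
  have \<delta>pos: "\<delta> n > 0" for n using m unfolding \<delta> m_def[symmetric] by simp
  have \<delta>lim: "\<delta> \<longlonglongrightarrow> 0"
  proof -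
    have "(\<lambda>n. 1 / (4 * (m + 1)) * inverse (real (Suc n))) \<longlonglongrightarrow> 1 / (4 * (m + 1)) * 0"
      by (intro tendsto_intros LIMSEQ_inverse_real_of_nat)
    then show ?thesis by (simp add: \<delta>[abs_def] m_def inverse_eq_divide)
  qed
  define \<psi> where "\<psi> = symmetric_walk.\<psi> \<nu> \<xi>"
  define num where "num = (\<integral>z. complex_of_real (cos (\<xi> \<bullet> z) - 1) * \<phi> z \<partial>\<nu>)"
  define P where "P = (\<integral>z. \<phi> z \<partial>\<nu>)"
  have \<psi>_eq: "\<psi> = (\<integral>z. cos (\<xi> \<bullet> z) - 1 \<partial>\<nu>)" using symmetric_walk.\<psi>_def[OF W] by (simp add: \<psi>_def)
  have ms: "mult_symbol \<nu> \<phi> \<xi> = (if \<psi> = 0 then 0 else num / complex_of_real \<psi>)"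
    by (simp add: mult_symbol_def Let_def \<psi>_eq num_def)
  show ?thesis
  proof (cases "\<psi> = 0")
    case True
    then show ?thesis
      using symmetric_walk.walk_multiplier_zero[OF W \<phi>] by (simp add: ms \<psi>_def)
  next
    case False
    have \<psi>neg: "\<psi> < 0" using False symmetric_walk.\<psi>_nonpos[OF W[of 0], of \<xi>] by (simp add: \<psi>_def)
    have \<psi>ge: "- 2 * m \<le> \<psi>" using symmetric_walk.\<psi>_ge[OF W[of 0], of \<xi>] by (simp add: \<psi>_def m_def)
    define R where "R n = 1 + \<delta> n * \<psi>" for n
    have R: "symmetric_walk.r \<nu> (\<delta> n) \<xi> = R n" for n using symmetric_walk.r_def[OF W[of n]]
        by (simp add: R_def \<psi>_def)
    have dm: "\<delta> n * m \<le> 1/4" for n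
    proof -
      have "4 * m \<le> 4 * (m + 1) * real (Suc n)" using m by (simp add: algebra_simps add_increasing2)
      then show ?thesis using m unfolding \<delta> m_def[symmetric] by (simp add: divide_simps del: of_nat_Suc)
    qed
    have dpsi: "- 1/2 \<le> \<delta> n * \<psi>" for n
      using mult_left_mono[OF \<psi>ge, of "\<delta> n"] \<delta>pos[of n] dm[of n] by simp
    have Rb: "0 \<le> R n" for n using dpsi[of n] by (simp add: R_def)
    have eq: "symmetric_walk.walk_multiplier \<nu> (\<delta> n) ((Suc n)\<^sup>2) \<phi> \<xi>
        = complex_of_real ((1 - R n ^ (2 * (Suc n)\<^sup>2)) / (- \<psi> * (2 + \<delta> n * \<psi>)))
          * (- 2 * complex_of_real (R n) * num + complex_of_real ((\<delta> n * \<psi>)\<^sup>2) * P)" for n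
      using symmetric_walk.walk_multiplier_eq[OF W[of n], of \<xi> "(Suc n)\<^sup>2" \<phi>]
        symmetric_walk.jump_multiplier_eq[OF W[of n] \<phi>, of \<xi>] False \<delta>pos[of n] dpsi[of n]
      unfolding R \<psi>_def[symmetric] num_def[symmetric] P_def[symmetric] by simp
    \<comment> \<open>By \<open>1 + t \<le> exp t\<close> and 2 (n+1)^2 \<delta>_n = (n+1) / (2
      (m+1)), the power of \<open>R n\<close> is at most \<open>e ^ Suc n\<close>.\<close>
    define e where "e = exp (\<psi> / (2 * (m + 1)))"
    have e: "0 < e" "e < 1" using \<psi>neg m by (auto simp: e_def divide_neg_pos)
    have Rlim: "(\<lambda>n. R n ^ (2 * (Suc n)\<^sup>2)) \<longlonglongrightarrow> 0"
    proof (rule tendsto_sandwich[where f="\<lambda>_. 0"])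
      have "R n ^ (2 * (Suc n)\<^sup>2) \<le> e ^ Suc n" for n
      proof -
        have "R n \<le> exp (\<delta> n * \<psi>)" unfolding R_def by (rule exp_ge_add_one_self)
        then have "R n ^ (2 * (Suc n)\<^sup>2) \<le> exp (\<delta> n * \<psi>) ^ (2 * (Suc n)\<^sup>2)" using Rb by (rule power_mono)
        also have "\<dots> = exp (real (2 * (Suc n)\<^sup>2) * (\<delta> n * \<psi>))" by (rule exp_of_nat_mult[symmetric])
        also have "real (2 * (Suc n)\<^sup>2) * (\<delta> n * \<psi>) = real (Suc n) * (\<psi> / (2 * (m + 1)))"
        proof -
          define N where "N = real (Suc n)"
          define M where "M = m + 1"
          have e: "real (2 * (Suc n)\<^sup>2) = 2 * N * N" unfolding N_def
              by (simp add: power2_eq_square algebra_simps)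
          have "N > 0" "M > 0" using m by (auto simp: N_def M_def)
          then have "2 * N * N * (1 / (4 * M * N) * \<psi>) = N * (\<psi> / (2 * M))" by (simp add: divide_simps)
          then show ?thesis unfolding e \<delta> m_def[symmetric] N_def[symmetric] M_def[symmetric] .
        qed
        also have "exp (real (Suc n) * (\<psi> / (2 * (m + 1)))) = e ^ Suc n"
          unfolding e_def by (rule exp_of_nat_mult)
        finally show ?thesis .
      qed
      then show "\<forall>\<^sub>F n in sequentially. R n ^ (2 * (Suc n)\<^sup>2) \<le> e ^ Suc n" by simp
      show "(\<lambda>n. e ^ Suc n) \<longlonglongrightarrow> 0" using e by (intro LIMSEQ_Suc LIMSEQ_power_zero) auto
    qed (use Rb in auto)
    have R1: "R \<longlonglongrightarrow> 1"
    proof -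
      have "(\<lambda>n. 1 + \<delta> n * \<psi>) \<longlonglongrightarrow> 1 + 0 * \<psi>" by (intro tendsto_intros \<delta>lim)
      then show ?thesis by (simp add: R_def[abs_def])
    qed
    have "(\<lambda>n. complex_of_real ((1 - R n ^ (2 * (Suc n)\<^sup>2)) / (- \<psi> * (2 + \<delta> n * \<psi>)))
          * (- 2 * complex_of_real (R n) * num + complex_of_real ((\<delta> n * \<psi>)\<^sup>2) * P))
        \<longlonglongrightarrow> complex_of_real ((1 - 0) / (- \<psi> * (2 + 0 * \<psi>)))
          * (- 2 * complex_of_real 1 * num + complex_of_real ((0 * \<psi>)\<^sup>2) * P)"
      using False by (intro tendsto_intros Rlim R1 \<delta>lim) auto
    then show ?thesis unfolding eq using False by (simp add: ms field_simps)
  qed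
qed

lemma fourier_cmult: "fourier (\<lambda>x. c * f x) \<xi> = c * fourier f \<xi>"
proof -
  have "fourier (\<lambda>x. c * f x) \<xi> = (\<integral>z. c * (cis (\<xi> \<bullet> z) * f z) \<partial>lborel)"
    unfolding fourier_def by (simp only: mult_ac)
  then show ?thesis by (simp add: fourier_def)
qed

text \<open>The walk multipliers are bounded by 2 and multiply an integrable function, so the
  estimate passes to their limit. Measurability of the symbol is inherited from the same
  limit.\<close>

lemma finite_jump_bilinear:
  fixes \<nu> :: "'a::euclidean_space measure" and f g :: "'a \<Rightarrow> complex"
  assumes "finite_measure \<nu>" "sets \<nu> = sets borel" "distr \<nu> borel uminus = \<nu>"
    and \<phi>: "\<phi> \<in> borel_measurable borel" "\<And>z. cmod (\<phi> z) \<le> 1"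
    and p: "p > 1" and q: "q = p / (p - 1)" and C: "C = max p q - 1"
    and f: "bounded_support f" and g: "bounded_support g"
  shows "mult_symbol \<nu> \<phi> \<in> borel_measurable borel"
    and "cmod (\<integral>\<xi>. mult_symbol \<nu> \<phi> \<xi> * (fourier f \<xi> * cnj (fourier g \<xi>)) \<partial>lborel)
      \<le> (2 * pi) ^ DIM('a) * (C * (Lp_norm p f powr p / p + Lp_norm q g powr q / q))"
proof -
  interpret finite_measure \<nu> by fact
  define m where "m = measure \<nu> UNIV"
  have m: "m \<ge> 0" by (simp add: m_def)
  define \<delta> where "\<delta> n = 1 / (4 * (measure \<nu> UNIV + 1) * real (Suc n))" for n
  have \<delta>pos: "\<delta> n > 0" for n using m unfolding \<delta>_def m_def[symmetric] by simp
  have dm: "\<delta> n * m \<le> 1/4" for n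
  proof -
    have "4 * m \<le> 4 * (m + 1) * real (Suc n)" using m by (simp add: algebra_simps add_increasing2)
    then show ?thesis using m unfolding \<delta>_def m_def[symmetric] by (simp add: divide_simps del: of_nat_Suc)
  qed
  have W: "symmetric_walk \<nu> (\<delta> n)" for n
    using assms(2,3) dm[of n] \<delta>pos[of n] by unfold_locales (auto simp: m_def)
  define X where "X n = symmetric_walk.walk_multiplier \<nu> (\<delta> n) ((Suc n)\<^sup>2) \<phi>" for n
  have Xm [measurable]: "X n \<in> borel_measurable borel" for n
    unfolding X_def by (rule symmetric_walk.walk_multiplier_measurable[OF W \<phi>(1)])
  have Xlim: "(\<lambda>n. X n \<xi>) \<longlonglongrightarrow> mult_symbol \<nu> \<phi> \<xi>" for \<xi>
    unfolding X_def by (rule walk_multiplier_tendsto[OF W \<delta>_def \<phi>])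
  show ms [measurable]: "mult_symbol \<nu> \<phi> \<in> borel_measurable borel"
    by (rule borel_measurable_LIMSEQ_metric[OF Xm Xlim])
  have X2: "cmod (X n \<xi>) \<le> 2" for n \<xi>
    unfolding X_def using symmetric_walk.cmod_walk_multiplier_le[OF W \<phi> \<delta>pos] dm by (simp add: m_def)
  have bf: "bdd_L1 f" "bdd_L1 g" using f g by (auto intro: bounded_support_bdd_L1)
  define h where "h \<xi> = fourier f \<xi> * cnj (fourier g \<xi>)" for \<xi>
  have hi: "integrable lborel h" unfolding h_def by (rule bdd_L1_fourier_product_integrable[OF bf])
  have [measurable]: "h \<in> borel_measurable borel" using hi by auto
  obtain \<Phi> :: "complex \<Rightarrow> complex \<Rightarrow> real" where \<Phi>: "\<And>x y. 0 \<le> \<Phi> x y"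
    "\<And>x y. \<Phi> x y \<le> C * (cmod x powr p / p + cmod y powr q / q)"
    "continuous_on UNIV (\<lambda>z. \<Phi> (fst z) (snd z))"
    "\<And>x y. \<exists>l m. \<forall>x' y'. \<Phi> x y + l \<bullet> (x' - x) + m \<bullet> (y' - y) + cmod (x' - x) * cmod (y' - y) \<le> \<Phi> x' y'"
    by (rule bellman_subgradient[OF p q C]) (rule that)
  have q1: "q > 1" using p by (simp add: q)
  have C0: "C \<ge> 0" using p by (simp add: C)
  have fL: "in_Lp p f" "in_Lp q g" using bounded_support_in_Lp[OF f] bounded_support_in_Lp[OF g] p q1
      by auto
  define D where "D = C * (Lp_norm p f powr p / p + Lp_norm q g powr q / q)"
  have D0: "D \<ge> 0" using C0 p q1 by (simp add: D_def)
  have "(\<integral>\<^sup>+x. ennreal (\<Phi> (f x) (g x)) \<partial>lborel) \<le> (\<integral>\<^sup>+x. ennreal (C * (cmod (f x) powr p / p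
      + cmod (g x) powr q / q)) \<partial>lborel)"
    using \<Phi>(2) by (intro nn_integral_mono ennreal_leI)
  also have "\<dots> = ennreal (\<integral>x. C * (cmod (f x) powr p / p + cmod (g x) powr q / q) \<partial>lborel)"
    using in_Lp_integrable[OF fL(1)] in_Lp_integrable[OF fL(2)] C0 p q1
        by (intro nn_integral_eq_integral) auto
  also have "(\<integral>x. C * (cmod (f x) powr p / p + cmod (g x) powr q / q) \<partial>lborel) = D"
    using in_Lp_integrable[OF fL(1)] in_Lp_integrable[OF fL(2)] Lp_norm_powr[OF fL(1)] Lp_norm_powr[OF
        fL(2)] p q1
    by (simp add: D_def)
  finally have \<Phi>D: "(\<integral>\<^sup>+x. ennreal (\<Phi> (f x) (g x)) \<partial>lborel) \<le> ennreal D" .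
  have bound: "cmod (\<integral>\<xi>. X n \<xi> * h \<xi> \<partial>lborel) \<le> (2 * pi) ^ DIM('a) * D" for n
  proof -
    have "ennreal (cmod (\<integral>\<xi>. X n \<xi> * h \<xi> \<partial>lborel)) \<le> ennreal ((2 * pi) ^ DIM('a))
        * (\<integral>\<^sup>+x. ennreal (\<Phi> (f x) (g x)) \<partial>lborel)"
      unfolding X_def h_def by (rule symmetric_walk.walk_multiplier_bound[OF W \<Phi>(1,3,4) bf \<phi>])
    also have "\<dots> \<le> ennreal ((2 * pi) ^ DIM('a)) * ennreal D" using \<Phi>D by (intro mult_left_mono) auto
    also have "\<dots> = ennreal ((2 * pi) ^ DIM('a) * D)" using D0 by (simp add: ennreal_mult)
    finally show ?thesis using D0 by (subst (asm) ennreal_le_iff) auto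
  qed
  have "(\<lambda>n. \<integral>\<xi>. X n \<xi> * h \<xi> \<partial>lborel) \<longlonglongrightarrow> (\<integral>\<xi>. mult_symbol \<nu> \<phi> \<xi> * h \<xi> \<partial>lborel)"
  proof (rule integral_dominated_convergence)
    show "integrable lborel (\<lambda>\<xi>. 2 * cmod (h \<xi>))" using hi by simp
    show "AE \<xi> in lborel. (\<lambda>n. X n \<xi> * h \<xi>) \<longlonglongrightarrow> mult_symbol \<nu> \<phi> \<xi> * h \<xi>"
      by (intro AE_I2 tendsto_intros Xlim)
    show "AE \<xi> in lborel. norm (X n \<xi> * h \<xi>) \<le> 2 * cmod (h \<xi>)" for n
      using X2 by (intro AE_I2) (simp add: norm_mult mult_right_mono)
  qed measurable
  then have "(\<lambda>n. cmod (\<integral>\<xi>. X n \<xi> * h \<xi> \<partial>lborel)) \<longlonglongrightarrow> cmod (\<integral>\<xi>. mult_symbol \<nu> \<phi> \<xi> * h \<xi> \<partial>lborel)"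
    by (rule tendsto_norm)
  then show "cmod (\<integral>\<xi>. mult_symbol \<nu> \<phi> \<xi> * (fourier f \<xi> * cnj (fourier g \<xi>)) \<partial>lborel)
      \<le> (2 * pi) ^ DIM('a) * (C * (Lp_norm p f powr p / p + Lp_norm q g powr q / q))"
    unfolding h_def[symmetric] D_def[symmetric] using bound by (intro LIMSEQ_le_const2) auto
qed

lemma one_minus_cos_le: "1 - cos t \<le> t\<^sup>2 / 2" for t :: real
proof -
  have "1 - cos t = 2 * (sin (t / 2))\<^sup>2" using cos_double_sin[of "t/2"] by simp
  also have "(sin (t / 2))\<^sup>2 \<le> (t / 2)\<^sup>2"
    using power_mono[OF abs_sin_x_le_abs_x[of "t/2"], of 2] by (simp add: power_divide)
  finally show ?thesis by (simp add: power_divide)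
qed

locale levy_multiplier =
  fixes V :: "'a::euclidean_space measure" and \<phi> :: "'a \<Rightarrow> complex"
  assumes sets_V [measurable_cong]: "sets V = sets borel"
    and V_finite: "(\<integral>\<^sup>+x. ennreal (min ((norm x)\<^sup>2) 1) \<partial>V) < \<infinity>"
    and V_sym: "\<And>B. B \<in> sets borel \<Longrightarrow> emeasure V (uminus ` B) = emeasure V B"
    and \<phi>_measurable [measurable]: "\<phi> \<in> borel_measurable borel"
    and \<phi>_le: "\<And>z. cmod (\<phi> z) \<le> 1"
begin

lemma space_V [simp]: "space V = UNIV"
  using sets_eq_imp_space_eq[OF sets_V] by simp

lemma min_integrable: "integrable V (\<lambda>x. min ((norm x)\<^sup>2) 1)"
proof (rule integrableI_bounded)
  show "(\<integral>\<^sup>+x. ennreal (norm (min ((norm x)\<^sup>2) 1)) \<partial>V) < \<infinity>" using V_finite by simp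
qed measurable

definition den :: "'a \<Rightarrow> real" where "den \<xi> = (\<integral>z. cos (\<xi> \<bullet> z) - 1 \<partial>V)"

definition num :: "'a \<Rightarrow> complex" where "num \<xi> = (\<integral>z. complex_of_real (cos (\<xi> \<bullet> z) - 1) * \<phi> z \<partial>V)"

text \<open>Quadratic near the origin, at most 2 elsewhere: exactly what the integrability condition
  on \<open>V\<close> controls.\<close>

lemma cos_bound: "\<bar>cos (\<xi> \<bullet> z) - 1\<bar> \<le> (2 + (norm \<xi>)\<^sup>2) * min ((norm z)\<^sup>2) 1"
proof -
  have a: "\<bar>cos (\<xi> \<bullet> z) - 1\<bar> = 1 - cos (\<xi> \<bullet> z)" using cos_le_one[of "\<xi> \<bullet> z"] by simp
  show ?thesis
  proof (cases "norm z \<le> 1")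
    case True
    then have "(norm z)\<^sup>2 \<le> 1" by (simp add: power_le_one)
    have "1 - cos (\<xi> \<bullet> z) \<le> (\<xi> \<bullet> z)\<^sup>2 / 2" by (rule one_minus_cos_le)
    also have "(\<xi> \<bullet> z)\<^sup>2 \<le> (norm \<xi> * norm z)\<^sup>2"
      using Cauchy_Schwarz_ineq2[of \<xi> z] by (metis abs_ge_zero power2_abs power_mono)
    finally have "1 - cos (\<xi> \<bullet> z) \<le> (norm \<xi>)\<^sup>2 * (norm z)\<^sup>2 / 2" by (simp add: power_mult_distrib)
    also have "\<dots> \<le> (2 + (norm \<xi>)\<^sup>2) * (norm z)\<^sup>2" by (simp add: algebra_simps)
    finally show ?thesis using \<open>(norm z)\<^sup>2 \<le> 1\<close> by (simp add: a)
  next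
    case False
    then have m1: "min ((norm z)\<^sup>2) 1 = 1" by simp
    show ?thesis unfolding a m1 mult_1_right using cos_ge_minus_one[of "\<xi> \<bullet> z"] zero_le_power2[of "norm
        \<xi>"] by linarith
  qed
qed

lemma cos_V_integrable: "integrable V (\<lambda>z. cos (\<xi> \<bullet> z) - 1)"
  by (rule Bochner_Integration.integrable_bound[OF integrable_mult_right[OF min_integrable, of "2
      + (norm \<xi>)\<^sup>2"]])
     (use cos_bound in \<open>auto intro!: AE_I2 intro: order_trans[OF _ abs_ge_self]\<close>)

lemma num_bound: "cmod (complex_of_real (cos (\<xi> \<bullet> z) - 1) * \<phi> z) \<le> \<bar>cos (\<xi> \<bullet> z) - 1\<bar>"
  unfolding norm_mult norm_of_real using \<phi>_le[of z] by (intro mult_left_le) auto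

lemma num_V_integrable: "integrable V (\<lambda>z. complex_of_real (cos (\<xi> \<bullet> z) - 1) * \<phi> z)"
  by (rule Bochner_Integration.integrable_bound[OF cos_V_integrable[of \<xi>]]) (use num_bound in auto)

lemma abs_den: "\<bar>den \<xi>\<bar> = (\<integral>z. \<bar>cos (\<xi> \<bullet> z) - 1\<bar> \<partial>V)"
proof -
  have "(\<integral>z. \<bar>cos (\<xi> \<bullet> z) - 1\<bar> \<partial>V) = (\<integral>z. - (cos (\<xi> \<bullet> z) - 1) \<partial>V)"
    by (intro Bochner_Integration.integral_cong refl abs_of_nonpos) simp
  also have "\<dots> = - den \<xi>" unfolding den_def by (rule Bochner_Integration.integral_minus)
  finally have e: "(\<integral>z. \<bar>cos (\<xi> \<bullet> z) - 1\<bar> \<partial>V) = - den \<xi>" .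
  moreover have "0 \<le> (\<integral>z. \<bar>cos (\<xi> \<bullet> z) - 1\<bar> \<partial>V)" by (rule integral_nonneg_AE) auto
  ultimately show ?thesis by simp
qed

lemma cmod_num_le_den: "cmod (num \<xi>) \<le> \<bar>den \<xi>\<bar>"
proof -
  have "cmod (num \<xi>) \<le> (\<integral>z. cmod (complex_of_real (cos (\<xi> \<bullet> z) - 1) * \<phi> z) \<partial>V)"
    unfolding num_def by (rule integral_norm_bound)
  also have "\<dots> \<le> (\<integral>z. \<bar>cos (\<xi> \<bullet> z) - 1\<bar> \<partial>V)"
    using num_bound cos_V_integrable num_V_integrable
        by (intro integral_mono integrable_norm integrable_abs) auto
  finally show ?thesis by (simp add: abs_den)
qed

lemma mult_symbol_eq: "mult_symbol V \<phi> \<xi> = (if den \<xi> = 0 then 0 else num \<xi> / complex_of_real (den \<xi>))"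
  by (simp add: mult_symbol_def Let_def den_def num_def)

lemma cmod_mult_symbol_le: "cmod (mult_symbol V \<phi> \<xi>) \<le> 1"
  using cmod_num_le_den[of \<xi>] by (simp add: mult_symbol_eq norm_divide)

section \<open>Removing the small jumps\<close>

definition away :: "nat \<Rightarrow> 'a set" where "away j = {z. norm z \<ge> inverse (real (Suc j))}"

definition cut_measure :: "nat \<Rightarrow> 'a measure" where "cut_measure j = density V (indicator (away j))"

lemma away_sets [measurable]: "away j \<in> sets borel" unfolding away_def by measurable


lemma sets_cut [measurable_cong]: "sets (cut_measure j) = sets borel"
  by (simp add: cut_measure_def sets_V)

lemma emeasure_cut: "A \<in> sets borel \<Longrightarrow> emeasure (cut_measure j) A = emeasure V (away j \<inter> A)"
  unfolding cut_measure_def by (subst emeasure_density) (auto simp: sets_V nn_integral_indicator simp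
      flip: indicator_inter_arith)

text \<open>Chebyshev's inequality: on \<open>away j\<close> the integrand in
  \<open>V_finite\<close> is at least \<open>c\<^sup>2\<close>.\<close>

lemma finite_cut: "finite_measure (cut_measure j)"
proof
  define c where "c = inverse (real (Suc j))"
  have c: "0 < c" "c \<le> 1" by (auto simp: c_def divide_simps)
  have "emeasure (cut_measure j) (space (cut_measure j)) = emeasure V (away j)"
    using emeasure_cut[of UNIV j] sets_eq_imp_space_eq[OF sets_cut[of j]] by simp
  also have "\<dots> = (\<integral>\<^sup>+z. indicator (away j) z \<partial>V)" by (simp add: sets_V)
  also have "\<dots> \<le> (\<integral>\<^sup>+z. ennreal (1 / c\<^sup>2) * ennreal (min ((norm z)\<^sup>2) 1) \<partial>V)"
  proof (rule nn_integral_mono)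
    fix z
    show "indicator (away j) z \<le> ennreal (1 / c\<^sup>2) * ennreal (min ((norm z)\<^sup>2) 1)"
    proof (cases "z \<in> away j")
      case True
      then have "c\<^sup>2 \<le> (norm z)\<^sup>2" using c by (intro power_mono) (auto simp: away_def c_def)
      moreover have "c\<^sup>2 \<le> 1" using c by (simp add: power_le_one)
      ultimately have "1 \<le> 1 / c\<^sup>2 * min ((norm z)\<^sup>2) 1" using c by (simp add: min_def field_simps)
      then have "ennreal 1 \<le> ennreal (1 / c\<^sup>2 * min ((norm z)\<^sup>2) 1)" by (rule ennreal_leI)
      also have "\<dots> = ennreal (1 / c\<^sup>2) * ennreal (min ((norm z)\<^sup>2) 1)" by (rule ennreal_mult) auto
      finally show ?thesis using True by simp
    qed simp
  qed
  also have "\<dots> = ennreal (1 / c\<^sup>2) * (\<integral>\<^sup>+z. ennreal (min ((norm z)\<^sup>2) 1) \<partial>V)"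
    by (rule nn_integral_cmult) measurable
  also have "\<dots> < \<infinity>" using V_finite by (simp add: ennreal_mult_less_top)
  finally show "emeasure (cut_measure j) (space (cut_measure j)) \<noteq> \<infinity>" by simp
qed

lemma away_uminus: "away j \<inter> uminus -` A = uminus ` (away j \<inter> A)"
proof
  show "away j \<inter> uminus -` A \<subseteq> uminus ` (away j \<inter> A)"
  proof
    fix z assume "z \<in> away j \<inter> uminus -` A"
    then show "z \<in> uminus ` (away j \<inter> A)" by (intro image_eqI[of z uminus "- z"]) (auto simp: away_def)
  qed
qed (auto simp: away_def)

lemma sym_cut: "distr (cut_measure j) borel uminus = cut_measure j"
proof (rule measure_eqI)
  have m: "uminus \<in> cut_measure j \<rightarrow>\<^sub>M borel" by measurable
  fix A assume "A \<in> sets (distr (cut_measure j) borel uminus)"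
  then have A: "A \<in> sets borel" by simp
  note eq = away_uminus[of j A]
  have "uminus -` A \<in> sets borel" using measurable_sets_borel[of uminus borel A] A by simp
  then have "emeasure (distr (cut_measure j) borel uminus) A = emeasure V (away j \<inter> uminus -` A)"
    using A sets_eq_imp_space_eq[OF sets_cut[of j]] by (simp add: emeasure_distr[OF m] emeasure_cut)
  also have "\<dots> = emeasure V (away j \<inter> A)" unfolding eq using A by (intro V_sym) auto
  finally show "emeasure (distr (cut_measure j) borel uminus) A = emeasure (cut_measure j) A"
    using A by (simp add: emeasure_cut)
qed (simp add: sets_cut)

lemma integral_cut:
  fixes f :: "'a \<Rightarrow> 'b::{banach, second_countable_topology}"
  assumes [measurable]: "f \<in> borel_measurable borel"
  shows "(\<integral>z. f z \<partial>cut_measure j) = (\<integral>z. indicator (away j) z *\<^sub>R f z \<partial>V)"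
proof -
  have "cut_measure j = density V (\<lambda>z. ennreal (indicator (away j) z))"
    unfolding cut_measure_def by (intro arg_cong[of _ _ "density V"] ext) (simp add: indicator_def)
  then show ?thesis by (simp add: integral_density)
qed

lemma indicator_away_tendsto:
  assumes "z \<noteq> 0"
  shows "\<forall>\<^sub>F j in sequentially. indicator (away j) z = (1::real)"
proof -
  have "\<forall>\<^sub>F j in sequentially. inverse (real (Suc j)) < norm z"
    using LIMSEQ_inverse_real_of_nat assms by (intro order_tendstoD) auto
  then show ?thesis by eventually_elim (auto simp: away_def)
qed

text \<open>Every point other than the origin is eventually kept. The origin belongs to no
  \<open>away j\<close>, and there \<open>f 0 = 0\<close> gives the convergence.\<close>

lemma integral_cut_tendsto:
  fixes f :: "'a \<Rightarrow> 'b::{banach, second_countable_topology}"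
  assumes f: "integrable V f" and "f 0 = 0"
  shows "(\<lambda>j. \<integral>z. f z \<partial>cut_measure j) \<longlonglongrightarrow> (\<integral>z. f z \<partial>V)"
proof -
  have [measurable]: "f \<in> borel_measurable borel"
    using f by (metis borel_measurable_integrable measurable_cong_sets sets_V)
  show ?thesis unfolding integral_cut[OF \<open>f \<in> borel_measurable borel\<close>]
  proof (rule integral_dominated_convergence)
    show "integrable V (\<lambda>z. norm (f z))" using f by simp
    show "AE z in V. (\<lambda>j. indicator (away j) z *\<^sub>R f z) \<longlonglongrightarrow> f z"
    proof (rule AE_I2)
      fix z
      show "(\<lambda>j. indicator (away j) z *\<^sub>R f z) \<longlonglongrightarrow> f z"
      proof (cases "z = 0")
        case False
        have "\<forall>\<^sub>F j in sequentially. indicator (away j) z *\<^sub>R f z = f z"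
          using indicator_away_tendsto[OF False] by eventually_elim simp
        then show ?thesis by (rule tendsto_eventually)
      qed (simp add: assms)
    qed
    show "AE z in V. norm (indicator (away j) z *\<^sub>R f z) \<le> norm (f z)" for j
      by (auto simp: indicator_def)
  qed measurable
qed

text \<open>Makes \<open>abs_den\<close>, \<open>mult_symbol_eq\<close> and
  \<open>cmod_mult_symbol_le\<close> available for the cut measures.\<close>

lemma levy_cut: "levy_multiplier (cut_measure j) \<phi>"
proof
  show "(\<integral>\<^sup>+x. ennreal (min ((norm x)\<^sup>2) 1) \<partial>cut_measure j) < \<infinity>"
  proof -
    have "(\<integral>\<^sup>+x. ennreal (min ((norm x)\<^sup>2) 1) \<partial>cut_measure j) \<le> (\<integral>\<^sup>+x. ennreal (min ((norm x)\<^sup>2) 1) \<partial>V)"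
      unfolding cut_measure_def by (subst nn_integral_density) (auto intro!: nn_integral_mono simp:
          indicator_def)
    then show ?thesis using V_finite by (rule le_less_trans)
  qed
  fix B :: "'a set" assume B: "B \<in> sets borel"
  have i: "uminus ` B = uminus -` B" by force
  have "uminus -` B \<in> sets borel" using measurable_sets_borel[of uminus borel B] B by simp
  moreover note away_uminus[of j B]
  ultimately show "emeasure (cut_measure j) (uminus ` B) = emeasure (cut_measure j) B"
    unfolding i using B V_sym[of "away j \<inter> B"] by (simp add: emeasure_cut)
qed (auto simp: sets_cut \<phi>_le)

text \<open>Where \<open>den\<close> is nonzero, numerator and denominator converge separately.
  Where it is zero, \<open>1 - cos\<close> has integral 0 over the whole space and hence over each
  \<open>away j\<close>, so all symbols take the default value 0.\<close>

lemma cut_symbol_tendsto: "(\<lambda>j. mult_symbol (cut_measure j) \<phi> \<xi>) \<longlonglongrightarrow> mult_symbol V \<phi> \<xi>"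
proof -
  define dj where "dj j = levy_multiplier.den (cut_measure j) \<xi>" for j
  define nj where "nj j = levy_multiplier.num (cut_measure j) \<phi> \<xi>" for j
  have dj: "dj j = (\<integral>z. cos (\<xi> \<bullet> z) - 1 \<partial>cut_measure j)" for j
    unfolding dj_def by (rule levy_multiplier.den_def[OF levy_cut])
  have nj: "nj j = (\<integral>z. complex_of_real (cos (\<xi> \<bullet> z) - 1) * \<phi> z \<partial>cut_measure j)" for j
    unfolding nj_def by (rule levy_multiplier.num_def[OF levy_cut])
  have dlim: "dj \<longlonglongrightarrow> den \<xi>" unfolding dj den_def by (rule integral_cut_tendsto[OF cos_V_integrable]) simp
  have nlim: "nj \<longlonglongrightarrow> num \<xi>" unfolding nj num_def by (rule integral_cut_tendsto[OF num_V_integrable]) simp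
  have ms: "mult_symbol (cut_measure j) \<phi> \<xi> = (if dj j = 0 then 0 else nj j / complex_of_real (dj j))" for j
    unfolding dj_def nj_def by (rule levy_multiplier.mult_symbol_eq[OF levy_cut])
  show ?thesis
  proof (cases "den \<xi> = 0")
    case True
    have "dj j = 0" for j
    proof -
      have "\<bar>dj j\<bar> = (\<integral>z. indicator (away j) z *\<^sub>R \<bar>cos (\<xi> \<bullet> z) - 1\<bar> \<partial>V)"
        unfolding dj_def levy_multiplier.abs_den[OF levy_cut] by (rule integral_cut) measurable
      also have "\<dots> \<le> (\<integral>z. \<bar>cos (\<xi> \<bullet> z) - 1\<bar> \<partial>V)"
      proof (rule integral_mono)
        show i: "integrable V (\<lambda>z. \<bar>cos (\<xi> \<bullet> z) - 1\<bar>)" by (rule integrable_abs[OF cos_V_integrable])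
        show "integrable V (\<lambda>z. indicator (away j) z *\<^sub>R \<bar>cos (\<xi> \<bullet> z) - 1\<bar>)"
          by (rule Bochner_Integration.integrable_bound[OF i]) (auto simp: indicator_def)
      qed (auto simp: indicator_def)
      also have "\<dots> = 0" using abs_den[of \<xi>] True by simp
      finally show ?thesis by simp
    qed
    then show ?thesis by (simp add: ms mult_symbol_eq True)
  next
    case False
    have "(\<lambda>j. nj j / complex_of_real (dj j)) \<longlonglongrightarrow> num \<xi> / complex_of_real (den \<xi>)"
      using False by (intro tendsto_intros dlim nlim) auto
    moreover have "\<forall>\<^sub>F j in sequentially. dj j \<noteq> 0"
      using dlim False by (rule tendsto_imp_eventually_ne)
    then have "\<forall>\<^sub>F j in sequentially. nj j / complex_of_real (dj j) = mult_symbol (cut_measure j) \<phi> \<xi>"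
      by eventually_elim (simp add: ms)
    ultimately have "(\<lambda>j. mult_symbol (cut_measure j) \<phi> \<xi>) \<longlonglongrightarrow> num \<xi> / complex_of_real (den \<xi>)"
      by (rule Lim_transform_eventually)
    then show ?thesis by (simp add: mult_symbol_eq False)
  qed
qed

lemma cut_symbol_measurable: "mult_symbol (cut_measure j) \<phi> \<in> borel_measurable borel"
proof -
  \<comment> \<open>\<open>finite_jump_bilinear\<close> speaks of an exponent and two test
    functions; for its measurability part the exponent 2 and the zero function serve.\<close>
  have "bounded_support (\<lambda>_::'a. 0)" by (auto simp: bounded_support_def)
  then show ?thesis
    using finite_jump_bilinear(1)[OF finite_cut sets_cut sym_cut \<phi>_measurable \<phi>_le, of 2] by auto
qed

lemma symbol_measurable [measurable]: "mult_symbol V \<phi> \<in> borel_measurable borel"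
  by (rule borel_measurable_LIMSEQ_metric[OF cut_symbol_measurable cut_symbol_tendsto])

text \<open>The estimate for the cut measures is uniform in \<open>j\<close> and their symbols are
  bounded by 1, so dominated convergence removes the cut.\<close>

lemma levy_bilinear:
  fixes f g :: "'a \<Rightarrow> complex"
  assumes p: "p > 1" and q: "q = p / (p - 1)" and C: "C = max p q - 1"
    and f: "bounded_support f" and g: "bounded_support g"
  shows "cmod (\<integral>\<xi>. mult_symbol V \<phi> \<xi> * (fourier f \<xi> * cnj (fourier g \<xi>)) \<partial>lborel)
      \<le> (2 * pi) ^ DIM('a) * (C * (Lp_norm p f powr p / p + Lp_norm q g powr q / q))"
proof -
  have bf: "bdd_L1 f" "bdd_L1 g" using f g by (auto intro: bounded_support_bdd_L1)
  define h where "h \<xi> = fourier f \<xi> * cnj (fourier g \<xi>)" for \<xi>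
  have hi: "integrable lborel h" unfolding h_def by (rule bdd_L1_fourier_product_integrable[OF bf])
  have [measurable]: "h \<in> borel_measurable borel" using hi by auto
  note [measurable] = cut_symbol_measurable
  have "(\<lambda>j. \<integral>\<xi>. mult_symbol (cut_measure j) \<phi> \<xi> * h \<xi> \<partial>lborel) \<longlonglongrightarrow> (\<integral>\<xi>. mult_symbol V \<phi> \<xi> * h \<xi> \<partial>lborel)"
  proof (rule integral_dominated_convergence)
    show "integrable lborel (\<lambda>\<xi>. cmod (h \<xi>))" using hi by simp
    show "AE \<xi> in lborel. (\<lambda>j. mult_symbol (cut_measure j) \<phi> \<xi> * h \<xi>) \<longlonglongrightarrow> mult_symbol V \<phi> \<xi> * h \<xi>"
      by (intro AE_I2 tendsto_intros cut_symbol_tendsto)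
    show "AE \<xi> in lborel. norm (mult_symbol (cut_measure j) \<phi> \<xi> * h \<xi>) \<le> cmod (h \<xi>)" for j
      using levy_multiplier.cmod_mult_symbol_le[OF levy_cut]
      by (intro AE_I2) (simp add: norm_mult mult_left_le_one_le)
  qed measurable
  then have "(\<lambda>j. cmod (\<integral>\<xi>. mult_symbol (cut_measure j) \<phi> \<xi> * h \<xi> \<partial>lborel))
      \<longlonglongrightarrow> cmod (\<integral>\<xi>. mult_symbol V \<phi> \<xi> * h \<xi> \<partial>lborel)"
    by (rule tendsto_norm)
  then show ?thesis
    unfolding h_def[symmetric]
    using finite_jump_bilinear(2)[OF finite_cut sets_cut sym_cut \<phi>_measurable \<phi>_le p q C f g]
    by (intro LIMSEQ_le_const2) (auto simp: h_def)
qed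

end

section \<open>Boundedness of the multiplier operator\<close>

lemma Lp_norm_cong_AE:
  assumes "AE x in lborel. f x = g x"
  shows "Lp_norm p f = Lp_norm p g"
proof -
  have "(\<integral>\<^sup>+x. ennreal (cmod (f x) powr p) \<partial>lborel) = (\<integral>\<^sup>+x. ennreal (cmod (g x) powr p) \<partial>lborel)"
    using assms by (intro nn_integral_cong_AE) auto
  then show ?thesis by (simp add: Lp_norm_def)
qed

lemma Lp_norm_mono:
  assumes p: "p > 0" and g: "in_Lp p g" and f: "f \<in> borel_measurable lborel" and le: "\<And>x. cmod (f x)
      \<le> cmod (g x)"
  shows "in_Lp p f" "Lp_norm p f \<le> Lp_norm p g"
proof -
  have "(\<integral>\<^sup>+x. ennreal (cmod (f x) powr p) \<partial>lborel) \<le> (\<integral>\<^sup>+x. ennreal (cmod (g x) powr p) \<partial>lborel)"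
    using le p by (intro nn_integral_mono ennreal_leI powr_mono2) auto
  also have "\<dots> = ennreal (Lp_norm p g powr p)" by (rule Lp_norm_powr_ennreal[OF g p])
  finally show "in_Lp p f" "Lp_norm p f \<le> Lp_norm p g" using Lp_norm_leI[OF p Lp_norm_nonneg f] by auto
qed

text \<open>The extremal test function |w|^(p-2) w is built from a truncation \<open>w\<close> of
  \<open>u\<close>: this keeps it in the test class and makes the norm of \<open>w\<close> finite,
  so that a power of it can be divided out. Fatou removes the truncation, which also yields
  membership of \<open>u\<close>.\<close>

lemma Lp_converse_Holder:
  fixes u :: "'a::euclidean_space \<Rightarrow> complex"
  assumes p: "p > 1" and q: "q = p / (p
      - 1)" and A: "A \<ge> 0" and um [measurable]: "u \<in> borel_measurable lborel"
    and bound: "\<And>g. bounded_support g \<Longrightarrow> cmod (\<integral>x. u x * cnj (g x) \<partial>lborel) \<le> A * Lp_norm q g"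
  shows "in_Lp p u" "Lp_norm p u \<le> A"
proof -
  have q0: "q > 0" "(p - 1) * q = p" using p by (auto simp: q)
  have trunc: "in_Lp p (truncation n u)" for n
    by (rule bounded_support_in_Lp[OF truncation_bounded_support[OF um]]) (use p in simp)
  have "Lp_norm p (truncation n u) \<le> A" for n
  proof -
    define w where "w = truncation n u"
    have wm [measurable]: "w \<in> borel_measurable lborel" unfolding w_def by measurable
    \<comment> \<open>At zeros of \<open>w\<close> the product is 0 also for exponents below
      2.\<close>
    define g where "g x = complex_of_real (cmod (w x) powr (p - 2)) * w x" for x
    have gabs: "cmod (g x) = cmod (w x) powr (p - 1)" for x
    proof (cases "w x = 0")
      case False
      then have "cmod (w x) powr (p - 2) * cmod (w x) = cmod (w x) powr (p - 2) * cmod (w x) powr 1" by simp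
      also have "\<dots> = cmod (w x) powr (p - 2 + 1)" by (rule powr_add[symmetric])
      finally show ?thesis by (simp add: g_def norm_mult)
    qed (use p in \<open>simp add: g_def\<close>)
    have ug: "u x * cnj (g x) = complex_of_real (cmod (w x) powr p)" for x
    proof (cases "w x = 0")
      case False
      then have [simp]: "u x = w x" by (auto simp: w_def truncation_def split: if_splits)
      have "u x * cnj (g x) = complex_of_real (cmod (w x) powr (p - 2)) * complex_of_real ((cmod (w x))\<^sup>2)"
        unfolding complex_norm_square by (simp add: g_def)
      also have "\<dots> = complex_of_real (cmod (w x) powr (p - 2) * cmod (w x) powr 2)" by simp
      also have "cmod (w x) powr (p - 2) * cmod (w x) powr 2 = cmod (w x) powr (p - 2 + 2)"
          by (rule powr_add[symmetric])
      finally show ?thesis by simp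
    qed (use p in \<open>simp add: g_def\<close>)
    have gbs: "bounded_support g"
      unfolding bounded_support_def
    proof (intro conjI exI allI)
      show "g \<in> borel_measurable lborel" unfolding g_def[abs_def] by measurable
      show "cmod (g x) \<le> real n powr (p - 1)" for x
        unfolding gabs using p by (intro powr_mono2) (auto simp: w_def truncation_def)
      show "norm x > real n \<longrightarrow> g x = 0" for x by (simp add: g_def w_def truncation_def)
    qed
    define s where "s = Lp_norm p w"
    have s0: "s \<ge> 0" by (simp add: s_def)
    have wL: "in_Lp p w" unfolding w_def by (rule trunc)
    have S: "s powr p = (\<integral>x. cmod (w x) powr p \<partial>lborel)" unfolding s_def using p
        by (intro Lp_norm_powr wL) auto
    have gn: "Lp_norm q g = s powr (p - 1)"
    proof -
      have gL: "in_Lp q g" by (rule bounded_support_in_Lp[OF gbs q0(1)])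
      have "Lp_norm q g powr q = s powr p"
        unfolding Lp_norm_powr[OF gL q0(1)] S gabs powr_powr q0(2) ..
      then have "(Lp_norm q g powr q) powr (1 / q) = (s powr p) powr (1 / q)" by simp
      moreover have "p * (1 / q) = p - 1" using q0 p by (simp add: q)
      ultimately show ?thesis using q0 by (simp add: powr_powr)
    qed
    have "(\<integral>x. u x * cnj (g x) \<partial>lborel) = complex_of_real (s powr p)"
      unfolding ug integral_complex_of_real S ..
    then have "s powr p \<le> A * s powr (p - 1)" using bound[OF gbs] by (simp add: gn)
    then have "s powr (p - 1) * s \<le> s powr (p - 1) * A"
      using s0 by (cases "s = 0") (simp_all add: powr_diff mult.commute)
    then have "s \<le> A" using s0 A by (cases "s = 0") simp_all
    then show ?thesis by (simp add: s_def w_def)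
  qed
  then show "in_Lp p u" "Lp_norm p u \<le> A"
    using Lp_Fatou[OF _ trunc um AE_I2[OF truncation_tendsto], of "\<lambda>_. A" A] p by auto
qed

context levy_multiplier
begin

text \<open>Scaling both functions to norm 1 turns the sum of powers into
  \<open>1/p + 1/q = 1\<close>, and bilinearity restores the product of the norms. A function of
  norm 0 has vanishing transform.\<close>

lemma levy_bilinear_homogeneous:
  fixes f g :: "'a \<Rightarrow> complex"
  assumes p: "p > 1" and q: "q = p / (p - 1)" and C: "C = max p q - 1"
    and f: "bounded_support f" and g: "bounded_support g"
  shows "cmod (\<integral>\<xi>. mult_symbol V \<phi> \<xi> * (fourier f \<xi> * cnj (fourier g \<xi>)) \<partial>lborel)
      \<le> (2 * pi) ^ DIM('a) * (C * (Lp_norm p f * Lp_norm q g))"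
proof -
  have q1: "q > 1" "1/p + 1/q = 1" using p by (auto simp: q field_simps)
  have fL: "in_Lp p f" "in_Lp q g" using bounded_support_in_Lp[OF f] bounded_support_in_Lp[OF g] p q1
      by auto
  define a b where "a = Lp_norm p f" and "b = Lp_norm q g"
  have ab: "a \<ge> 0" "b \<ge> 0" by (auto simp: a_def b_def)
  have fourier_0: "fourier h \<xi> = 0" if "in_Lp r h" "r > 0" "Lp_norm r h = 0" for h r and \<xi> :: 'a
  proof -
    have "AE x in lborel. h x = 0" by (rule Lp_norm_eq_0_imp[OF that])
    then have "(\<integral>z. cis (\<xi> \<bullet> z) * h z \<partial>lborel) = (\<integral>z. 0 \<partial>(lborel :: 'a measure))"
      using in_Lp_measurable[OF that(1)] by (intro integral_cong_AE) (auto elim!: eventually_mono)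
    then show ?thesis by (simp add: fourier_def)
  qed
  consider "a = 0" | "b = 0" | "a > 0" "b > 0" using ab by linarith
  then show ?thesis
  proof cases
    case 1
    then show ?thesis using fourier_0[OF fL(1)] p by (simp add: a_def)
  next
    case 2
    then show ?thesis using fourier_0[OF fL(2)] q1 by (simp add: b_def)
  next
    case 3
    define f' g' where "f' x = complex_of_real (1 / a) * f x" and "g' x = complex_of_real (1 / b) * g x"
        for x
    have scale: "bounded_support (\<lambda>x. c * h x)" if h: "bounded_support h" for c and h :: "'a \<Rightarrow> complex"
    proof -
      obtain B R where B: "\<And>x. cmod (h x) \<le> B" "\<And>x. norm x > R \<Longrightarrow> h x
          = 0" and [measurable]: "h \<in> borel_measurable lborel"
        using h unfolding bounded_support_def by blast
      show ?thesis
        unfolding bounded_support_def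
      proof (intro conjI exI allI)
        show "cmod (c * h x) \<le> cmod c * B" for x using B(1)[of x] by (simp add: norm_mult mult_left_mono)
        show "norm x > R \<longrightarrow> c * h x = 0" for x using B(2) by simp
      qed measurable
    qed
    have n: "Lp_norm p f' = 1" "Lp_norm q g' = 1"
      unfolding f'_def g'_def using Lp_norm_cmult[OF fL(1), of "complex_of_real (1 / a)"]
        Lp_norm_cmult[OF fL(2), of "complex_of_real (1 / b)"] p q1 3
            by (simp_all add: norm_divide flip: a_def b_def)
    have eq: "mult_symbol V \<phi> \<xi> * (fourier f' \<xi> * cnj (fourier g' \<xi>))
        = complex_of_real (1 / (a * b)) * (mult_symbol V \<phi> \<xi> * (fourier f \<xi> * cnj (fourier g \<xi>)))" for \<xi>
      unfolding f'_def g'_def fourier_cmult by simp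
    have "cmod (\<integral>\<xi>. mult_symbol V \<phi> \<xi> * (fourier f' \<xi> * cnj (fourier g' \<xi>)) \<partial>lborel) \<le> (2
        * pi) ^ DIM('a) * (C * (1 / p + 1 / q))"
    proof -
      have "bounded_support f'" "bounded_support g'"
        unfolding f'_def[abs_def] g'_def[abs_def] by (rule scale[OF f], rule scale[OF g])
      then show ?thesis using levy_bilinear[OF p q C, of f' g'] unfolding n powr_one_eq_one by blast
    qed
    then have "cmod (complex_of_real (1 / (a * b)) * (\<integral>\<xi>. mult_symbol V \<phi> \<xi> * (fourier f \<xi>
        * cnj (fourier g \<xi>)) \<partial>lborel)) \<le> (2 * pi) ^ DIM('a) * C"
      unfolding eq integral_mult_right_zero q1(2) by simp
    then have "cmod (\<integral>\<xi>. mult_symbol V \<phi> \<xi> * (fourier f \<xi> * cnj (fourier g \<xi>)) \<partial>lborel) / (a * b) \<le> (2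
        * pi) ^ DIM('a) * C"
      using 3 unfolding norm_mult norm_of_real by simp
    then have "cmod (\<integral>\<xi>. mult_symbol V \<phi> \<xi> * (fourier f \<xi> * cnj (fourier g \<xi>)) \<partial>lborel) \<le> ((2
        * pi) ^ DIM('a) * C) * (a * b)"
      using 3 by (subst (asm) pos_divide_le_eq) auto
    then show ?thesis by (simp only: a_def b_def mult.assoc)
  qed
qed

lemma symbol_mult_in_L2:
  assumes F: "in_Lp 2 F"
  shows "in_Lp 2 (\<lambda>\<xi>. mult_symbol V \<phi> \<xi> * F \<xi>)"
proof (rule Lp_norm_mono(1)[OF _ F])
  show "(\<lambda>\<xi>. mult_symbol V \<phi> \<xi> * F \<xi>) \<in> borel_measurable lborel" using in_Lp_measurable[OF F] by measurable
  show "cmod (mult_symbol V \<phi> \<xi> * F \<xi>) \<le> cmod (F \<xi>)" for \<xi>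
    using cmod_mult_symbol_le[of \<xi>] by (simp add: norm_mult mult_left_le_one_le)
qed simp

lemma mult_op_exists:
  assumes f: "in_Lp 2 f"
  shows "\<exists>u. mult_op (mult_symbol V \<phi>) f u"
proof -
  obtain F where F: "L2_fourier f F" using L2_fourier_exists[OF f] .
  obtain u where "L2_fourier u (\<lambda>\<xi>. mult_symbol V \<phi> \<xi> * F \<xi>)"
    using L2_fourier_surj[OF symbol_mult_in_L2[OF L2_fourier_ran[OF F]]] .
  with F show ?thesis unfolding mult_op_def by blast
qed

text \<open>Duality: Parseval's relation identifies the pairing of \<open>u\<close> and
  \<open>g\<close> with the multiplier form, and its factor \<open>K\<close> cancels the one in the
  bilinear estimate. The function \<open>f\<close> is reached in \<open>L^2\<close> by truncations
  whose \<open>L^p\<close> norms do not exceed its own.\<close>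

lemma mult_op_Lp_bound:
  fixes f u :: "'a \<Rightarrow> complex"
  assumes p: "p > 1" and C: "C = max p (p / (p - 1)) - 1"
    and f: "in_Lp p f" "in_Lp 2 f" and u: "mult_op (mult_symbol V \<phi>) f u"
  shows "in_Lp p u" "Lp_norm p u \<le> C * Lp_norm p f"
proof -
  obtain F where F: "L2_fourier f F" and U: "L2_fourier u (\<lambda>\<xi>. mult_symbol V \<phi> \<xi> * F \<xi>)"
    using u unfolding mult_op_def by blast
  define q where "q = p / (p - 1)"
  define K where "K = (2 * pi) ^ DIM('a)"
  have K: "K > 0" by (simp add: K_def)
  have C0: "C \<ge> 0" using p by (simp add: C)
  have fm [measurable]: "f \<in> borel_measurable lborel" by (rule in_Lp_measurable[OF f(1)])
  have bound: "cmod (\<integral>x. u x * cnj (g x) \<partial>lborel) \<le> (C * Lp_norm p f) * Lp_norm q g"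
      if g: "bounded_support g" for g
  proof -
    have gL: "in_Lp 1 g" "in_Lp 2 g" using bounded_support_in_Lp[OF g] by auto
    \<comment> \<open>Symbol and transform of \<open>g\<close> together lie in \<open>L^2\<close>,
      so the form is \<open>L^2\<close>-continuous in \<open>f\<close>.\<close>
    define b where "b \<xi> = mult_symbol V \<phi> \<xi> * cnj (fourier g \<xi>)" for \<xi>
    have b: "in_Lp 2 b" unfolding b_def by (intro symbol_mult_in_L2 in_Lp_cnj plancherel(1) gL)
    define fn where "fn n = truncation n f" for n
    have fnb: "bounded_support (fn n)" for n unfolding fn_def by (rule truncation_bounded_support[OF fm])
    have fnL: "in_Lp 1 (fn n)" "in_Lp 2 (fn n)" for n using bounded_support_in_Lp[OF fnb] by auto
    have "Lp_norm 2 (\<lambda>\<xi>. fourier (fn n) \<xi> - F \<xi>) = sqrt K * Lp_norm 2 (\<lambda>x. f x - fn n x)" for n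
      using L2_fourier_norm[OF L2_fourier_diff[OF L2_fourier_L1[OF fnL] F]]
      by (simp only: K_def Lp_norm_minus_commute[of _ f])
    moreover have "(\<lambda>n. sqrt K * Lp_norm 2 (\<lambda>x. f x - fn n x)) \<longlonglongrightarrow> sqrt K * 0"
      unfolding fn_def by (intro tendsto_mult_left truncation_Lp_tendsto f) simp
    ultimately have l1: "(\<lambda>n. Lp_norm 2 (\<lambda>\<xi>. fourier (fn n) \<xi> - F \<xi>)) \<longlonglongrightarrow> 0" by simp
    have lim: "(\<lambda>n. \<integral>\<xi>. fourier (fn n) \<xi> * b \<xi> \<partial>lborel) \<longlonglongrightarrow> (\<integral>\<xi>. F \<xi> * b \<xi> \<partial>lborel)"
      using L2_product_tendsto[OF plancherel(1)[OF fnL] b L2_fourier_ran[OF F] b l1] by simp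
    have "cmod (\<integral>\<xi>. fourier (fn n) \<xi> * b \<xi> \<partial>lborel) \<le> K * (C * (Lp_norm p f * Lp_norm q g))" for n
    proof -
      have "cmod (\<integral>\<xi>. fourier (fn n) \<xi> * b \<xi> \<partial>lborel) \<le> K * (C * (Lp_norm p (fn n) * Lp_norm q g))"
        using levy_bilinear_homogeneous[OF p q_def C[folded q_def] fnb[of n] g]
            by (simp add: b_def K_def mult_ac)
      also have "\<dots> \<le> K * (C * (Lp_norm p f * Lp_norm q g))"
        unfolding fn_def using K C0 p
        by (intro mult_left_mono mult_right_mono Lp_norm_mono(2)[OF _ f(1)] cmod_truncation_le
            truncation_measurable fm) auto
      finally show ?thesis .
    qed
    then have "cmod (\<integral>\<xi>. F \<xi> * b \<xi> \<partial>lborel) \<le> K * (C * (Lp_norm p f * Lp_norm q g))"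
      using tendsto_norm[OF lim] by (intro LIMSEQ_le_const2) auto
    moreover have "(\<integral>\<xi>. F \<xi> * b \<xi> \<partial>lborel) = complex_of_real K * (\<integral>x. u x * cnj (g x) \<partial>lborel)"
      using L2_fourier_parseval[OF U L2_fourier_L1[OF gL]] by (simp add: b_def K_def mult_ac)
    ultimately have "K * cmod (\<integral>x. u x * cnj (g x) \<partial>lborel) \<le> K * (C * (Lp_norm p f * Lp_norm q g))"
      using K by (simp add: norm_mult)
    then show ?thesis using K by (simp add: mult.assoc)
  qed
  show "in_Lp p u" "Lp_norm p u \<le> C * Lp_norm p f"
    using Lp_converse_Holder[OF p q_def _ in_Lp_measurable[OF L2_fourier_dom[OF U]] bound] C0 by auto
qed

end

section \<open>Uniqueness and linearity of the multiplier relation\<close>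

lemma mult_op_unique:
  assumes "mult_op m f u" "mult_op m f u'"
  shows "ae_eq u u'"
proof -
  obtain F G where F: "L2_fourier f F" "L2_fourier u (\<lambda>\<xi>. m \<xi>
      * F \<xi>)" and G: "L2_fourier f G" "L2_fourier u' (\<lambda>\<xi>. m \<xi> * G \<xi>)"
    using assms unfolding mult_op_def by blast
  have "ae_eq F G" by (rule L2_fourier_unique[OF F(1) G(1)])
  then have "ae_eq (\<lambda>\<xi>. m \<xi> * F \<xi>) (\<lambda>\<xi>. m \<xi> * G \<xi>)" by (auto simp: ae_eq_def)
  then show ?thesis by (rule L2_fourier_inj[OF F(2) G(2)])
qed

lemma mult_op_cong:
  assumes "mult_op m f u" "ae_eq u u'" "u' \<in> borel_measurable lborel"
  shows "mult_op m f u'"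
proof -
  obtain F where F: "L2_fourier f F" "L2_fourier u (\<lambda>\<xi>. m \<xi> * F \<xi>)" using assms unfolding mult_op_def
      by blast
  have "L2_fourier u' (\<lambda>\<xi>. m \<xi> * F \<xi>)"
    using L2_fourier_cong[OF F(2) assms(2) _ assms(3) in_Lp_measurable[OF L2_fourier_ran[OF F(2)]]]
        by (simp add: ae_eq_def)
  then show ?thesis using F(1) unfolding mult_op_def by blast
qed

lemma mult_op_cmult:
  assumes "mult_op m f u"
  shows "mult_op m (\<lambda>x. c * f x) (\<lambda>x. c * u x)"
proof -
  obtain F where F: "L2_fourier f F" "L2_fourier u (\<lambda>\<xi>. m \<xi> * F \<xi>)" using assms unfolding mult_op_def
      by blast
  have "(\<lambda>\<xi>. m \<xi> * (c * F \<xi>)) = (\<lambda>\<xi>. c * (m \<xi> * F \<xi>))" by (simp add: mult_ac)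
  then show ?thesis unfolding mult_op_def using L2_fourier_cmult[OF F(1), of c] L2_fourier_cmult[OF
      F(2), of c] by metis
qed

lemma mult_op_add:
  assumes "mult_op m f u" "mult_op m g v"
  shows "mult_op m (\<lambda>x. f x + g x) (\<lambda>x. u x + v x)"
proof -
  obtain F G where F: "L2_fourier f F" "L2_fourier u (\<lambda>\<xi>. m \<xi>
      * F \<xi>)" and G: "L2_fourier g G" "L2_fourier v (\<lambda>\<xi>. m \<xi> * G \<xi>)"
    using assms unfolding mult_op_def by blast
  have "(\<lambda>\<xi>. m \<xi> * (F \<xi> + G \<xi>)) = (\<lambda>\<xi>. m \<xi> * F \<xi> + m \<xi> * G \<xi>)" by (simp add: distrib_left)
  then show ?thesis unfolding mult_op_def using L2_fourier_add[OF F(1) G(1)] L2_fourier_add[OF F(2)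
      G(2)] by metis
qed

lemma mult_op_diff:
  assumes "mult_op m f u" "mult_op m g v"
  shows "mult_op m (\<lambda>x. f x - g x) (\<lambda>x. u x - v x)"
  using mult_op_add[OF assms(1) mult_op_cmult[OF assms(2), of "-1"]] by simp

lemma ae_eq_if_Lp_norm_le_tendsto_0:
  assumes "in_Lp p u" "in_Lp p v" "p \<ge> 1" "\<And>n::nat. Lp_norm p (\<lambda>x. u x - v x) \<le> a n" "a \<longlonglongrightarrow> 0"
  shows "ae_eq u v"
proof (rule ae_eq_if_Lp_norm_0)
  show "in_Lp p (\<lambda>x. u x - v x)" by (rule in_Lp_diff[OF assms(1,2,3)])
  show "Lp_norm p (\<lambda>x. u x - v x) \<le> 0" using assms(4,5) by (intro LIMSEQ_le_const[of a]) auto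
qed (use assms in simp)

text \<open>\<open>Lp_bounded_linear\<close> gives additivity and homogeneity only almost
  everywhere, so the difference is treated as \<open>f + (-1) * g\<close>.\<close>

lemma Lp_bounded_linear_diff:
  assumes T: "Lp_bounded_linear p T C" and f: "in_Lp p f" "in_Lp p g" and p: "p \<ge> 1"
  shows "Lp_norm p (\<lambda>x. T f x - T g x) \<le> C * Lp_norm p (\<lambda>x. f x - g x)"
proof -
  have mg: "in_Lp p (\<lambda>x. (-1) * g x)" using f p by (intro in_Lp_cmult) auto
  have 1: "ae_eq (T (\<lambda>x. f x + (-1) * g x)) (\<lambda>x. T f x + T (\<lambda>x. (-1) * g x) x)"
    using T f(1) mg unfolding Lp_bounded_linear_def by blast
  have 2: "ae_eq (T (\<lambda>x. (-1) * g x)) (\<lambda>x. (-1) * T g x)"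
    using T f(2) unfolding Lp_bounded_linear_def by blast
  have d: "in_Lp p (\<lambda>x. f x - g x)" by (rule in_Lp_diff[OF f p])
  have L: "in_Lp p (T f)" "in_Lp p (T g)" "in_Lp p (T (\<lambda>x. f x - g x))"
    and n: "Lp_norm p (T (\<lambda>x. f x - g x)) \<le> C * Lp_norm p (\<lambda>x. f x - g x)"
    using T f d unfolding Lp_bounded_linear_def by auto
  have "ae_eq (T (\<lambda>x. f x - g x)) (\<lambda>x. T f x - T g x)"
    using 1 2 unfolding ae_eq_def by (simp, elim AE_mp) (auto intro!: AE_I2)
  then have "Lp_norm p (\<lambda>x. T f x - T g x) = Lp_norm p (T (\<lambda>x. f x - g x))"
    by (intro Lp_norm_cong_AE) (auto simp: ae_eq_def)
  then show ?thesis using n by simp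
qed

theorem theorem1p1:
  fixes V :: "'a::euclidean_space measure" and \<phi> :: "'a \<Rightarrow> complex" and p :: real
  assumes "sets V = sets borel"
    and "emeasure V {0} = 0"
    and "emeasure V (space V) \<noteq> 0"
    and "(\<integral>\<^sup>+x. ennreal (min ((norm x)\<^sup>2) 1) \<partial>V) < \<infinity>"
    and "\<forall>B \<in> sets borel. emeasure V (uminus ` B) = emeasure V B"
    and "\<phi> \<in> borel_measurable borel"
    and "\<forall>z. \<phi> (- z) = \<phi> z"
    and "\<forall>z. cmod (\<phi> z) \<le> 1"
    and "1 < p"
  shows "\<exists>T. Lp_bounded_linear p T (max p (p / (p - 1)) - 1)
           \<and> extends_mult p (mult_symbol V \<phi>) T
           \<and> (\<forall>T' C. Lp_bounded_linear p T' C \<and> extends_mult p (mult_symbol V \<phi>) T'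
                  \<longrightarrow> (\<forall>f. in_Lp p f \<longrightarrow> ae_eq (T' f) (T f)))"
proof -
  interpret levy_multiplier V \<phi> using assms by unfold_locales auto
  define C where "C = max p (p / (p - 1)) - 1"
  define M where "M = mult_symbol V \<phi>"
  have p: "p > 1" "p \<ge> 1" "p > 0" using assms by auto
  have C0: "C \<ge> 0" using p by (simp add: C_def)
  define D where "D = {h :: 'a \<Rightarrow> complex. in_Lp p h \<and> in_Lp 2 h}"
  \<comment> \<open>An arbitrary representative for each \<open>h\<close>; hence \<open>S\<close> is
    linear only up to null sets, by \<open>mult_op_unique\<close>.\<close>
  define S where "S h = (SOME u. mult_op M h u)" for h
  have S: "mult_op M h (S h)" if "h \<in> D" for h
  proof -
    have "\<exists>u. mult_op M h u" unfolding M_def by (rule mult_op_exists) (use that in \<open>simp add: D_def\<close>)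
    then show ?thesis unfolding S_def by (rule someI_ex)
  qed
  have bnd: "in_Lp p u \<and> Lp_norm p u \<le> C * Lp_norm p h" if "h \<in> D" "mult_op M h u" for h u
  proof -
    have h: "in_Lp p h" "in_Lp 2 h" "mult_op (mult_symbol V \<phi>) h u" using that by (auto simp: D_def M_def)
    show ?thesis using mult_op_Lp_bound[OF p(1) C_def h] by simp
  qed
  have SL: "in_Lp p (S h)" if "h \<in> D" for h using bnd[OF that S[OF that]] by simp
  have Ddiff: "(\<lambda>x. h x - k x) \<in> D" and Dadd: "(\<lambda>x. h x + k x) \<in> D" if "h \<in> D" "k \<in> D" for h k
    using that p by (auto simp: D_def intro!: in_Lp_diff in_Lp_add)
  have Dcmult: "(\<lambda>x. c * h x) \<in> D" if "h \<in> D" for h c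
    using that p by (auto simp: D_def intro!: in_Lp_cmult)
  have lip: "Lp_norm p (\<lambda>x. S h x - S k x) \<le> C * Lp_norm p (\<lambda>x. h x - k x)" if "h \<in> D" "k \<in> D" for h k
    using bnd[OF Ddiff[OF that] mult_op_diff[OF S S]] that by simp
  have truncD: "truncation n f \<in> D" if "in_Lp p f" for n f
    using bounded_support_in_Lp[OF truncation_bounded_support[OF in_Lp_measurable[OF that]]] p
        by (auto simp: D_def)
  \<comment> \<open>The distances to all \<open>S h\<close> determine \<open>w\<close> up to null
    sets. Everything below about \<open>T\<close> is derived from this property.\<close>
  define good where "good f w \<longleftrightarrow> in_Lp p w \<and> (\<forall>h\<in>D. Lp_norm p (\<lambda>x. w x - S h x) \<le> C * Lp_norm p (\<lambda>x. f x
      - h x))" for f w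
  have ex: "\<exists>w. good f w" if f: "in_Lp p f" for f
  proof (rule Lp_extension[where p=p and f=f and C=C and D=D and S=S])
    show "\<exists>h\<in>D. Lp_norm p (\<lambda>x. f x - h x) < e" if "e > 0" for e
    proof -
      have "\<forall>\<^sub>F n in sequentially. Lp_norm p (\<lambda>x. f x - truncation n f x) < e"
        using truncation_Lp_tendsto[OF p(3) f] that by (rule order_tendstoD)
      then show ?thesis using truncD[OF f] by (auto simp: eventually_sequentially)
    qed
    show "\<exists>w. good f w" if "in_Lp p w" "\<And>h. h \<in> D \<Longrightarrow> Lp_norm p (\<lambda>x. w x - S h x) \<le> C * Lp_norm p (\<lambda>x. f x
        - h x)" for w
      using that unfolding good_def by blast
  qed (use p f C0 SL lip in \<open>auto simp: D_def\<close>)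
  define T where "T f = (SOME w. good f w)" for f
  have "good f (T f)" if "in_Lp p f" for f unfolding T_def using ex[OF that] by (rule someI_ex)
  then have TL: "in_Lp p (T f)"
    and TS: "h \<in> D \<Longrightarrow> Lp_norm p (\<lambda>x. T f x - S h x) \<le> C * Lp_norm p (\<lambda>x. f x - h x)"
    if "in_Lp p f" for f h using that unfolding good_def by blast+
  define t where "t f n = C * Lp_norm p (\<lambda>x. f x - truncation n f x)" for f :: "'a \<Rightarrow> complex" and n
  have t0: "t f \<longlonglongrightarrow> 0" if "in_Lp p f" for f
    using tendsto_mult_left[OF truncation_Lp_tendsto[OF p(3) that], of C] by (simp add: t_def[abs_def])
  have Tt: "Lp_norm p (\<lambda>x. T f x - S (truncation n f) x) \<le> t f n" if "in_Lp p f" for f n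
    unfolding t_def by (rule TS[OF that truncD[OF that]])
  \<comment> \<open>Comparison with \<open>h = 0\<close>: the chosen representative
    \<open>S 0\<close> has norm 0.\<close>
  have bounded: "Lp_norm p (T f) \<le> C * Lp_norm p f" if f: "in_Lp p f" for f
  proof -
    have 0: "(\<lambda>x. 0) \<in> D" by (simp add: D_def)
    have "Lp_norm p (T f) \<le> Lp_norm p (\<lambda>x. T f x - S (\<lambda>x. 0) x) + Lp_norm p (S (\<lambda>x. 0))"
      by (rule Lp_norm_triangle_ineq2[OF TL[OF f] SL[OF 0] p(2)])
    also have "Lp_norm p (S (\<lambda>x. 0)) \<le> 0" using bnd[OF 0 S[OF 0]] by simp
    finally show ?thesis using TS[OF f 0] by simp
  qed
  have add: "ae_eq (T (\<lambda>x. f x + g x)) (\<lambda>x. T f x + T g x)" if f: "in_Lp p f" and g: "in_Lp p g" for f g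
  proof (rule ae_eq_if_Lp_norm_le_tendsto_0)
    note fg = in_Lp_add[OF f g p(2)]
    show "in_Lp p (T (\<lambda>x. f x + g x))" "in_Lp p (\<lambda>x. T f x + T g x)"
      using TL[OF fg] in_Lp_add[OF TL[OF f] TL[OF g] p(2)] by auto
    \<comment> \<open>One half of the bound is the error of \<open>T\<close> at
      \<open>f + g\<close>, the other the sum of its errors at \<open>f\<close> and at
      \<open>g\<close>; on the truncations themselves \<open>S\<close> is additive.\<close>
    show "Lp_norm p (\<lambda>x. T (\<lambda>x. f x + g x) x - (T f x + T g x)) \<le> 2 * (t f n + t g n)" for n
    proof -
      define h k where "h = truncation n f" and "k = truncation n g"
      have hk: "h \<in> D" "k \<in> D" using truncD f g by (auto simp: h_def k_def)
      have dL: "in_Lp p (\<lambda>x. f x - h x)" "in_Lp p (\<lambda>x. g x - k x)"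
        using in_Lp_diff[OF f _ p(2), of h] in_Lp_diff[OF g _ p(2), of k] hk by (auto simp: D_def)
      have "mult_op M (\<lambda>x. h x + k x) (\<lambda>x. S h x + S k x)" by (rule mult_op_add[OF S[OF hk(1)] S[OF hk(2)]])
      then have ae: "ae_eq (S (\<lambda>x. h x + k x)) (\<lambda>x. S h x + S k x)"
          by (rule mult_op_unique[OF S[OF Dadd[OF hk]]])
      have sL: "in_Lp p (\<lambda>x. S h x + S k x)" by (rule in_Lp_add[OF SL[OF hk(1)] SL[OF hk(2)] p(2)])
      have "Lp_norm p (\<lambda>x. T (\<lambda>x. f x + g x) x - (T f x + T g x))
          \<le> Lp_norm p (\<lambda>x. T (\<lambda>x. f x + g x) x - (S h x + S k x)) + Lp_norm p (\<lambda>x. (S h x + S k x)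
              - (T f x + T g x))"
        by (rule Lp_norm_dist_triangle[OF TL[OF fg] sL in_Lp_add[OF TL[OF f] TL[OF g] p(2)] p(2)])
      also have "Lp_norm p (\<lambda>x. T (\<lambda>x. f x + g x) x - (S h x + S k x)) = Lp_norm p (\<lambda>x. T (\<lambda>x. f x
          + g x) x - S (\<lambda>x. h x + k x) x)"
        using ae by (intro Lp_norm_cong_AE) (auto simp: ae_eq_def)
      also have "\<dots> \<le> C * Lp_norm p (\<lambda>x. (f x + g x) - (h x + k x))" by (rule TS[OF fg Dadd[OF hk]])
      also have "\<dots> = C * Lp_norm p (\<lambda>x. (f x - h x) + (g x - k x))" by (simp add: algebra_simps)
      also have "\<dots> \<le> C * (Lp_norm p (\<lambda>x. f x - h x) + Lp_norm p (\<lambda>x. g x - k x))"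
        using C0 by (intro mult_left_mono Lp_norm_triangle dL p) auto
      also have "\<dots> = t f n + t g n" by (simp add: t_def h_def k_def distrib_left)
      also have "Lp_norm p (\<lambda>x. (S h x + S k x) - (T f x + T g x)) = Lp_norm p (\<lambda>x. (T f x - S h x)
          + (T g x - S k x))"
        using Lp_norm_minus_commute[of p "\<lambda>x. S h x + S k x" "\<lambda>x. T f x + T g x"]
            by (simp add: algebra_simps)
      also have "\<dots> \<le> Lp_norm p (\<lambda>x. T f x - S h x) + Lp_norm p (\<lambda>x. T g x - S k x)"
        using in_Lp_diff[OF TL[OF f] SL[OF hk(1)] p(2)] in_Lp_diff[OF TL[OF g] SL[OF hk(2)] p(2)] p(2)
            by (rule Lp_norm_triangle)
      also have "\<dots> \<le> t f n + t g n" unfolding h_def k_def by (intro add_mono Tt f g)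
      finally show ?thesis by simp
    qed
    show "(\<lambda>n. 2 * (t f n + t g n)) \<longlonglongrightarrow> 0"
      using tendsto_mult_left[OF tendsto_add[OF t0[OF f] t0[OF g]], of 2] by simp
  qed (rule p)
  have cmult: "ae_eq (T (\<lambda>x. c * f x)) (\<lambda>x. c * T f x)" if f: "in_Lp p f" for f c
  proof (rule ae_eq_if_Lp_norm_le_tendsto_0)
    note cf = in_Lp_cmult[OF f p(3), of c]
    note cT = in_Lp_cmult[OF TL[OF f] p(3), of c]
    show "in_Lp p (T (\<lambda>x. c * f x))" by (rule TL[OF cf])
    show "in_Lp p (\<lambda>x. c * T f x)" by (rule cT)
    show "Lp_norm p (\<lambda>x. T (\<lambda>x. c * f x) x - c * T f x) \<le> 2 * (cmod c * t f n)" for n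
    proof -
      define h where "h = truncation n f"
      have h: "h \<in> D" using truncD f by (auto simp: h_def)
      have hL: "in_Lp p h" using h by (simp add: D_def)
      have ae: "ae_eq (S (\<lambda>x. c * h x)) (\<lambda>x. c * S h x)"
          by (rule mult_op_unique[OF S[OF Dcmult[OF h]] mult_op_cmult[OF S[OF h]]])
      have sL: "in_Lp p (\<lambda>x. c * S h x)" by (rule in_Lp_cmult[OF SL[OF h] p(3)])
      have "Lp_norm p (\<lambda>x. T (\<lambda>x. c * f x) x - c * T f x)
          \<le> Lp_norm p (\<lambda>x. T (\<lambda>x. c * f x) x - c * S h x) + Lp_norm p (\<lambda>x. c * S h x - c * T f x)"
        by (rule Lp_norm_dist_triangle[OF TL[OF cf] sL cT p(2)])
      also have "Lp_norm p (\<lambda>x. T (\<lambda>x. c * f x) x - c * S h x) = Lp_norm p (\<lambda>x. T (\<lambda>x. c * f x) x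
          - S (\<lambda>x. c * h x) x)"
        using ae by (intro Lp_norm_cong_AE) (auto simp: ae_eq_def)
      also have "\<dots> \<le> C * Lp_norm p (\<lambda>x. c * f x - c * h x)" by (rule TS[OF cf Dcmult[OF h]])
      also have "\<dots> = cmod c * t f n"
        using Lp_norm_cmult[OF in_Lp_diff[OF f hL p(2)] p(3), of c]
            by (simp add: t_def h_def right_diff_distrib mult_ac)
      also have "Lp_norm p (\<lambda>x. c * S h x - c * T f x) = cmod c * Lp_norm p (\<lambda>x. T f x - S h x)"
        using Lp_norm_cmult[OF in_Lp_diff[OF SL[OF h] TL[OF f] p(2)] p(3), of c]
        by (simp add: right_diff_distrib Lp_norm_minus_commute[of p "T f"])
      also have "\<dots> \<le> cmod c * t f n" unfolding h_def by (intro mult_left_mono Tt f) simp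
      finally show ?thesis by simp
    qed
    show "(\<lambda>n. 2 * (cmod c * t f n)) \<longlonglongrightarrow> 0"
      using tendsto_mult_left[OF tendsto_mult_left[OF t0[OF f]], of 2 "cmod c"] by simp
  qed (rule p)
  have lin: "Lp_bounded_linear p T C"
    unfolding Lp_bounded_linear_def by (intro conjI allI impI TL bounded add cmult)
  have ext: "extends_mult p M T"
    unfolding extends_mult_def
  proof (intro allI impI)
    fix f :: "'a \<Rightarrow> complex" assume f: "in_Lp p f \<and> in_Lp 2 f"
    then have fD: "f \<in> D" by (simp add: D_def)
    \<comment> \<open>Here \<open>f\<close> itself belongs to \<open>D\<close> and can serve as its
      own approximant.\<close>
    have "Lp_norm p (\<lambda>x. T f x - S f x) \<le> 0" using TS[OF conjunct1[OF f] fD] by simp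
    then have ae: "ae_eq (T f) (S f)"
      using in_Lp_diff[OF TL[OF conjunct1[OF f]] SL[OF fD] p(2)] p by (intro ae_eq_if_Lp_norm_0) auto
    show "mult_op M f (T f)"
      by (rule mult_op_cong[OF S[OF fD] ae_eq_sym[OF ae] in_Lp_measurable[OF TL[OF conjunct1[OF f]]]])
  qed
  have uniq: "ae_eq (T' f) (T f)"
    if T': "Lp_bounded_linear p T' C'" "extends_mult p M T'" and f: "in_Lp p f" for T' C' f
  proof (rule ae_eq_if_Lp_norm_le_tendsto_0)
    have T'L: "in_Lp p (T' h)" if "in_Lp p h" for h using T'(1) that unfolding Lp_bounded_linear_def
        by blast
    show "in_Lp p (T' f)" "in_Lp p (T f)" using T'L TL f by auto
    \<comment> \<open>Two extensions agree on truncations, and each is Lipschitz with its own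
      constant.\<close>
    show "Lp_norm p (\<lambda>x. T' f x - T f x) \<le> (C' + C) * Lp_norm p (\<lambda>x. f x - truncation n f x)" for n
    proof -
      define h where "h = truncation n f"
      have h: "h \<in> D" using truncD f by (auto simp: h_def)
      then have hL: "in_Lp p h" by (simp add: D_def)
      have "mult_op M h (T' h)" "mult_op M h (T h)" using T'(2) ext h unfolding extends_mult_def D_def
          by auto
      then have ae: "ae_eq (T' h) (T h)" by (rule mult_op_unique)
      have "Lp_norm p (\<lambda>x. T' f x - T f x) \<le> Lp_norm p (\<lambda>x. T' f x - T' h x) + Lp_norm p (\<lambda>x. T' h x
          - T f x)"
        using T'L TL f hL p by (intro Lp_norm_dist_triangle) auto
      also have "Lp_norm p (\<lambda>x. T' h x - T f x) = Lp_norm p (\<lambda>x. T h x - T f x)"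
        using ae by (intro Lp_norm_cong_AE) (auto simp: ae_eq_def)
      also have "\<dots> \<le> C * Lp_norm p (\<lambda>x. f x - h x)"
        using Lp_bounded_linear_diff[OF lin hL f p(2)] by (simp add: Lp_norm_minus_commute[of p h])
      also have "Lp_norm p (\<lambda>x. T' f x - T' h x) \<le> C' * Lp_norm p (\<lambda>x. f x - h x)"
        by (rule Lp_bounded_linear_diff[OF T'(1) f hL p(2)])
      finally show ?thesis by (simp add: h_def distrib_right)
    qed
    show "(\<lambda>n. (C' + C) * Lp_norm p (\<lambda>x. f x - truncation n f x)) \<longlonglongrightarrow> 0"
      using tendsto_mult_left[OF truncation_Lp_tendsto[OF p(3) f], of "C' + C"] by simp
  qed (rule p)
  show ?thesis
    unfolding C_def[symmetric] M_def[symmetric]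
    by (intro exI[of _ T] conjI lin ext allI impI) (erule conjE, rule uniq)
qed

end
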